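(* Let $\mathcal{C}$ be a spherical fusion category over $\mathbb{C}$ and let $X\in\mathcal{O}(\mathcal{C})$. If $X^{\otimes n}\cong\mathbbm{1}_{\mathcal{C}}$ for some $n\in\mathbb{Z}_{\geq1}$, then $\theta_Y^n=\theta_{Y'}^n$ for all simple summands $Y,Y'\subset I(X)$ in $\mathcal{Z}(\mathcal{C})$.
   Context: $\mathcal{O}(\mathcal{C})$ is the set of isomorphism classes of simple objects of the fusion category $\mathcal{C}$ and $\mathbbm{1}_{\mathcal{C}}$ is its monoidal unit. $\mathcal{Z}(\mathcal{C})$ is the Drinfeld center of $\mathcal{C}$, a modular tensor category with the spherical structure induced from that of $\mathcal{C}$; $\theta_Y$ denotes the twist (a root of unity) of a simple object $Y$ of $\mathcal{Z}(\mathcal{C})$. $F:\mathcal{Z}(\mathcal{C})\to\mathcal{C}$ is the forgetful functor and $I:\mathcal{C}\to\mathcal{Z}(\mathcal{C})$ is its adjoint (induction), so $\mathrm{Hom}_{\mathcal{Z}(\mathcal{C})}(I(X),Y)\cong\mathrm{Hom}_{\mathcal{C}}(X,F(Y))$. *)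

theory Defs
  imports Complex_Main "HOL-Library.FuncSet"
begin

text \<open>
  Small \<^emph>\<open>complex-linear categories\<close>.  The hom spaces are subspaces of one ambient complex vector
  space \<^typ>\<open>'m\<close> with scalar multiplication \<open>scl\<close>, so that addition of morphisms is the addition
  of \<^typ>\<open>'m\<close>.  Hom spaces between different pairs of objects may overlap (they all contain 0), so a
  morphism does not determine its source and target; these are passed along where they matter.
  Every small complex-linear category has this form up to isomorphism: take for \<^typ>\<open>'m\<close> the
  direct sum of all its hom spaces.  Composition and tensor product of morphisms need no object
  arguments, since they are bilinear and hence send 0 to 0.
\<close>

record ('o, 'm) linear_cat =
  obj :: "'o set"
  hom :: "'o \<Rightarrow> 'o \<Rightarrow> 'm set"
  idm :: "'o \<Rightarrow> 'm" ("\<i>\<index>")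
  cmp :: "'m \<Rightarrow> 'm \<Rightarrow> 'm" (infixr "\<cdot>\<index>" 66)
  scl :: "complex \<Rightarrow> 'm \<Rightarrow> 'm"

locale linear_category =
  fixes C :: "('o, 'm::ab_group_add, 'z) linear_cat_scheme" (structure)
  assumes vector_space_scl: "vector_space (scl C)"
    and hom_subspace: "\<lbrakk>X \<in> obj C; Y \<in> obj C\<rbrakk> \<Longrightarrow> module.subspace (scl C) (hom C X Y)"
    and idm_in_hom: "X \<in> obj C \<Longrightarrow> \<i> X \<in> hom C X X"
    and cmp_in_hom: "\<lbrakk>X \<in> obj C; Y \<in> obj C; Z \<in> obj C; f \<in> hom C X Y; g \<in> hom C Y Z\<rbrakk>
      \<Longrightarrow> g \<cdot> f \<in> hom C X Z"
    and cmp_assoc: "\<lbrakk>W \<in> obj C; X \<in> obj C; Y \<in> obj C; Z \<in> obj C;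
      f \<in> hom C W X; g \<in> hom C X Y; h \<in> hom C Y Z\<rbrakk> \<Longrightarrow> (h \<cdot> g) \<cdot> f = h \<cdot> (g \<cdot> f)"
    and cmp_idm_left: "\<lbrakk>X \<in> obj C; Y \<in> obj C; f \<in> hom C X Y\<rbrakk> \<Longrightarrow> \<i> Y \<cdot> f = f"
    and cmp_idm_right: "\<lbrakk>X \<in> obj C; Y \<in> obj C; f \<in> hom C X Y\<rbrakk> \<Longrightarrow> f \<cdot> \<i> X = f"
    and cmp_add_left: "\<lbrakk>X \<in> obj C; Y \<in> obj C; Z \<in> obj C;
      f \<in> hom C X Y; g \<in> hom C Y Z; g' \<in> hom C Y Z\<rbrakk> \<Longrightarrow> (g + g') \<cdot> f = (g \<cdot> f) + (g' \<cdot> f)"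
    and cmp_add_right: "\<lbrakk>X \<in> obj C; Y \<in> obj C; Z \<in> obj C;
      f \<in> hom C X Y; f' \<in> hom C X Y; g \<in> hom C Y Z\<rbrakk> \<Longrightarrow> g \<cdot> (f + f') = (g \<cdot> f) + (g \<cdot> f')"
    and cmp_scl_left: "\<lbrakk>X \<in> obj C; Y \<in> obj C; Z \<in> obj C; f \<in> hom C X Y; g \<in> hom C Y Z\<rbrakk>
      \<Longrightarrow> scl C a g \<cdot> f = scl C a (g \<cdot> f)"
    and cmp_scl_right: "\<lbrakk>X \<in> obj C; Y \<in> obj C; Z \<in> obj C; f \<in> hom C X Y; g \<in> hom C Y Z\<rbrakk>
      \<Longrightarrow> g \<cdot> scl C a f = scl C a (g \<cdot> f)"

context
  fixes C :: "('o, 'm::ab_group_add, 'z) linear_cat_scheme" (structure)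
begin

definition inverses :: "'o \<Rightarrow> 'o \<Rightarrow> 'm \<Rightarrow> 'm \<Rightarrow> bool" where
  "inverses X Y f g \<longleftrightarrow> f \<in> hom C X Y \<and> g \<in> hom C Y X \<and> g \<cdot> f = \<i> X \<and> f \<cdot> g = \<i> Y"

definition is_iso :: "'o \<Rightarrow> 'o \<Rightarrow> 'm \<Rightarrow> bool" where
  "is_iso X Y f \<longleftrightarrow> (\<exists>g. inverses X Y f g)"

definition inv_mor :: "'o \<Rightarrow> 'o \<Rightarrow> 'm \<Rightarrow> 'm" where
  "inv_mor X Y f = (THE g. inverses X Y f g)"

definition isomorphic :: "'o \<Rightarrow> 'o \<Rightarrow> bool" where
  "isomorphic X Y \<longleftrightarrow> X \<in> obj C \<and> Y \<in> obj C \<and> (\<exists>f. is_iso X Y f)"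

definition is_zero :: "'o \<Rightarrow> bool" where
  "is_zero X \<longleftrightarrow> X \<in> obj C \<and> (\<forall>Y\<in>obj C. hom C X Y = {0} \<and> hom C Y X = {0})"

definition is_mono :: "'o \<Rightarrow> 'o \<Rightarrow> 'm \<Rightarrow> bool" where
  "is_mono X Y f \<longleftrightarrow> f \<in> hom C X Y \<and>
     (\<forall>W\<in>obj C. \<forall>g\<in>hom C W X. \<forall>h\<in>hom C W X. f \<cdot> g = f \<cdot> h \<longrightarrow> g = h)"

definition is_epi :: "'o \<Rightarrow> 'o \<Rightarrow> 'm \<Rightarrow> bool" where
  "is_epi X Y f \<longleftrightarrow> f \<in> hom C X Y \<and>
     (\<forall>W\<in>obj C. \<forall>g\<in>hom C Y W. \<forall>h\<in>hom C Y W. g \<cdot> f = h \<cdot> f \<longrightarrow> g = h)"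

definition is_kernel :: "'o \<Rightarrow> 'm \<Rightarrow> 'o \<Rightarrow> 'o \<Rightarrow> 'm \<Rightarrow> bool" where
  "is_kernel K k X Y f \<longleftrightarrow> K \<in> obj C \<and> k \<in> hom C K X \<and> f \<cdot> k = 0 \<and>
     (\<forall>W\<in>obj C. \<forall>g\<in>hom C W X. f \<cdot> g = 0 \<longrightarrow> (\<exists>!u. u \<in> hom C W K \<and> k \<cdot> u = g))"

definition is_cokernel :: "'o \<Rightarrow> 'm \<Rightarrow> 'o \<Rightarrow> 'o \<Rightarrow> 'm \<Rightarrow> bool" where
  "is_cokernel Q q X Y f \<longleftrightarrow> Q \<in> obj C \<and> q \<in> hom C Y Q \<and> q \<cdot> f = 0 \<and>
     (\<forall>W\<in>obj C. \<forall>g\<in>hom C Y W. g \<cdot> f = 0 \<longrightarrow> (\<exists>!u. u \<in> hom C Q W \<and> u \<cdot> q = g))"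

definition is_direct_sum :: "'o \<Rightarrow> 'o \<Rightarrow> 'o \<Rightarrow> bool" where
  "is_direct_sum S A B \<longleftrightarrow> S \<in> obj C \<and> A \<in> obj C \<and> B \<in> obj C \<and>
     (\<exists>i\<in>hom C A S. \<exists>j\<in>hom C B S. \<exists>p\<in>hom C S A. \<exists>q\<in>hom C S B.
        p \<cdot> i = \<i> A \<and> q \<cdot> j = \<i> B \<and> q \<cdot> i = 0 \<and> p \<cdot> j = 0 \<and> (i \<cdot> p) + (j \<cdot> q) = \<i> S)"

definition is_finite_direct_sum :: "'o \<Rightarrow> nat \<Rightarrow> (nat \<Rightarrow> 'o) \<Rightarrow> bool" where
  "is_finite_direct_sum S n A \<longleftrightarrow> S \<in> obj C \<and> (\<forall>k<n. A k \<in> obj C) \<and>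
     (\<exists>i p. (\<forall>k<n. i k \<in> hom C (A k) S \<and> p k \<in> hom C S (A k)) \<and>
            (\<forall>k<n. \<forall>l<n. p k \<cdot> i l = (if k = l then \<i> (A k) else 0)) \<and>
            (\<Sum>k<n. i k \<cdot> p k) = \<i> S)"

definition abelian :: bool where
  "abelian \<longleftrightarrow>
     (\<exists>X. is_zero X) \<and>
     (\<forall>A\<in>obj C. \<forall>B\<in>obj C. \<exists>S. is_direct_sum S A B) \<and>
     (\<forall>X\<in>obj C. \<forall>Y\<in>obj C. \<forall>f\<in>hom C X Y.
        (\<exists>K k. is_kernel K k X Y f) \<and> (\<exists>Q q. is_cokernel Q q X Y f)) \<and>
     (\<forall>X\<in>obj C. \<forall>Y\<in>obj C. \<forall>f. is_mono X Y f \<longrightarrow>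
        (\<exists>Z\<in>obj C. \<exists>g\<in>hom C Y Z. is_kernel X f Y Z g)) \<and>
     (\<forall>X\<in>obj C. \<forall>Y\<in>obj C. \<forall>f. is_epi X Y f \<longrightarrow>
        (\<exists>Z\<in>obj C. \<exists>g\<in>hom C Z X. is_cokernel Y f Z X g))"

definition simple :: "'o \<Rightarrow> bool" where
  "simple X \<longleftrightarrow> X \<in> obj C \<and> \<not> is_zero X \<and>
     (\<forall>W\<in>obj C. \<forall>f. is_mono W X f \<longrightarrow> is_zero W \<or> is_iso W X f)"

definition semisimple :: bool where
  "semisimple \<longleftrightarrow> (\<forall>X\<in>obj C. \<exists>n A. (\<forall>k<n. simple (A k)) \<and> is_finite_direct_sum X n A)"

definition simple_summand :: "'o \<Rightarrow> 'o \<Rightarrow> bool" where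
  "simple_summand Y A \<longleftrightarrow> simple Y \<and> (\<exists>B. is_direct_sum A Y B)"

end

text \<open>
  Functors and adjunctions.  The action of a functor on morphisms takes source and target as
  additional arguments because hom spaces may overlap.
\<close>

definition is_functor ::
  "('o, 'm, 'z) linear_cat_scheme \<Rightarrow> ('p, 'n, 'y) linear_cat_scheme \<Rightarrow>
   ('o \<Rightarrow> 'p) \<Rightarrow> ('o \<Rightarrow> 'o \<Rightarrow> 'm \<Rightarrow> 'n) \<Rightarrow> bool" where
  "is_functor C D Fo Fm \<longleftrightarrow>
     (\<forall>X\<in>obj C. Fo X \<in> obj D \<and> Fm X X (idm C X) = idm D (Fo X)) \<and>
     (\<forall>X\<in>obj C. \<forall>Y\<in>obj C. \<forall>f\<in>hom C X Y. Fm X Y f \<in> hom D (Fo X) (Fo Y)) \<and>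
     (\<forall>X\<in>obj C. \<forall>Y\<in>obj C. \<forall>Z\<in>obj C. \<forall>f\<in>hom C X Y. \<forall>g\<in>hom C Y Z.
        Fm X Z (g \<cdot>\<^bsub>C\<^esub> f) = Fm Y Z g \<cdot>\<^bsub>D\<^esub> Fm X Y f)"

definition left_adjoint ::
  "('o, 'm, 'z) linear_cat_scheme \<Rightarrow> ('p, 'n, 'y) linear_cat_scheme \<Rightarrow>
   ('o \<Rightarrow> 'p) \<Rightarrow> ('o \<Rightarrow> 'o \<Rightarrow> 'm \<Rightarrow> 'n) \<Rightarrow>
   ('p \<Rightarrow> 'o) \<Rightarrow> ('p \<Rightarrow> 'p \<Rightarrow> 'n \<Rightarrow> 'm) \<Rightarrow> bool" where
  "left_adjoint C D Lo Lm Ro Rm \<longleftrightarrow>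
     is_functor C D Lo Lm \<and> is_functor D C Ro Rm \<and>
     (\<exists>\<phi>. (\<forall>X\<in>obj C. \<forall>Y\<in>obj D. bij_betw (\<phi> X Y) (hom D (Lo X) Y) (hom C X (Ro Y))) \<and>
          (\<forall>X\<in>obj C. \<forall>X'\<in>obj C. \<forall>Y\<in>obj D. \<forall>f\<in>hom C X' X. \<forall>h\<in>hom D (Lo X) Y.
             \<phi> X' Y (h \<cdot>\<^bsub>D\<^esub> Lm X' X f) = \<phi> X Y h \<cdot>\<^bsub>C\<^esub> f) \<and>
          (\<forall>X\<in>obj C. \<forall>Y\<in>obj D. \<forall>Y'\<in>obj D. \<forall>g\<in>hom D Y Y'. \<forall>h\<in>hom D (Lo X) Y.
             \<phi> X Y' (g \<cdot>\<^bsub>D\<^esub> h) = Rm Y Y' g \<cdot>\<^bsub>C\<^esub> \<phi> X Y h))"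

text \<open>
  Monoidal categories: \<open>asc X Y Z : (X \<otimes> Y) \<otimes> Z \<rightarrow> X \<otimes> (Y \<otimes> Z)\<close>, \<open>lun X : \<one> \<otimes> X \<rightarrow> X\<close>,
  \<open>run X : X \<otimes> \<one> \<rightarrow> X\<close>.  The tensor product of morphisms is written \<open>f \<odot> g\<close>.
\<close>

record ('o, 'm) monoidal_cat = "('o, 'm) linear_cat" +
  tobj :: "'o \<Rightarrow> 'o \<Rightarrow> 'o" (infixl "\<otimes>\<index>" 70)
  tmor :: "'m \<Rightarrow> 'm \<Rightarrow> 'm" (infixl "\<odot>\<index>" 70)
  unit :: "'o" ("\<one>\<index>")
  asc :: "'o \<Rightarrow> 'o \<Rightarrow> 'o \<Rightarrow> 'm"
  lun :: "'o \<Rightarrow> 'm"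
  run :: "'o \<Rightarrow> 'm"

locale monoidal_linear_category = linear_category C
  for C :: "('o, 'm::ab_group_add, 'z) monoidal_cat_scheme" (structure) +
  assumes unit_obj: "\<one> \<in> obj C"
    and tobj_obj: "\<lbrakk>X \<in> obj C; Y \<in> obj C\<rbrakk> \<Longrightarrow> X \<otimes> Y \<in> obj C"
    and tmor_in_hom: "\<lbrakk>X \<in> obj C; Y \<in> obj C; X' \<in> obj C; Y' \<in> obj C;
      f \<in> hom C X Y; f' \<in> hom C X' Y'\<rbrakk> \<Longrightarrow> f \<odot> f' \<in> hom C (X \<otimes> X') (Y \<otimes> Y')"
    and tmor_idm: "\<lbrakk>X \<in> obj C; Y \<in> obj C\<rbrakk> \<Longrightarrow> \<i> X \<odot> \<i> Y = \<i> (X \<otimes> Y)"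
    and tmor_cmp: "\<lbrakk>X \<in> obj C; Y \<in> obj C; Z \<in> obj C; X' \<in> obj C; Y' \<in> obj C; Z' \<in> obj C;
      f \<in> hom C X Y; g \<in> hom C Y Z; f' \<in> hom C X' Y'; g' \<in> hom C Y' Z'\<rbrakk>
      \<Longrightarrow> (g \<cdot> f) \<odot> (g' \<cdot> f') = (g \<odot> g') \<cdot> (f \<odot> f')"
    and tmor_add_left: "\<lbrakk>X \<in> obj C; Y \<in> obj C; X' \<in> obj C; Y' \<in> obj C;
      f \<in> hom C X Y; g \<in> hom C X Y; h \<in> hom C X' Y'\<rbrakk> \<Longrightarrow> (f + g) \<odot> h = (f \<odot> h) + (g \<odot> h)"
    and tmor_add_right: "\<lbrakk>X \<in> obj C; Y \<in> obj C; X' \<in> obj C; Y' \<in> obj C;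
      h \<in> hom C X Y; f \<in> hom C X' Y'; g \<in> hom C X' Y'\<rbrakk> \<Longrightarrow> h \<odot> (f + g) = (h \<odot> f) + (h \<odot> g)"
    and tmor_scl_left: "\<lbrakk>X \<in> obj C; Y \<in> obj C; X' \<in> obj C; Y' \<in> obj C;
      f \<in> hom C X Y; h \<in> hom C X' Y'\<rbrakk> \<Longrightarrow> scl C a f \<odot> h = scl C a (f \<odot> h)"
    and tmor_scl_right: "\<lbrakk>X \<in> obj C; Y \<in> obj C; X' \<in> obj C; Y' \<in> obj C;
      h \<in> hom C X Y; f \<in> hom C X' Y'\<rbrakk> \<Longrightarrow> h \<odot> scl C a f = scl C a (h \<odot> f)"
    and asc_iso: "\<lbrakk>X \<in> obj C; Y \<in> obj C; Z \<in> obj C\<rbrakk>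
      \<Longrightarrow> is_iso C ((X \<otimes> Y) \<otimes> Z) (X \<otimes> (Y \<otimes> Z)) (asc C X Y Z)"
    and asc_natural: "\<lbrakk>X \<in> obj C; Y \<in> obj C; Z \<in> obj C; X' \<in> obj C; Y' \<in> obj C; Z' \<in> obj C;
      f \<in> hom C X X'; g \<in> hom C Y Y'; h \<in> hom C Z Z'\<rbrakk>
      \<Longrightarrow> asc C X' Y' Z' \<cdot> ((f \<odot> g) \<odot> h) = (f \<odot> (g \<odot> h)) \<cdot> asc C X Y Z"
    and lun_iso: "X \<in> obj C \<Longrightarrow> is_iso C (\<one> \<otimes> X) X (lun C X)"
    and lun_natural: "\<lbrakk>X \<in> obj C; Y \<in> obj C; f \<in> hom C X Y\<rbrakk>
      \<Longrightarrow> lun C Y \<cdot> (\<i> \<one> \<odot> f) = f \<cdot> lun C X"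
    and run_iso: "X \<in> obj C \<Longrightarrow> is_iso C (X \<otimes> \<one>) X (run C X)"
    and run_natural: "\<lbrakk>X \<in> obj C; Y \<in> obj C; f \<in> hom C X Y\<rbrakk>
      \<Longrightarrow> run C Y \<cdot> (f \<odot> \<i> \<one>) = f \<cdot> run C X"
    and pentagon: "\<lbrakk>W \<in> obj C; X \<in> obj C; Y \<in> obj C; Z \<in> obj C\<rbrakk>
      \<Longrightarrow> asc C W X (Y \<otimes> Z) \<cdot> asc C (W \<otimes> X) Y Z
        = (\<i> W \<odot> asc C X Y Z) \<cdot> asc C W (X \<otimes> Y) Z \<cdot> (asc C W X Y \<odot> \<i> Z)"
    and triangle: "\<lbrakk>X \<in> obj C; Y \<in> obj C\<rbrakk>
      \<Longrightarrow> (\<i> X \<odot> lun C Y) \<cdot> asc C X \<one> Y = run C X \<odot> \<i> Y"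

context
  fixes C :: "('o, 'm::ab_group_add, 'z) monoidal_cat_scheme" (structure)
begin

definition asc_inv :: "'o \<Rightarrow> 'o \<Rightarrow> 'o \<Rightarrow> 'm" where
  "asc_inv X Y Z = inv_mor C ((X \<otimes> Y) \<otimes> Z) (X \<otimes> (Y \<otimes> Z)) (asc C X Y Z)"

definition lun_inv :: "'o \<Rightarrow> 'm" where
  "lun_inv X = inv_mor C (\<one> \<otimes> X) X (lun C X)"

definition run_inv :: "'o \<Rightarrow> 'm" where
  "run_inv X = inv_mor C (X \<otimes> \<one>) X (run C X)"

primrec tensor_power :: "'o \<Rightarrow> nat \<Rightarrow> 'o" where
  "tensor_power X 0 = \<one>"
| "tensor_power X (Suc n) = tensor_power X n \<otimes> X"

text \<open>
  \<open>dual_pair A X e c\<close>: \<open>A\<close> is a left dual of \<open>X\<close>, equivalently \<open>X\<close> is a right dual of \<open>A\<close>, with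
  evaluation \<open>e : A \<otimes> X \<rightarrow> \<one>\<close> and coevaluation \<open>c : \<one> \<rightarrow> X \<otimes> A\<close>.
\<close>

definition dual_pair :: "'o \<Rightarrow> 'o \<Rightarrow> 'm \<Rightarrow> 'm \<Rightarrow> bool" where
  "dual_pair A X e c \<longleftrightarrow> A \<in> obj C \<and> X \<in> obj C \<and> e \<in> hom C (A \<otimes> X) \<one> \<and> c \<in> hom C \<one> (X \<otimes> A) \<and>
     run C X \<cdot> (\<i> X \<odot> e) \<cdot> asc C X A X \<cdot> (c \<odot> \<i> X) \<cdot> lun_inv X = \<i> X \<and>
     lun C A \<cdot> (e \<odot> \<i> A) \<cdot> asc_inv A X A \<cdot> (\<i> A \<odot> c) \<cdot> run_inv A = \<i> A"

definition rigid :: bool where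
  "rigid \<longleftrightarrow> (\<forall>X\<in>obj C. (\<exists>A e c. dual_pair A X e c) \<and> (\<exists>B e c. dual_pair X B e c))"

end

locale fusion_category = monoidal_linear_category C
  for C :: "('o, 'm::ab_group_add, 'z) monoidal_cat_scheme" (structure) +
  assumes abelian: "abelian C"
    and semisimple: "semisimple C"
    and hom_finite_dim: "\<lbrakk>X \<in> obj C; Y \<in> obj C\<rbrakk>
      \<Longrightarrow> \<exists>B. finite B \<and> module.span (scl C) B = hom C X Y"
    and finitely_many_simples: "\<exists>T. finite T \<and> (\<forall>X. simple C X \<longrightarrow> (\<exists>Y\<in>T. isomorphic C X Y))"
    and unit_simple: "simple C \<one>"
    and rigid: "rigid C"

text \<open>
  Pivotal structures: a chosen left dual \<open>X\<^sup>\<star>\<close> of every object, with \<open>ev X : X\<^sup>\<star> \<otimes> X \<rightarrow> \<one>\<close> and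
  \<open>coev X : \<one> \<rightarrow> X \<otimes> X\<^sup>\<star>\<close>, and a monoidal natural isomorphism \<open>piv X : X \<rightarrow> X\<^sup>\<star>\<^sup>\<star>\<close>.
\<close>

record ('o, 'm) pivotal_cat = "('o, 'm) monoidal_cat" +
  dual :: "'o \<Rightarrow> 'o" ("(_\<^sup>\<star>\<index>)" [999] 999)
  ev :: "'o \<Rightarrow> 'm"
  coev :: "'o \<Rightarrow> 'm"
  piv :: "'o \<Rightarrow> 'm"

context
  fixes C :: "('o, 'm::ab_group_add, 'z) pivotal_cat_scheme" (structure)
begin

text \<open>The morphism \<open>A \<rightarrow> X\<^sup>\<star>\<close> corresponding to \<open>g : A \<otimes> X \<rightarrow> \<one>\<close>.\<close>

definition transpose :: "'o \<Rightarrow> 'o \<Rightarrow> 'm \<Rightarrow> 'm" where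
  "transpose A X g =
     lun C (X\<^sup>\<star>) \<cdot> (g \<odot> \<i> (X\<^sup>\<star>)) \<cdot> asc_inv C A X (X\<^sup>\<star>) \<cdot> (\<i> A \<odot> coev C X) \<cdot> run_inv C A"

text \<open>The dual \<open>Y\<^sup>\<star> \<rightarrow> X\<^sup>\<star>\<close> of a morphism \<open>f : X \<rightarrow> Y\<close>.\<close>

definition dual_mor :: "'o \<Rightarrow> 'o \<Rightarrow> 'm \<Rightarrow> 'm" where
  "dual_mor X Y f = transpose (Y\<^sup>\<star>) X (ev C Y \<cdot> (\<i> (Y\<^sup>\<star>) \<odot> f))"

text \<open>The canonical isomorphism \<open>Y\<^sup>\<star> \<otimes> X\<^sup>\<star> \<rightarrow> (X \<otimes> Y)\<^sup>\<star>\<close>, obtained from the nested evaluation.\<close>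

definition dual_tensor :: "'o \<Rightarrow> 'o \<Rightarrow> 'm" where
  "dual_tensor X Y = transpose (Y\<^sup>\<star> \<otimes> X\<^sup>\<star>) (X \<otimes> Y)
     (ev C Y \<cdot> (\<i> (Y\<^sup>\<star>) \<odot> (lun C Y \<cdot> (ev C X \<odot> \<i> Y) \<cdot> asc_inv C (X\<^sup>\<star>) X Y))
        \<cdot> asc C (Y\<^sup>\<star>) (X\<^sup>\<star>) (X \<otimes> Y))"

text \<open>The evaluation \<open>X \<otimes> X\<^sup>\<star> \<rightarrow> \<one>\<close> obtained from the pivotal structure.\<close>

definition piv_ev :: "'o \<Rightarrow> 'm" where
  "piv_ev X = ev C (X\<^sup>\<star>) \<cdot> (piv C X \<odot> \<i> (X\<^sup>\<star>))"

text \<open>The pivotal dimension of \<open>X\<close>, as an endomorphism of \<open>\<one>\<close>.\<close>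

definition pdim :: "'o \<Rightarrow> 'm" where
  "pdim X = piv_ev X \<cdot> coev C X"

end

text \<open>
  The axiom \<open>piv_monoidal\<close> says that \<open>piv (X \<otimes> Y)\<close> is \<open>piv X \<odot> piv Y\<close> followed by the canonical
  isomorphism \<open>X\<^sup>\<star>\<^sup>\<star> \<otimes> Y\<^sup>\<star>\<^sup>\<star> \<rightarrow> (X \<otimes> Y)\<^sup>\<star>\<^sup>\<star>\<close>; both sides are compared in \<open>(Y\<^sup>\<star> \<otimes> X\<^sup>\<star>)\<^sup>\<star>\<close>.
\<close>

locale spherical_fusion_category = fusion_category C
  for C :: "('o, 'm::ab_group_add, 'z) pivotal_cat_scheme" (structure) +
  assumes dual: "X \<in> obj C \<Longrightarrow> dual_pair C (X\<^sup>\<star>) X (ev C X) (coev C X)"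
    and piv_iso: "X \<in> obj C \<Longrightarrow> is_iso C X (X\<^sup>\<star>\<^sup>\<star>) (piv C X)"
    and piv_natural: "\<lbrakk>X \<in> obj C; Y \<in> obj C; f \<in> hom C X Y\<rbrakk>
      \<Longrightarrow> piv C Y \<cdot> f = dual_mor C (Y\<^sup>\<star>) (X\<^sup>\<star>) (dual_mor C X Y f) \<cdot> piv C X"
    and piv_monoidal: "\<lbrakk>X \<in> obj C; Y \<in> obj C\<rbrakk>
      \<Longrightarrow> dual_mor C (Y\<^sup>\<star> \<otimes> X\<^sup>\<star>) ((X \<otimes> Y)\<^sup>\<star>) (dual_tensor C X Y) \<cdot> piv C (X \<otimes> Y)
        = dual_tensor C (Y\<^sup>\<star>) (X\<^sup>\<star>) \<cdot> (piv C X \<odot> piv C Y)"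
    and spherical: "X \<in> obj C \<Longrightarrow> pdim C X = pdim C (X\<^sup>\<star>)"

text \<open>
  Braided pivotal categories, \<open>brd X Y : X \<otimes> Y \<rightarrow> Y \<otimes> X\<close>.  The twist of \<open>X\<close> is the right partial
  trace of \<open>brd X X\<close>; on a simple object it is a scalar.
\<close>

record ('o, 'm) braided_pivotal_cat = "('o, 'm) pivotal_cat" +
  brd :: "'o \<Rightarrow> 'o \<Rightarrow> 'm"

context
  fixes C :: "('o, 'm::ab_group_add, 'z) braided_pivotal_cat_scheme" (structure)
begin

definition twist_mor :: "'o \<Rightarrow> 'm" where
  "twist_mor X =
     run C X \<cdot> (\<i> X \<odot> piv_ev C X) \<cdot> asc C X X (X\<^sup>\<star>) \<cdot> (brd C X X \<odot> \<i> (X\<^sup>\<star>))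
       \<cdot> asc_inv C X X (X\<^sup>\<star>) \<cdot> (\<i> X \<odot> coev C X) \<cdot> run_inv C X"

definition twist :: "'o \<Rightarrow> complex" where
  "twist X = (THE t. twist_mor X = scl C t (\<i> X))"

end

text \<open>
  The Drinfeld center.  Its objects are pairs \<open>(X, e)\<close> of an object \<open>X\<close> and a half-braiding
  \<open>e Z : X \<otimes> Z \<rightarrow> Z \<otimes> X\<close>; outside \<open>obj C\<close> the function \<open>e\<close> is \<^term>\<open>undefined\<close>, so that it is
  determined by its components.
\<close>

context
  fixes C :: "('o, 'm::ab_group_add, 'z) pivotal_cat_scheme" (structure)
begin

definition half_braiding :: "'o \<Rightarrow> ('o \<Rightarrow> 'm) \<Rightarrow> bool" where
  "half_braiding X e \<longleftrightarrow> e \<in> extensional (obj C) \<and>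
     (\<forall>Z\<in>obj C. is_iso C (X \<otimes> Z) (Z \<otimes> X) (e Z)) \<and>
     (\<forall>Z\<in>obj C. \<forall>W\<in>obj C. \<forall>f\<in>hom C Z W. (f \<odot> \<i> X) \<cdot> e Z = e W \<cdot> (\<i> X \<odot> f)) \<and>
     (\<forall>Z\<in>obj C. \<forall>W\<in>obj C.
        asc C Z W X \<cdot> e (Z \<otimes> W) \<cdot> asc C X Z W
          = (\<i> Z \<odot> e W) \<cdot> asc C Z X W \<cdot> (e Z \<odot> \<i> W)) \<and>
     lun C X \<cdot> e \<one> = run C X"

definition center_hom :: "'o \<times> ('o \<Rightarrow> 'm) \<Rightarrow> 'o \<times> ('o \<Rightarrow> 'm) \<Rightarrow> 'm set" where
  "center_hom = (\<lambda>(X, e) (Y, d).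
     {f \<in> hom C X Y. \<forall>Z\<in>obj C. (\<i> Z \<odot> f) \<cdot> e Z = d Z \<cdot> (f \<odot> \<i> Z)})"

definition center_tensor ::
  "'o \<times> ('o \<Rightarrow> 'm) \<Rightarrow> 'o \<times> ('o \<Rightarrow> 'm) \<Rightarrow> 'o \<times> ('o \<Rightarrow> 'm)" where
  "center_tensor = (\<lambda>(X, e) (Y, d). (X \<otimes> Y, \<lambda>Z\<in>obj C.
     asc C Z X Y \<cdot> (e Z \<odot> \<i> Y) \<cdot> asc_inv C X Z Y \<cdot> (\<i> X \<odot> d Z) \<cdot> asc C X Y Z))"

definition center_unit :: "'o \<times> ('o \<Rightarrow> 'm)" where
  "center_unit = (\<one>, \<lambda>Z\<in>obj C. run_inv C Z \<cdot> lun C Z)"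

text \<open>The half-braiding of \<open>X\<^sup>\<star>\<close> is the left-dual mate of the inverse half-braiding of \<open>X\<close>.\<close>

definition center_dual :: "'o \<times> ('o \<Rightarrow> 'm) \<Rightarrow> 'o \<times> ('o \<Rightarrow> 'm)" where
  "center_dual = (\<lambda>(X, e). (X\<^sup>\<star>, \<lambda>Z\<in>obj C.
     ((lun C Z \<cdot> (ev C X \<odot> \<i> Z) \<cdot> asc_inv C (X\<^sup>\<star>) X Z
         \<cdot> (\<i> (X\<^sup>\<star>) \<odot> inv_mor C (X \<otimes> Z) (Z \<otimes> X) (e Z)) \<cdot> asc C (X\<^sup>\<star>) Z X) \<odot> \<i> (X\<^sup>\<star>))
       \<cdot> asc_inv C (X\<^sup>\<star> \<otimes> Z) X (X\<^sup>\<star>) \<cdot> (\<i> (X\<^sup>\<star> \<otimes> Z) \<odot> coev C X) \<cdot> run_inv C (X\<^sup>\<star> \<otimes> Z)))"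

definition drinfeld_center :: "('o \<times> ('o \<Rightarrow> 'm), 'm) braided_pivotal_cat" where
  "drinfeld_center = \<lparr>
     obj = {(X, e). X \<in> obj C \<and> half_braiding X e},
     hom = center_hom,
     idm = \<lambda>(X, e). \<i> X,
     cmp = cmp C,
     scl = scl C,
     tobj = center_tensor,
     tmor = tmor C,
     unit = center_unit,
     asc = \<lambda>(X, _) (Y, _) (Z, _). asc C X Y Z,
     lun = \<lambda>(X, _). lun C X,
     run = \<lambda>(X, _). run C X,
     dual = center_dual,
     ev = \<lambda>(X, _). ev C X,
     coev = \<lambda>(X, _). coev C X,
     piv = \<lambda>(X, _). piv C X,
     brd = \<lambda>(X, e) (Y, _). e Y\<rparr>"

end

definition forget_obj :: "'o \<times> ('o \<Rightarrow> 'm) \<Rightarrow> 'o" where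
  "forget_obj = fst"

definition forget_mor :: "'o \<times> ('o \<Rightarrow> 'm) \<Rightarrow> 'o \<times> ('o \<Rightarrow> 'm) \<Rightarrow> 'm \<Rightarrow> 'm" where
  "forget_mor _ _ f = f"

text \<open>\<open>Io\<close> and \<open>Ir\<close> form a left adjoint of the forgetful functor of the center of \<open>C\<close>.\<close>

definition induction_functor ::
  "('o, 'm::ab_group_add, 'z) pivotal_cat_scheme \<Rightarrow>
   ('o \<Rightarrow> 'o \<times> ('o \<Rightarrow> 'm)) \<Rightarrow> ('o \<Rightarrow> 'o \<Rightarrow> 'm \<Rightarrow> 'm) \<Rightarrow> bool" where
  "induction_functor C Io Ir \<longleftrightarrow>
     left_adjoint C (drinfeld_center C) Io Ir forget_obj forget_mor"

end

theory Submission
  imports Defs "HOL-Computational_Algebra.Fundamental_Theorem_Algebra"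
begin

text \<open>Write \<open>Y = (A, e)\<close> for a simple summand of \<open>I(X)\<close>.  Its twist can be read off from the
\<open>X\<close>-isotypic part of \<open>A\<close>: by adjunction there is a nonzero \<open>i : X \<rightarrow> A\<close>.  As \<open>X\<close> is invertible,
tensoring with \<open>X\<close> is full (\<open>lwhisk_full\<close>), so the composite \<open>e X \<circ> (i \<otimes> X) : X \<otimes> X \<rightarrow> X \<otimes> A\<close> has the
form \<open>X \<otimes> u\<close>.  The twist is a loop in which \<open>A\<close> braids with itself.  Composing it with \<open>i\<close> and with
an arbitrary \<open>p : A \<rightarrow> X\<close> and sliding both along the loop gives \<open>\<theta> (p \<circ> i) = \<delta> (p \<circ> u)\<close>, where \<open>\<delta>\<close> is
the pivotal dimension of \<open>X\<close>; semisimplicity then gives \<open>\<theta> i = \<delta> u\<close>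
(\<open>twist_on_multiplicity_space\<close>).  If \<open>\<delta> = 0\<close> then \<open>\<theta> = 0\<close>.  Otherwise \<open>u = b i\<close> with
\<open>b = \<theta> / \<delta>\<close>: braiding \<open>i\<close> past one factor \<open>X\<close> costs the scalar \<open>b\<close>.  By the hexagon, braiding \<open>i\<close>
past the \<open>n\<close>-th tensor power costs \<open>b ^ n\<close> and an associativity isomorphism (\<open>power_braiding\<close>).  The
half-braiding is natural with respect to the isomorphism of this power with the unit, and canonical
on the unit; comparing the two gives \<open>\<theta> ^ n m = \<delta> ^ n m'\<close> with morphisms \<open>m\<close> and
\<open>m' \<noteq> 0\<close> that depend only on \<open>X\<close> and the chosen isomorphism (\<open>twist_power\<close>).  This determines
\<open>\<theta> ^ n\<close> independently of \<open>Y\<close>.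

All this presupposes that the twist endomorphism of \<open>Y\<close> is a scalar (\<open>twist_scalar\<close>), which has two
ingredients.  First, the twist is a morphism of the center (\<open>twist_arrow_central\<close>).  By the
Yang-Baxter relation this reduces to the statement that the evaluation \<open>A \<otimes> A\<^sup>\<star> \<rightarrow> \<one>\<close> built from the
pivotal structure is a morphism of the center (\<open>pev_central\<close>).  Here the pivotal structure has to be
natural and monoidal: together these say that the left and the right mate of a morphism
\<open>X \<otimes> Y \<rightarrow> X' \<otimes> Y'\<close> agree (\<open>left_mate_eq_right_mate\<close>), and this is applied to the half-braiding itself.
Second, Schur's lemma holds in the center (\<open>center_schur\<close>): the kernel in \<open>C\<close> of a morphism of the
center splits and inherits a half-braiding, because every morphism of a semisimple category is
von Neumann regular (\<open>regular\<close>).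

Morphisms are handled as arrows that carry their source and target, and every associator is pushed
away by looking at a morphism \<open>s : X \<otimes> Y \<rightarrow> X' \<otimes> Y'\<close> through the natural family
\<open>X \<otimes> (Y \<otimes> W) \<rightarrow> X' \<otimes> (Y' \<otimes> W)\<close> that it induces for a spectator \<open>W\<close>.  In such families everything is
nested to the right, so that string diagrams can be transcribed without coherence isomorphisms.\<close>

section \<open>Typed arrows\<close>

text \<open>\<open>None\<close> is the value of every undefined operation.  It makes composition of arrows associative without
side conditions (\<open>comp_assoc\<close>), and the simplifier can check composability by computing sources and
targets; a bare morphism does not determine these.\<close>
type_synonym ('o, 'm) arrow = "('o \<times> 'm \<times> 'o) option"

context monoidal_linear_category
begin

definition ok :: "('o, 'm) arrow \<Rightarrow> bool" where
  "ok a \<longleftrightarrow> (\<exists>X Y f. X \<in> obj C \<and> Y \<in> obj C \<and> f \<in> hom C X Y \<and> a = Some (X, f, Y))"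

definition arrow :: "'o \<Rightarrow> 'o \<Rightarrow> 'm \<Rightarrow> ('o, 'm) arrow" where
  "arrow X Y f = (if X \<in> obj C \<and> Y \<in> obj C \<and> f \<in> hom C X Y then Some (X, f, Y) else None)"

definition src :: "('o, 'm) arrow \<Rightarrow> 'o" where "src a = fst (the a)"
definition tgt :: "('o, 'm) arrow \<Rightarrow> 'o" where "tgt a = snd (snd (the a))"
definition mor :: "('o, 'm) arrow \<Rightarrow> 'm" where "mor a = fst (snd (the a))"

definition comp :: "('o, 'm) arrow \<Rightarrow> ('o, 'm) arrow \<Rightarrow> ('o, 'm) arrow" (infixr "\<bullet>" 60) where
  "b \<bullet> a = (if ok a \<and> ok b \<and> src b = tgt a then arrow (src a) (tgt b) (mor b \<cdot> mor a) else None)"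

text \<open>The tensor product is only used through whiskering with an identity on the left or right; the
general product of two arrows is a composite of two whiskerings (\<open>interchange\<close>).\<close>
definition lwhisk :: "'o \<Rightarrow> ('o, 'm) arrow \<Rightarrow> ('o, 'm) arrow" (infixr "\<rhd>" 75) where
  "X \<rhd> a = (if X \<in> obj C \<and> ok a then arrow (X \<otimes> src a) (X \<otimes> tgt a) (\<i> X \<odot> mor a) else None)"

definition rwhisk :: "('o, 'm) arrow \<Rightarrow> 'o \<Rightarrow> ('o, 'm) arrow" (infixl "\<lhd>" 76) where
  "a \<lhd> X = (if X \<in> obj C \<and> ok a then arrow (src a \<otimes> X) (tgt a \<otimes> X) (mor a \<odot> \<i> X) else None)"

definition Id :: "'o \<Rightarrow> ('o, 'm) arrow" where "Id X = arrow X X (\<i> X)"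
definition \<alpha> :: "'o \<Rightarrow> 'o \<Rightarrow> 'o \<Rightarrow> ('o, 'm) arrow" where
  "\<alpha> X Y Z = arrow ((X \<otimes> Y) \<otimes> Z) (X \<otimes> (Y \<otimes> Z)) (asc C X Y Z)"
definition \<alpha>i :: "'o \<Rightarrow> 'o \<Rightarrow> 'o \<Rightarrow> ('o, 'm) arrow" where
  "\<alpha>i X Y Z = arrow (X \<otimes> (Y \<otimes> Z)) ((X \<otimes> Y) \<otimes> Z) (asc_inv C X Y Z)"
definition lu :: "'o \<Rightarrow> ('o, 'm) arrow" where "lu X = arrow (\<one> \<otimes> X) X (lun C X)"
definition lui :: "'o \<Rightarrow> ('o, 'm) arrow" where "lui X = arrow X (\<one> \<otimes> X) (lun_inv C X)"
definition ru :: "'o \<Rightarrow> ('o, 'm) arrow" where "ru X = arrow (X \<otimes> \<one>) X (run C X)"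
definition rui :: "'o \<Rightarrow> ('o, 'm) arrow" where "rui X = arrow X (X \<otimes> \<one>) (run_inv C X)"

declare unit_obj [simp] tobj_obj [simp]

lemma arrow_ok: "\<lbrakk>X \<in> obj C; Y \<in> obj C; f \<in> hom C X Y\<rbrakk> \<Longrightarrow> ok (arrow X Y f) \<and> src (arrow X Y f) = X \<and> tgt (arrow X Y f) = Y \<and> mor (arrow X Y f) = f"
  by (auto simp: arrow_def ok_def src_def tgt_def mor_def)

lemma ok_E: assumes "ok a"
  obtains X Y f where "X \<in> obj C" "Y \<in> obj C" "f \<in> hom C X Y" "a = arrow X Y f" "src a = X" "tgt a = Y" "mor a = f"
  using assms by (auto simp: arrow_def ok_def src_def tgt_def mor_def)

lemma src_obj [simp]: "ok a \<Longrightarrow> src a \<in> obj C" by (auto elim: ok_E)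
lemma tgt_obj [simp]: "ok a \<Longrightarrow> tgt a \<in> obj C" by (auto elim: ok_E)
lemma mor_hom: "ok a \<Longrightarrow> mor a \<in> hom C (src a) (tgt a)" by (auto elim: ok_E)

lemma mor_Id_left: "ok a \<Longrightarrow> \<i> (tgt a) \<cdot> mor a = mor a"
  using cmp_idm_left src_obj tgt_obj mor_hom by blast
lemma mor_Id_right: "ok a \<Longrightarrow> mor a \<cdot> \<i> (src a) = mor a"
  using cmp_idm_right src_obj tgt_obj mor_hom by blast

lemma arrow_mor: "ok a \<Longrightarrow> arrow (src a) (tgt a) (mor a) = a" by (auto elim: ok_E)

lemma not_ok_None [simp]: "\<not> ok None" by (simp add: ok_def)

lemma comp_mor: "\<lbrakk>ok a; ok b; src b = tgt a\<rbrakk> \<Longrightarrow> mor b \<cdot> mor a \<in> hom C (src a) (tgt b)"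
  using cmp_in_hom mor_hom tgt_obj src_obj by metis

lemma ok_comp [simp]: "ok (b \<bullet> a) \<longleftrightarrow> ok a \<and> ok b \<and> src b = tgt a"
  using comp_mor by (auto simp: comp_def arrow_ok)
lemma src_comp [simp]: "\<lbrakk>ok a; ok b; src b = tgt a\<rbrakk> \<Longrightarrow> src (b \<bullet> a) = src a"
  using comp_mor by (auto simp: comp_def arrow_ok)
lemma tgt_comp [simp]: "\<lbrakk>ok a; ok b; src b = tgt a\<rbrakk> \<Longrightarrow> tgt (b \<bullet> a) = tgt b"
  using comp_mor by (auto simp: comp_def arrow_ok)
lemma mor_comp: "\<lbrakk>ok a; ok b; src b = tgt a\<rbrakk> \<Longrightarrow> mor (b \<bullet> a) = mor b \<cdot> mor a"
  using comp_mor by (auto simp: comp_def arrow_ok)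

lemma lwhisk_mor: "\<lbrakk>X \<in> obj C; ok a\<rbrakk> \<Longrightarrow> \<i> X \<odot> mor a \<in> hom C (X \<otimes> src a) (X \<otimes> tgt a)"
  by (simp add: tmor_in_hom idm_in_hom mor_hom)
lemma rwhisk_mor: "\<lbrakk>X \<in> obj C; ok a\<rbrakk> \<Longrightarrow> mor a \<odot> \<i> X \<in> hom C (src a \<otimes> X) (tgt a \<otimes> X)"
  by (simp add: tmor_in_hom idm_in_hom mor_hom)

lemma ok_lwh [simp]: "ok (X \<rhd> a) \<longleftrightarrow> X \<in> obj C \<and> ok a"
  using lwhisk_mor by (auto simp: lwhisk_def arrow_ok)
lemma src_lwh [simp]: "\<lbrakk>X \<in> obj C; ok a\<rbrakk> \<Longrightarrow> src (X \<rhd> a) = X \<otimes> src a"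
  using lwhisk_mor by (auto simp: lwhisk_def arrow_ok)
lemma tgt_lwh [simp]: "\<lbrakk>X \<in> obj C; ok a\<rbrakk> \<Longrightarrow> tgt (X \<rhd> a) = X \<otimes> tgt a"
  using lwhisk_mor by (auto simp: lwhisk_def arrow_ok)
lemma mor_lwh: "\<lbrakk>X \<in> obj C; ok a\<rbrakk> \<Longrightarrow> mor (X \<rhd> a) = \<i> X \<odot> mor a"
  using lwhisk_mor by (auto simp: lwhisk_def arrow_ok)
lemma ok_rwh [simp]: "ok (a \<lhd> X) \<longleftrightarrow> X \<in> obj C \<and> ok a"
  using rwhisk_mor by (auto simp: rwhisk_def arrow_ok)
lemma src_rwh [simp]: "\<lbrakk>X \<in> obj C; ok a\<rbrakk> \<Longrightarrow> src (a \<lhd> X) = src a \<otimes> X"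
  using rwhisk_mor by (auto simp: rwhisk_def arrow_ok)
lemma tgt_rwh [simp]: "\<lbrakk>X \<in> obj C; ok a\<rbrakk> \<Longrightarrow> tgt (a \<lhd> X) = tgt a \<otimes> X"
  using rwhisk_mor by (auto simp: rwhisk_def arrow_ok)
lemma mor_rwh: "\<lbrakk>X \<in> obj C; ok a\<rbrakk> \<Longrightarrow> mor (a \<lhd> X) = mor a \<odot> \<i> X"
  using rwhisk_mor by (auto simp: rwhisk_def arrow_ok)

lemma arrow_eqI: "\<lbrakk>ok a; ok b; src a = src b; tgt a = tgt b; mor a = mor b\<rbrakk> \<Longrightarrow> a = b"
  by (metis arrow_mor)

lemma inverses_unique:
  assumes "X \<in> obj C" "Y \<in> obj C" "inverses C X Y f g" "inverses C X Y f g'"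
  shows "g = g'"
proof -
  have "g = g \<cdot> (f \<cdot> g')" using assms cmp_idm_right unfolding inverses_def by metis
  also have "\<dots> = (g \<cdot> f) \<cdot> g'" using assms cmp_assoc[of Y X Y X g' f g] unfolding inverses_def by metis
  also have "\<dots> = g'" using assms cmp_idm_left unfolding inverses_def by metis
  finally show ?thesis .
qed

lemma inv_mor_eq:
  assumes "X \<in> obj C" "Y \<in> obj C" "inverses C X Y f g"
  shows "inv_mor C X Y f = g"
  unfolding inv_mor_def using assms inverses_unique by blast

lemma inv_mor_inverses:
  assumes "X \<in> obj C" "Y \<in> obj C" "is_iso C X Y f"
  shows "inverses C X Y f (inv_mor C X Y f)"
  using assms inv_mor_eq unfolding is_iso_def by metis

lemma asc_inverses: "\<lbrakk>X \<in> obj C; Y \<in> obj C; Z \<in> obj C\<rbrakk> \<Longrightarrow>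
  inverses C ((X \<otimes> Y) \<otimes> Z) (X \<otimes> (Y \<otimes> Z)) (asc C X Y Z) (asc_inv C X Y Z)"
  unfolding asc_inv_def by (intro inv_mor_inverses asc_iso) auto
lemma lun_inverses: "X \<in> obj C \<Longrightarrow> inverses C (\<one> \<otimes> X) X (lun C X) (lun_inv C X)"
  unfolding lun_inv_def by (intro inv_mor_inverses lun_iso) auto
lemma run_inverses: "X \<in> obj C \<Longrightarrow> inverses C (X \<otimes> \<one>) X (run C X) (run_inv C X)"
  unfolding run_inv_def by (intro inv_mor_inverses run_iso) auto

lemma asc_hom: "\<lbrakk>X \<in> obj C; Y \<in> obj C; Z \<in> obj C\<rbrakk> \<Longrightarrow> asc C X Y Z \<in> hom C ((X \<otimes> Y) \<otimes> Z) (X \<otimes> (Y \<otimes> Z))"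
  "\<lbrakk>X \<in> obj C; Y \<in> obj C; Z \<in> obj C\<rbrakk> \<Longrightarrow> asc_inv C X Y Z \<in> hom C (X \<otimes> (Y \<otimes> Z)) ((X \<otimes> Y) \<otimes> Z)"
  using asc_inverses by (auto simp: inverses_def)
lemma lun_hom: "X \<in> obj C \<Longrightarrow> lun C X \<in> hom C (\<one> \<otimes> X) X" "X \<in> obj C \<Longrightarrow> lun_inv C X \<in> hom C X (\<one> \<otimes> X)"
  using lun_inverses by (auto simp: inverses_def)
lemma run_hom: "X \<in> obj C \<Longrightarrow> run C X \<in> hom C (X \<otimes> \<one>) X" "X \<in> obj C \<Longrightarrow> run_inv C X \<in> hom C X (X \<otimes> \<one>)"
  using run_inverses by (auto simp: inverses_def)

lemma Id_typ: "X \<in> obj C \<Longrightarrow> ok (Id X) \<and> src (Id X) = X \<and> tgt (Id X) = X \<and> mor (Id X) = \<i> X"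
  unfolding Id_def by (simp add: arrow_ok idm_in_hom)
lemma \<alpha>_typ: "\<lbrakk>X \<in> obj C; Y \<in> obj C; Z \<in> obj C\<rbrakk> \<Longrightarrow> ok (\<alpha> X Y Z) \<and> src (\<alpha> X Y Z) = (X \<otimes> Y) \<otimes> Z
    \<and> tgt (\<alpha> X Y Z) = X \<otimes> (Y \<otimes> Z) \<and> mor (\<alpha> X Y Z) = asc C X Y Z"
  unfolding \<alpha>_def by (simp add: arrow_ok asc_hom)
lemma \<alpha>i_typ: "\<lbrakk>X \<in> obj C; Y \<in> obj C; Z \<in> obj C\<rbrakk> \<Longrightarrow> ok (\<alpha>i X Y Z) \<and> src (\<alpha>i X Y Z) = X \<otimes> (Y \<otimes> Z)
    \<and> tgt (\<alpha>i X Y Z) = (X \<otimes> Y) \<otimes> Z \<and> mor (\<alpha>i X Y Z) = asc_inv C X Y Z"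
  unfolding \<alpha>i_def by (simp add: arrow_ok asc_hom)
lemma lu_typ: "X \<in> obj C \<Longrightarrow> ok (lu X) \<and> src (lu X) = \<one> \<otimes> X \<and> tgt (lu X) = X \<and> mor (lu X) = lun C X"
  unfolding lu_def by (simp add: arrow_ok lun_hom)
lemma lui_typ: "X \<in> obj C \<Longrightarrow> ok (lui X) \<and> src (lui X) = X \<and> tgt (lui X) = \<one> \<otimes> X \<and> mor (lui X) = lun_inv C X"
  unfolding lui_def by (simp add: arrow_ok lun_hom)
lemma ru_typ: "X \<in> obj C \<Longrightarrow> ok (ru X) \<and> src (ru X) = X \<otimes> \<one> \<and> tgt (ru X) = X \<and> mor (ru X) = run C X"
  unfolding ru_def by (simp add: arrow_ok run_hom)
lemma rui_typ: "X \<in> obj C \<Longrightarrow> ok (rui X) \<and> src (rui X) = X \<and> tgt (rui X) = X \<otimes> \<one> \<and> mor (rui X) = run_inv C X"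
  unfolding rui_def by (simp add: arrow_ok run_hom)

lemmas coherence_typ [simp] = Id_typ \<alpha>_typ \<alpha>i_typ lu_typ lui_typ ru_typ rui_typ
lemmas mor_simps = mor_comp mor_lwh mor_rwh

lemma comp_assoc [simp]: "(c \<bullet> b) \<bullet> a = c \<bullet> (b \<bullet> a)"
proof (cases "ok a \<and> ok b \<and> ok c \<and> src b = tgt a \<and> src c = tgt b")
  case True
  have "(mor c \<cdot> mor b) \<cdot> mor a = mor c \<cdot> (mor b \<cdot> mor a)"
    using True mor_hom src_obj tgt_obj cmp_assoc[of "src a" "src b" "src c" "tgt c" "mor a" "mor b" "mor c"] by metis
  with True show ?thesis
    by (intro arrow_eqI) (auto simp: mor_comp)
next
  case False
  have "\<And>u v. \<not> ok (u \<bullet> v) \<Longrightarrow> u \<bullet> v = None" by (metis comp_def ok_comp)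
  moreover have "\<not> ok ((c \<bullet> b) \<bullet> a)" "\<not> ok (c \<bullet> (b \<bullet> a))" using False by auto
  ultimately show ?thesis by metis
qed

lemma comp_Id_left [simp]: "\<lbrakk>ok a; tgt a = X\<rbrakk> \<Longrightarrow> Id X \<bullet> a = a"
  by (intro arrow_eqI) (auto simp: mor_comp mor_Id_left)
lemma comp_Id_right [simp]: "\<lbrakk>ok a; src a = X\<rbrakk> \<Longrightarrow> a \<bullet> Id X = a"
  by (intro arrow_eqI) (auto simp: mor_comp mor_Id_right)

lemma reassoc: "b \<bullet> a = c \<Longrightarrow> b \<bullet> (a \<bullet> x) = c \<bullet> x"
  by (metis comp_assoc)

lemma lwhisk_Id [simp]: "\<lbrakk>X \<in> obj C; Y \<in> obj C\<rbrakk> \<Longrightarrow> X \<rhd> Id Y = Id (X \<otimes> Y)"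
  by (intro arrow_eqI) (auto simp: mor_lwh tmor_idm)
lemma rwhisk_Id [simp]: "\<lbrakk>X \<in> obj C; Y \<in> obj C\<rbrakk> \<Longrightarrow> Id X \<lhd> Y = Id (X \<otimes> Y)"
  by (intro arrow_eqI) (auto simp: mor_rwh tmor_idm)

lemma lwhisk_comp [simp]: assumes "src b = tgt a" shows "X \<rhd> (b \<bullet> a) = (X \<rhd> b) \<bullet> (X \<rhd> a)"
proof (cases "ok a \<and> ok b \<and> X \<in> obj C")
  case True
  then have "\<i> X \<odot> (mor b \<cdot> mor a) = (\<i> X \<odot> mor b) \<cdot> (\<i> X \<odot> mor a)"
    using tmor_cmp[of X X X "src a" "src b" "tgt b" "\<i> X" "\<i> X" "mor a" "mor b"] mor_hom[of a] mor_hom[of b] assms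
    by (auto simp: idm_in_hom cmp_idm_left)
  with True assms show ?thesis by (intro arrow_eqI) (auto simp: mor_simps)
next
  case False
  then show ?thesis by (auto simp: comp_def lwhisk_def)
qed

lemma rwhisk_comp [simp]: assumes "src b = tgt a" shows "(b \<bullet> a) \<lhd> X = (b \<lhd> X) \<bullet> (a \<lhd> X)"
proof (cases "ok a \<and> ok b \<and> X \<in> obj C")
  case True
  then have "(mor b \<cdot> mor a) \<odot> \<i> X = (mor b \<odot> \<i> X) \<cdot> (mor a \<odot> \<i> X)"
    using tmor_cmp[of "src a" "src b" "tgt b" X X X "mor a" "mor b" "\<i> X" "\<i> X"] mor_hom[of a] mor_hom[of b] assms
    by (auto simp: idm_in_hom cmp_idm_left)
  with True assms show ?thesis by (intro arrow_eqI) (auto simp: mor_simps)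
next
  case False
  then show ?thesis by (auto simp: comp_def rwhisk_def)
qed

lemma interchange_mor:
  assumes "ok f" "ok g"
  shows "mor ((f \<lhd> tgt g) \<bullet> (src f \<rhd> g)) = mor f \<odot> mor g" "mor ((tgt f \<rhd> g) \<bullet> (f \<lhd> src g)) = mor f \<odot> mor g"
  using assms mor_hom[of f] mor_hom[of g]
    tmor_cmp[of "src f" "src f" "tgt f" "src g" "tgt g" "tgt g" "\<i> (src f)" "mor f" "mor g" "\<i> (tgt g)"]
    tmor_cmp[of "src f" "tgt f" "tgt f" "src g" "src g" "tgt g" "mor f" "\<i> (tgt f)" "\<i> (src g)" "mor g"]
  by (auto simp: mor_simps idm_in_hom mor_Id_left mor_Id_right)

lemma interchange:
  assumes "ok f" "ok g" "src f = X" "tgt f = X'" "src g = Y" "tgt g = Y'"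
  shows "(f \<lhd> Y') \<bullet> (X \<rhd> g) = (X' \<rhd> g) \<bullet> (f \<lhd> Y)"
  using assms interchange_mor[of f g] by (intro arrow_eqI) auto

lemma \<alpha>_inv [simp]: "\<lbrakk>X \<in> obj C; Y \<in> obj C; Z \<in> obj C\<rbrakk> \<Longrightarrow> \<alpha> X Y Z \<bullet> \<alpha>i X Y Z = Id (X \<otimes> (Y \<otimes> Z))"
  "\<lbrakk>X \<in> obj C; Y \<in> obj C; Z \<in> obj C\<rbrakk> \<Longrightarrow> \<alpha>i X Y Z \<bullet> \<alpha> X Y Z = Id ((X \<otimes> Y) \<otimes> Z)"
  using asc_inverses[of X Y Z] by (auto intro!: arrow_eqI simp: inverses_def mor_comp)
lemma lu_inv [simp]: "X \<in> obj C \<Longrightarrow> lu X \<bullet> lui X = Id X" "X \<in> obj C \<Longrightarrow> lui X \<bullet> lu X = Id (\<one> \<otimes> X)"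
  using lun_inverses[of X] by (auto intro!: arrow_eqI simp: inverses_def mor_comp)
lemma ru_inv [simp]: "X \<in> obj C \<Longrightarrow> ru X \<bullet> rui X = Id X" "X \<in> obj C \<Longrightarrow> rui X \<bullet> ru X = Id (X \<otimes> \<one>)"
  using run_inverses[of X] by (auto intro!: arrow_eqI simp: inverses_def mor_comp)

lemma inv_cancel: "\<lbrakk>b \<bullet> a = Id X; ok x; tgt x = X\<rbrakk> \<Longrightarrow> b \<bullet> (a \<bullet> x) = x"
  by (metis comp_assoc comp_Id_left)

lemma lwhisk_inv: "\<lbrakk>b \<bullet> a = Id X; X \<in> obj C; Y \<in> obj C\<rbrakk> \<Longrightarrow> (Y \<rhd> b) \<bullet> (Y \<rhd> a) = Id (Y \<otimes> X)"
  by (metis Id_typ lwhisk_Id lwhisk_comp ok_comp)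
lemma rwhisk_inv: "\<lbrakk>b \<bullet> a = Id X; X \<in> obj C; Y \<in> obj C\<rbrakk> \<Longrightarrow> (b \<lhd> Y) \<bullet> (a \<lhd> Y) = Id (X \<otimes> Y)"
  by (metis Id_typ rwhisk_Id rwhisk_comp ok_comp)

lemma solve_left: "\<lbrakk>c \<bullet> b = Id X; ok a; tgt a = X; b \<bullet> a = x\<rbrakk> \<Longrightarrow> a = c \<bullet> x"
  using inv_cancel by metis
lemma iso_cancel_left:
  assumes "c \<bullet> b = Id X" "ok a" "ok a'" "tgt a = X" "tgt a' = X" "b \<bullet> a = b \<bullet> a'" shows "a = a'"
  using assms inv_cancel by metis
lemma iso_cancel_right:
  assumes "b \<bullet> c = Id X" "ok a" "ok a'" "src a = X" "src a' = X" "a \<bullet> b = a' \<bullet> b" shows "a = a'"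
  using assms by (metis comp_assoc comp_Id_right)

lemma coherence_cancel [simp]:
  "\<lbrakk>X \<in> obj C; Y \<in> obj C; Z \<in> obj C; ok x; tgt x = X \<otimes> (Y \<otimes> Z)\<rbrakk> \<Longrightarrow> \<alpha> X Y Z \<bullet> (\<alpha>i X Y Z \<bullet> x) = x"
  "\<lbrakk>X \<in> obj C; Y \<in> obj C; Z \<in> obj C; ok x; tgt x = (X \<otimes> Y) \<otimes> Z\<rbrakk> \<Longrightarrow> \<alpha>i X Y Z \<bullet> (\<alpha> X Y Z \<bullet> x) = x"
  "\<lbrakk>X \<in> obj C; ok x; tgt x = X\<rbrakk> \<Longrightarrow> lu X \<bullet> (lui X \<bullet> x) = x"
  "\<lbrakk>X \<in> obj C; ok x; tgt x = \<one> \<otimes> X\<rbrakk> \<Longrightarrow> lui X \<bullet> (lu X \<bullet> x) = x"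
  "\<lbrakk>X \<in> obj C; ok x; tgt x = X\<rbrakk> \<Longrightarrow> ru X \<bullet> (rui X \<bullet> x) = x"
  "\<lbrakk>X \<in> obj C; ok x; tgt x = X \<otimes> \<one>\<rbrakk> \<Longrightarrow> rui X \<bullet> (ru X \<bullet> x) = x"
  by (auto intro: inv_cancel)

lemma coherence_cancel_lwhisk [simp]:
  "\<lbrakk>X \<in> obj C; Y \<in> obj C; Z \<in> obj C; V \<in> obj C\<rbrakk> \<Longrightarrow> (V \<rhd> \<alpha> X Y Z) \<bullet> (V \<rhd> \<alpha>i X Y Z) = Id (V \<otimes> (X \<otimes> (Y \<otimes> Z)))"
  "\<lbrakk>X \<in> obj C; Y \<in> obj C; Z \<in> obj C; V \<in> obj C\<rbrakk> \<Longrightarrow> (V \<rhd> \<alpha>i X Y Z) \<bullet> (V \<rhd> \<alpha> X Y Z) = Id (V \<otimes> ((X \<otimes> Y) \<otimes> Z))"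
  "\<lbrakk>X \<in> obj C; V \<in> obj C\<rbrakk> \<Longrightarrow> (V \<rhd> lu X) \<bullet> (V \<rhd> lui X) = Id (V \<otimes> X)"
  "\<lbrakk>X \<in> obj C; V \<in> obj C\<rbrakk> \<Longrightarrow> (V \<rhd> lui X) \<bullet> (V \<rhd> lu X) = Id (V \<otimes> (\<one> \<otimes> X))"
  "\<lbrakk>X \<in> obj C; V \<in> obj C\<rbrakk> \<Longrightarrow> (V \<rhd> ru X) \<bullet> (V \<rhd> rui X) = Id (V \<otimes> X)"
  "\<lbrakk>X \<in> obj C; V \<in> obj C\<rbrakk> \<Longrightarrow> (V \<rhd> rui X) \<bullet> (V \<rhd> ru X) = Id (V \<otimes> (X \<otimes> \<one>))"
  by (auto intro: lwhisk_inv)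

lemma coherence_cancel_lwhisk_assoc [simp]:
  "\<lbrakk>X \<in> obj C; Y \<in> obj C; Z \<in> obj C; V \<in> obj C; ok x; tgt x = V \<otimes> (X \<otimes> (Y \<otimes> Z))\<rbrakk>
    \<Longrightarrow> (V \<rhd> \<alpha> X Y Z) \<bullet> ((V \<rhd> \<alpha>i X Y Z) \<bullet> x) = x"
  "\<lbrakk>X \<in> obj C; Y \<in> obj C; Z \<in> obj C; V \<in> obj C; ok x; tgt x = V \<otimes> ((X \<otimes> Y) \<otimes> Z)\<rbrakk>
    \<Longrightarrow> (V \<rhd> \<alpha>i X Y Z) \<bullet> ((V \<rhd> \<alpha> X Y Z) \<bullet> x) = x"
  "\<lbrakk>X \<in> obj C; V \<in> obj C; ok x; tgt x = V \<otimes> X\<rbrakk> \<Longrightarrow> (V \<rhd> lu X) \<bullet> ((V \<rhd> lui X) \<bullet> x) = x"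
  "\<lbrakk>X \<in> obj C; V \<in> obj C; ok x; tgt x = V \<otimes> (\<one> \<otimes> X)\<rbrakk> \<Longrightarrow> (V \<rhd> lui X) \<bullet> ((V \<rhd> lu X) \<bullet> x) = x"
  "\<lbrakk>X \<in> obj C; V \<in> obj C; ok x; tgt x = V \<otimes> X\<rbrakk> \<Longrightarrow> (V \<rhd> ru X) \<bullet> ((V \<rhd> rui X) \<bullet> x) = x"
  "\<lbrakk>X \<in> obj C; V \<in> obj C; ok x; tgt x = V \<otimes> (X \<otimes> \<one>)\<rbrakk> \<Longrightarrow> (V \<rhd> rui X) \<bullet> ((V \<rhd> ru X) \<bullet> x) = x"
  by (auto intro: inv_cancel)

section \<open>Coherence\<close>

lemma \<alpha>_natural1: "\<lbrakk>ok f; src f = X; tgt f = X'; Y \<in> obj C; Z \<in> obj C\<rbrakk>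
    \<Longrightarrow> \<alpha> X' Y Z \<bullet> (f \<lhd> Y \<lhd> Z) = (f \<lhd> (Y \<otimes> Z)) \<bullet> \<alpha> X Y Z"
  using asc_natural[of X Y Z X' Y Z "mor f" "\<i> Y" "\<i> Z"] mor_hom[of f] src_obj[of f] tgt_obj[of f]
  by (intro arrow_eqI) (auto simp: mor_simps idm_in_hom tmor_idm)
lemma \<alpha>_natural2: "\<lbrakk>ok f; src f = Y; tgt f = Y'; X \<in> obj C; Z \<in> obj C\<rbrakk>
    \<Longrightarrow> \<alpha> X Y' Z \<bullet> ((X \<rhd> f) \<lhd> Z) = (X \<rhd> (f \<lhd> Z)) \<bullet> \<alpha> X Y Z"
  using asc_natural[of X Y Z X Y' Z "\<i> X" "mor f" "\<i> Z"] mor_hom[of f] src_obj[of f] tgt_obj[of f]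
  by (intro arrow_eqI) (auto simp: mor_simps idm_in_hom tmor_idm)
lemma \<alpha>_natural3: "\<lbrakk>ok f; src f = Z; tgt f = Z'; X \<in> obj C; Y \<in> obj C\<rbrakk>
    \<Longrightarrow> \<alpha> X Y Z' \<bullet> ((X \<otimes> Y) \<rhd> f) = (X \<rhd> Y \<rhd> f) \<bullet> \<alpha> X Y Z"
  using asc_natural[of X Y Z X Y Z' "\<i> X" "\<i> Y" "mor f"] mor_hom[of f] src_obj[of f] tgt_obj[of f]
  by (intro arrow_eqI) (auto simp: mor_simps idm_in_hom tmor_idm)
lemma lu_natural: "\<lbrakk>ok f; src f = Z; tgt f = Z'\<rbrakk> \<Longrightarrow> lu Z' \<bullet> (\<one> \<rhd> f) = f \<bullet> lu Z"
  using lun_natural[of Z Z' "mor f"] mor_hom[of f] src_obj[of f] tgt_obj[of f]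
  by (intro arrow_eqI) (auto simp: mor_simps)
lemma ru_natural: "\<lbrakk>ok f; src f = Z; tgt f = Z'\<rbrakk> \<Longrightarrow> ru Z' \<bullet> (f \<lhd> \<one>) = f \<bullet> ru Z"
  using run_natural[of Z Z' "mor f"] mor_hom[of f] src_obj[of f] tgt_obj[of f]
  by (intro arrow_eqI) (auto simp: mor_simps)

lemma pentagon_arrow: "\<lbrakk>W \<in> obj C; X \<in> obj C; Y \<in> obj C; Z \<in> obj C\<rbrakk> \<Longrightarrow>
   \<alpha> W X (Y \<otimes> Z) \<bullet> \<alpha> (W \<otimes> X) Y Z = (W \<rhd> \<alpha> X Y Z) \<bullet> (\<alpha> W (X \<otimes> Y) Z \<bullet> (\<alpha> W X Y \<lhd> Z))"
  using pentagon[of W X Y Z] by (intro arrow_eqI) (auto simp: mor_simps)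
lemma triangle_arrow: "\<lbrakk>X \<in> obj C; Y \<in> obj C\<rbrakk> \<Longrightarrow> (X \<rhd> lu Y) \<bullet> \<alpha> X \<one> Y = ru X \<lhd> Y"
  using triangle[of X Y] by (intro arrow_eqI) (auto simp: mor_simps)

lemma rwhisk_unit_faithful:
  assumes "ok f" "ok g" "src f = src g" "tgt f = tgt g" "f \<lhd> \<one> = g \<lhd> \<one>" shows "f = g"
proof -
  have "f \<bullet> ru (src f) = g \<bullet> ru (src f)"
    using ru_natural[of f] ru_natural[of g] assms by metis
  with assms show ?thesis
    by (intro iso_cancel_right[of "ru (src f)" "rui (src f)" "src f" f g]) auto
qed
lemma lwhisk_unit_faithful:
  assumes "ok f" "ok g" "src f = src g" "tgt f = tgt g" "\<one> \<rhd> f = \<one> \<rhd> g" shows "f = g"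
proof -
  have "f \<bullet> lu (src f) = g \<bullet> lu (src f)"
    using lu_natural[of f] lu_natural[of g] assms by metis
  with assms show ?thesis
    by (intro iso_cancel_right[of "lu (src f)" "lui (src f)" "src f" f g]) auto
qed

text \<open>Read from left to right, this lemma and the ones with similar names below push every right whiskering
inwards until it meets an atomic arrow, and turn every left whiskering with a tensor product into two.
The associators created on the way cancel, so that simplification with them (the collection
\<open>strictify\<close>) decides most equations that hold by coherence and naturality alone.\<close>
lemma rwhisk_rwhisk: "\<lbrakk>ok f; Y \<in> obj C; Z \<in> obj C\<rbrakk> \<Longrightarrow> f \<lhd> Y \<lhd> Z = \<alpha>i (tgt f) Y Z \<bullet> ((f \<lhd> (Y \<otimes> Z)) \<bullet> \<alpha> (src f) Y Z)"
  using solve_left[OF \<alpha>_inv(2), OF _ _ _ _ _ \<alpha>_natural1[of f]] by auto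
lemma rwhisk_lwhisk: "\<lbrakk>ok f; X \<in> obj C; Z \<in> obj C\<rbrakk> \<Longrightarrow> (X \<rhd> f) \<lhd> Z = \<alpha>i X (tgt f) Z \<bullet> ((X \<rhd> (f \<lhd> Z)) \<bullet> \<alpha> X (src f) Z)"
  using solve_left[OF \<alpha>_inv(2), OF _ _ _ _ _ \<alpha>_natural2[of f]] by auto
lemma lwhisk_tensor: "\<lbrakk>ok f; X \<in> obj C; Y \<in> obj C\<rbrakk> \<Longrightarrow> (X \<otimes> Y) \<rhd> f = \<alpha>i X Y (tgt f) \<bullet> ((X \<rhd> Y \<rhd> f) \<bullet> \<alpha> X Y (src f))"
  using solve_left[OF \<alpha>_inv(2), OF _ _ _ _ _ \<alpha>_natural3[of f]] by auto
lemma lwhisk_unit: "ok f \<Longrightarrow> \<one> \<rhd> f = lui (tgt f) \<bullet> (f \<bullet> lu (src f))"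
  using solve_left[OF lu_inv(2), OF _ _ _ lu_natural[of f]] by auto
lemma rwhisk_unit: "ok f \<Longrightarrow> f \<lhd> \<one> = rui (tgt f) \<bullet> (f \<bullet> ru (src f))"
  using solve_left[OF ru_inv(2), OF _ _ _ ru_natural[of f]] by auto
lemma rwhisk_\<alpha>: "\<lbrakk>W \<in> obj C; X \<in> obj C; Y \<in> obj C; Z \<in> obj C\<rbrakk> \<Longrightarrow>
   \<alpha> W X Y \<lhd> Z = \<alpha>i W (X \<otimes> Y) Z \<bullet> ((W \<rhd> \<alpha>i X Y Z) \<bullet> (\<alpha> W X (Y \<otimes> Z) \<bullet> \<alpha> (W \<otimes> X) Y Z))"
  by (simp add: pentagon_arrow)
lemma rwhisk_\<alpha>i: "\<lbrakk>W \<in> obj C; X \<in> obj C; Y \<in> obj C; Z \<in> obj C\<rbrakk> \<Longrightarrow>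
   \<alpha>i W X Y \<lhd> Z = \<alpha>i (W \<otimes> X) Y Z \<bullet> (\<alpha>i W X (Y \<otimes> Z) \<bullet> ((W \<rhd> \<alpha> X Y Z) \<bullet> \<alpha> W (X \<otimes> Y) Z))"
  apply (rule iso_cancel_right[of "\<alpha> W X Y \<lhd> Z" "\<alpha>i W X Y \<lhd> Z" "(W \<otimes> (X \<otimes> Y)) \<otimes> Z"])
  apply (simp_all add: rwhisk_inv)
  apply (simp add: rwhisk_\<alpha>)
  done

text \<open>Kelly's argument: after whiskering with the unit from the left, which is faithful, both sides become
composites in the pentagon for \<open>\<one>, \<one>, X, Y\<close>, where the triangle axiom identifies them.\<close>
lemma lu_tensor: assumes [simp]: "X \<in> obj C" "Y \<in> obj C"
  shows "lu (X \<otimes> Y) \<bullet> \<alpha> \<one> X Y = lu X \<lhd> Y"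
proof -
  have "(\<one> \<rhd> lu (X \<otimes> Y)) \<bullet> ((\<one> \<rhd> \<alpha> \<one> X Y) \<bullet> (\<alpha> \<one> (\<one> \<otimes> X) Y \<bullet> (\<alpha> \<one> \<one> X \<lhd> Y)))
     = (ru \<one> \<lhd> (X \<otimes> Y)) \<bullet> \<alpha> (\<one> \<otimes> \<one>) X Y"
    by (simp add: pentagon_arrow[symmetric] reassoc[OF triangle_arrow])
  also have "\<dots> = \<alpha> \<one> X Y \<bullet> (ru \<one> \<lhd> X \<lhd> Y)"
    by (simp add: \<alpha>_natural1)
  also have "\<dots> = \<alpha> \<one> X Y \<bullet> (((\<one> \<rhd> lu X) \<lhd> Y) \<bullet> (\<alpha> \<one> \<one> X \<lhd> Y))"
    by (simp add: triangle_arrow[symmetric])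
  also have "\<dots> = (\<one> \<rhd> (lu X \<lhd> Y)) \<bullet> (\<alpha> \<one> (\<one> \<otimes> X) Y \<bullet> (\<alpha> \<one> \<one> X \<lhd> Y))"
    by (simp add: reassoc[OF \<alpha>_natural2])
  finally have "(\<one> \<rhd> (lu (X \<otimes> Y) \<bullet> \<alpha> \<one> X Y)) \<bullet> (\<alpha> \<one> (\<one> \<otimes> X) Y \<bullet> (\<alpha> \<one> \<one> X \<lhd> Y))
      = (\<one> \<rhd> (lu X \<lhd> Y)) \<bullet> (\<alpha> \<one> (\<one> \<otimes> X) Y \<bullet> (\<alpha> \<one> \<one> X \<lhd> Y))"
    by simp
  then have "\<one> \<rhd> (lu (X \<otimes> Y) \<bullet> \<alpha> \<one> X Y) = \<one> \<rhd> (lu X \<lhd> Y)"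
    by (rule iso_cancel_right[of "\<alpha> \<one> (\<one> \<otimes> X) Y \<bullet> (\<alpha> \<one> \<one> X \<lhd> Y)" "(\<alpha>i \<one> \<one> X \<lhd> Y) \<bullet> \<alpha>i \<one> (\<one> \<otimes> X) Y"
         "\<one> \<otimes> ((\<one> \<otimes> X) \<otimes> Y)", rotated -1])
      (simp_all add: reassoc[OF rwhisk_inv[OF \<alpha>_inv(1)]])
  then show ?thesis
    by - (rule lwhisk_unit_faithful, auto)
qed

text \<open>The mirror image of \<open>lu_tensor\<close>, from the pentagon for \<open>X, Y, \<one>, \<one>\<close>.\<close>
lemma ru_tensor: assumes [simp]: "X \<in> obj C" "Y \<in> obj C"
  shows "(X \<rhd> ru Y) \<bullet> \<alpha> X Y \<one> = ru (X \<otimes> Y)"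
proof -
  have "\<alpha> X Y \<one> \<bullet> (((X \<rhd> ru Y) \<bullet> \<alpha> X Y \<one>) \<lhd> \<one>)
      = (X \<rhd> (ru Y \<lhd> \<one>)) \<bullet> (\<alpha> X (Y \<otimes> \<one>) \<one> \<bullet> (\<alpha> X Y \<one> \<lhd> \<one>))"
    by (simp add: reassoc[OF \<alpha>_natural2])
  also have "\<dots> = (X \<rhd> Y \<rhd> lu \<one>) \<bullet> ((X \<rhd> \<alpha> Y \<one> \<one>) \<bullet> (\<alpha> X (Y \<otimes> \<one>) \<one> \<bullet> (\<alpha> X Y \<one> \<lhd> \<one>)))"
    by (simp add: triangle_arrow[symmetric])
  also have "\<dots> = \<alpha> X Y \<one> \<bullet> (((X \<otimes> Y) \<rhd> lu \<one>) \<bullet> \<alpha> (X \<otimes> Y) \<one> \<one>)"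
    by (simp add: pentagon_arrow[symmetric] reassoc[OF \<alpha>_natural3])
  also have "\<dots> = \<alpha> X Y \<one> \<bullet> (ru (X \<otimes> Y) \<lhd> \<one>)"
    by (simp add: triangle_arrow)
  finally have "((X \<rhd> ru Y) \<bullet> \<alpha> X Y \<one>) \<lhd> \<one> = ru (X \<otimes> Y) \<lhd> \<one>"
    by (rule iso_cancel_left[OF \<alpha>_inv(2)[of X Y \<one>], rotated -1]) simp_all
  then show ?thesis
    by - (rule rwhisk_unit_faithful, auto)
qed

lemma rwhisk_ru: "\<lbrakk>X \<in> obj C; Y \<in> obj C\<rbrakk> \<Longrightarrow> ru X \<lhd> Y = (X \<rhd> lu Y) \<bullet> \<alpha> X \<one> Y"
  by (simp add: triangle_arrow)
lemma rwhisk_lu: "\<lbrakk>X \<in> obj C; Y \<in> obj C\<rbrakk> \<Longrightarrow> lu X \<lhd> Y = lu (X \<otimes> Y) \<bullet> \<alpha> \<one> X Y"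
  by (simp add: lu_tensor)
lemma rwhisk_rui: "\<lbrakk>X \<in> obj C; Y \<in> obj C\<rbrakk> \<Longrightarrow> rui X \<lhd> Y = \<alpha>i X \<one> Y \<bullet> (X \<rhd> lui Y)"
  by (rule iso_cancel_left[of "rui X \<lhd> Y" "ru X \<lhd> Y" "(X \<otimes> \<one>) \<otimes> Y"]) (simp_all add: rwhisk_inv, simp add: rwhisk_ru)
lemma rwhisk_lui: "\<lbrakk>X \<in> obj C; Y \<in> obj C\<rbrakk> \<Longrightarrow> lui X \<lhd> Y = \<alpha>i \<one> X Y \<bullet> lui (X \<otimes> Y)"
  by (rule iso_cancel_left[of "lui X \<lhd> Y" "lu X \<lhd> Y" "(\<one> \<otimes> X) \<otimes> Y"]) (simp_all add: rwhisk_inv, simp add: rwhisk_lu)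

lemmas strictify = rwhisk_rwhisk rwhisk_lwhisk lwhisk_tensor rwhisk_\<alpha> rwhisk_\<alpha>i rwhisk_ru rwhisk_lu rwhisk_rui rwhisk_lui

lemma \<alpha>i_natural3: "\<lbrakk>ok f; src f = Z; tgt f = Z'; X \<in> obj C; Y \<in> obj C\<rbrakk>
    \<Longrightarrow> \<alpha>i X Y Z' \<bullet> (X \<rhd> Y \<rhd> f) = ((X \<otimes> Y) \<rhd> f) \<bullet> \<alpha>i X Y Z"
  by (auto simp: lwhisk_tensor)
lemma lui_natural: "\<lbrakk>ok f; src f = Z; tgt f = Z'\<rbrakk> \<Longrightarrow> lui Z' \<bullet> f = (\<one> \<rhd> f) \<bullet> lui Z"
  by (auto simp: lwhisk_unit)

section \<open>Caps, cups and crossings with a spectator\<close>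

text \<open>The natural families induced by a pairing \<open>X \<otimes> Y \<rightarrow> \<one>\<close>, a copairing \<open>\<one> \<rightarrow> X \<otimes> Y\<close> and a morphism
\<open>X \<otimes> Y \<rightarrow> X' \<otimes> Y'\<close> when a spectator \<open>W\<close> stands to their right, with all tensor products nested to the
right and the unit removed.\<close>
definition cap :: "('o, 'm) arrow \<Rightarrow> 'o \<Rightarrow> 'o \<Rightarrow> 'o \<Rightarrow> ('o, 'm) arrow" where
  "cap g X Y W = lu W \<bullet> ((g \<lhd> W) \<bullet> \<alpha>i X Y W)"
definition cup :: "('o, 'm) arrow \<Rightarrow> 'o \<Rightarrow> 'o \<Rightarrow> 'o \<Rightarrow> ('o, 'm) arrow" where
  "cup c X Y W = \<alpha> X Y W \<bullet> ((c \<lhd> W) \<bullet> lui W)"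
definition cross :: "('o, 'm) arrow \<Rightarrow> 'o \<Rightarrow> 'o \<Rightarrow> 'o \<Rightarrow> 'o \<Rightarrow> 'o \<Rightarrow> ('o, 'm) arrow" where
  "cross s X Y X' Y' W = \<alpha> X' Y' W \<bullet> ((s \<lhd> W) \<bullet> \<alpha>i X Y W)"

definition pairing :: "('o, 'm) arrow \<Rightarrow> 'o \<Rightarrow> 'o \<Rightarrow> bool" where
  "pairing g X Y \<longleftrightarrow> X \<in> obj C \<and> Y \<in> obj C \<and> ok g \<and> src g = X \<otimes> Y \<and> tgt g = \<one>"

definition crossing :: "('o, 'm) arrow \<Rightarrow> 'o \<Rightarrow> 'o \<Rightarrow> 'o \<Rightarrow> 'o \<Rightarrow> bool" where
  "crossing s X Y X' Y' \<longleftrightarrow> X \<in> obj C \<and> Y \<in> obj C \<and> X' \<in> obj C \<and> Y' \<in> obj C \<and> ok s \<and> src s = X \<otimes> Y \<and> tgt s = X' \<otimes> Y'"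

lemma pairingD: "pairing g X Y \<Longrightarrow> X \<in> obj C \<and> Y \<in> obj C \<and> ok g \<and> src g = X \<otimes> Y \<and> tgt g = \<one>"
  by (simp add: pairing_def)
lemma crossingD: "crossing s X Y X' Y' \<Longrightarrow> X \<in> obj C \<and> Y \<in> obj C \<and> X' \<in> obj C \<and> Y' \<in> obj C \<and> ok s \<and> src s = X \<otimes> Y \<and> tgt s = X' \<otimes> Y'"
  by (simp add: crossing_def)

lemma cap_typ [simp]:
  assumes "pairing g X Y" "W \<in> obj C"
  shows "ok (cap g X Y W)" "src (cap g X Y W) = X \<otimes> (Y \<otimes> W)" "tgt (cap g X Y W) = W"
  using assms by (auto simp: cap_def pairing_def)
lemma cross_typ [simp]:
  assumes "crossing s X Y X' Y'" "W \<in> obj C"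
  shows "ok (cross s X Y X' Y' W)" "src (cross s X Y X' Y' W) = X \<otimes> (Y \<otimes> W)" "tgt (cross s X Y X' Y' W) = X' \<otimes> (Y' \<otimes> W)"
  using assms by (auto simp: cross_def crossing_def)

lemma cap_natural:
  assumes "pairing g X Y" "ok h" "src h = W" "tgt h = W'"
  shows "cap g X Y W' \<bullet> (X \<rhd> Y \<rhd> h) = h \<bullet> cap g X Y W"
proof -
  note [simp] = pairingD[OF assms(1)]
  have [simp]: "W \<in> obj C" "W' \<in> obj C" using assms by auto
  have "cap g X Y W' \<bullet> (X \<rhd> Y \<rhd> h) = lu W' \<bullet> ((g \<lhd> W') \<bullet> (((X \<otimes> Y) \<rhd> h) \<bullet> \<alpha>i X Y W))"
    using assms by (simp add: cap_def \<alpha>i_natural3)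
  also have "\<dots> = lu W' \<bullet> ((\<one> \<rhd> h) \<bullet> ((g \<lhd> W) \<bullet> \<alpha>i X Y W))"
    using assms by (simp add: reassoc[OF interchange[of g h]])
  also have "\<dots> = h \<bullet> cap g X Y W"
    using assms by (simp add: cap_def reassoc[OF lu_natural])
  finally show ?thesis .
qed

lemma cross_natural:
  assumes "crossing s X Y X' Y'" "ok h" "src h = W" "tgt h = W'"
  shows "cross s X Y X' Y' W' \<bullet> (X \<rhd> Y \<rhd> h) = (X' \<rhd> Y' \<rhd> h) \<bullet> cross s X Y X' Y' W"
proof -
  note [simp] = crossingD[OF assms(1)]
  have [simp]: "W \<in> obj C" "W' \<in> obj C" using assms by auto
  have "cross s X Y X' Y' W' \<bullet> (X \<rhd> Y \<rhd> h) = \<alpha> X' Y' W' \<bullet> ((s \<lhd> W') \<bullet> (((X \<otimes> Y) \<rhd> h) \<bullet> \<alpha>i X Y W))"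
    using assms by (simp add: cross_def \<alpha>i_natural3)
  also have "\<dots> = \<alpha> X' Y' W' \<bullet> (((X' \<otimes> Y') \<rhd> h) \<bullet> ((s \<lhd> W) \<bullet> \<alpha>i X Y W))"
    using assms by (simp add: reassoc[OF interchange[of s h]])
  also have "\<dots> = (X' \<rhd> Y' \<rhd> h) \<bullet> cross s X Y X' Y' W"
    using assms by (simp add: cross_def reassoc[OF \<alpha>_natural3])
  finally show ?thesis .
qed

definition duality :: "'o \<Rightarrow> 'o \<Rightarrow> ('o, 'm) arrow \<Rightarrow> ('o, 'm) arrow \<Rightarrow> bool" where
  "duality A X e c \<longleftrightarrow> pairing e A X \<and> ok c \<and> src c = \<one> \<and> tgt c = X \<otimes> A \<and>
     ru X \<bullet> ((X \<rhd> e) \<bullet> (\<alpha> X A X \<bullet> ((c \<lhd> X) \<bullet> lui X))) = Id X \<and>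
     lu A \<bullet> ((e \<lhd> A) \<bullet> (\<alpha>i A X A \<bullet> ((A \<rhd> c) \<bullet> rui A))) = Id A"

lemma dualityD: "duality A X e c \<Longrightarrow> pairing e A X \<and> A \<in> obj C \<and> X \<in> obj C \<and> ok e \<and> src e = A \<otimes> X \<and> tgt e = \<one> \<and> ok c \<and> src c = \<one> \<and> tgt c = X \<otimes> A"
  by (auto simp: duality_def pairing_def)

lemma cup_typ [simp]:
  assumes "duality A X e c" "W \<in> obj C"
  shows "ok (cup c X A W)" "src (cup c X A W) = W" "tgt (cup c X A W) = X \<otimes> (A \<otimes> W)"
  using dualityD[OF assms(1)] assms(2) by (auto simp: cup_def)

lemma cup_natural:
  assumes "duality A X e c" "ok h" "src h = W" "tgt h = W'"
  shows "cup c X A W' \<bullet> h = (X \<rhd> A \<rhd> h) \<bullet> cup c X A W"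
proof -
  note [simp] = dualityD[OF assms(1)]
  have [simp]: "W \<in> obj C" "W' \<in> obj C" using assms by auto
  have "cup c X A W' \<bullet> h = \<alpha> X A W' \<bullet> ((c \<lhd> W') \<bullet> ((\<one> \<rhd> h) \<bullet> lui W))"
    using assms by (simp add: cup_def lui_natural)
  also have "\<dots> = \<alpha> X A W' \<bullet> (((X \<otimes> A) \<rhd> h) \<bullet> ((c \<lhd> W) \<bullet> lui W))"
    using assms by (simp add: reassoc[OF interchange[of c h]])
  also have "\<dots> = (X \<rhd> A \<rhd> h) \<bullet> cup c X A W"
    using assms by (simp add: cup_def reassoc[OF \<alpha>_natural3])
  finally show ?thesis .
qed

lemma zigzag1:
  assumes "duality A X e c" and [simp]: "W \<in> obj C"
  shows "(X \<rhd> cap e A X W) \<bullet> cup c X A (X \<otimes> W) = Id (X \<otimes> W)"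
proof -
  note [simp] = dualityD[OF assms(1)]
  have "Id (X \<otimes> W) = (ru X \<bullet> ((X \<rhd> e) \<bullet> (\<alpha> X A X \<bullet> ((c \<lhd> X) \<bullet> lui X)))) \<lhd> W"
    using assms by (simp add: duality_def del: rwhisk_comp)
  also have "\<dots> = (X \<rhd> cap e A X W) \<bullet> cup c X A (X \<otimes> W)"
    by (simp add: cap_def cup_def strictify)
  finally show ?thesis by simp
qed

lemma zigzag2:
  assumes "duality A X e c" and [simp]: "W \<in> obj C"
  shows "cap e A X (A \<otimes> W) \<bullet> (A \<rhd> cup c X A W) = Id (A \<otimes> W)"
proof -
  note [simp] = dualityD[OF assms(1)]
  have "Id (A \<otimes> W) = (lu A \<bullet> ((e \<lhd> A) \<bullet> (\<alpha>i A X A \<bullet> ((A \<rhd> c) \<bullet> rui A)))) \<lhd> W"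
    using assms by (simp add: duality_def del: rwhisk_comp)
  also have "\<dots> = cap e A X (A \<otimes> W) \<bullet> (A \<rhd> cup c X A W)"
    by (simp add: cap_def cup_def strictify)
  finally show ?thesis by simp
qed

text \<open>Bending the last input of \<open>m : B \<otimes> X \<rightarrow> V\<close> around to an output \<open>V \<otimes> A\<close>, where \<open>A\<close> is dual to \<open>X\<close>.
The mate of a half-braiding and the inner part of the twist both have this form.\<close>
definition bend :: "('o, 'm) arrow \<Rightarrow> 'o \<Rightarrow> 'o \<Rightarrow> ('o, 'm) arrow \<Rightarrow> 'o \<Rightarrow> ('o, 'm) arrow" where
  "bend m B X c A = (m \<lhd> A) \<bullet> (\<alpha>i B X A \<bullet> ((B \<rhd> c) \<bullet> rui B))"

lemma bend_typ [simp]: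
  assumes "duality A X e c" "ok m" "B \<in> obj C" "src m = B \<otimes> X"
  shows "ok (bend m B X c A)" "src (bend m B X c A) = B" "tgt (bend m B X c A) = tgt m \<otimes> A"
  using dualityD[OF assms(1)] assms(2-) by (auto simp: bend_def)

lemma bend_whisker:
  assumes "duality A X e c" "ok m" "B \<in> obj C" "src m = B \<otimes> X" "tgt m = V" and [simp]: "W \<in> obj C"
  shows "\<alpha> V A W \<bullet> (bend m B X c A \<lhd> W) = (m \<lhd> (A \<otimes> W)) \<bullet> (\<alpha>i B X (A \<otimes> W) \<bullet> (B \<rhd> cup c X A W))"
proof -
  note [simp] = dualityD[OF assms(1)]
  have [simp]: "V \<in> obj C" using assms by auto
  show ?thesis using assms(2-5) by (simp add: bend_def cup_def strictify)
qed

definition to_dual :: "('o, 'm) arrow \<Rightarrow> 'o \<Rightarrow> 'o \<Rightarrow> ('o, 'm) arrow \<Rightarrow> 'o \<Rightarrow> ('o, 'm) arrow" where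
  "to_dual g B X c A = lu A \<bullet> bend g B X c A"

lemma to_dual_typ [simp]:
  assumes "duality A X e c" "pairing g B X"
  shows "ok (to_dual g B X c A)" "src (to_dual g B X c A) = B" "tgt (to_dual g B X c A) = A"
  using dualityD[OF assms(1)] pairingD[OF assms(2)] assms by (auto simp: to_dual_def)

lemma to_dual_whisker:
  assumes "duality A X e c" "pairing g B X" and [simp]: "W \<in> obj C"
  shows "to_dual g B X c A \<lhd> W = cap g B X (A \<otimes> W) \<bullet> (B \<rhd> cup c X A W)"
proof -
  note [simp] = dualityD[OF assms(1)] pairingD[OF assms(2)]
  have "to_dual g B X c A \<lhd> W = lu (A \<otimes> W) \<bullet> (\<alpha> \<one> A W \<bullet> (bend g B X c A \<lhd> W))"
    using assms by (simp add: to_dual_def rwhisk_lu)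
  then show ?thesis using assms by (simp add: bend_whisker cap_def)
qed

lemma cap_pre1:
  assumes "pairing g A X" "ok u" "src u = B" "tgt u = A" "W \<in> obj C"
  shows "cap (g \<bullet> (u \<lhd> X)) B X W = cap g A X W \<bullet> (u \<lhd> (X \<otimes> W))"
  using pairingD[OF assms(1)] assms(2-) by (auto simp: cap_def strictify)
lemma cap_pre2:
  assumes "pairing g B A" "ok u" "src u = X" "tgt u = A" "W \<in> obj C"
  shows "cap (g \<bullet> (B \<rhd> u)) B X W = cap g B A W \<bullet> (B \<rhd> (u \<lhd> W))"
  using pairingD[OF assms(1)] assms(2-) by (auto simp: cap_def strictify)

text \<open>The spectator \<open>\<one>\<close> loses nothing, since whiskering with the unit is faithful.\<close>
lemma cap_inj:
  assumes "pairing g A X" "pairing g' A X" "cap g A X \<one> = cap g' A X \<one>"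
  shows "g = g'"
proof -
  note [simp] = pairingD[OF assms(1)] pairingD[OF assms(2)]
  have "(g \<lhd> \<one>) \<bullet> \<alpha>i A X \<one> = (g' \<lhd> \<one>) \<bullet> \<alpha>i A X \<one>"
    using assms(3) unfolding cap_def by - (rule iso_cancel_left[of "lui \<one>" "lu \<one>" "\<one> \<otimes> \<one>"], auto)
  then have "g \<lhd> \<one> = g' \<lhd> \<one>"
    by (rule iso_cancel_right[OF \<alpha>_inv(2), rotated -1]) auto
  then show ?thesis by - (rule rwhisk_unit_faithful, auto)
qed

lemma pairing_pre1 [intro]: "\<lbrakk>pairing g A X; ok u; src u = B; tgt u = A\<rbrakk> \<Longrightarrow> pairing (g \<bullet> (u \<lhd> X)) B X"
  by (auto simp: pairing_def)
lemma pairing_pre2 [intro]: "\<lbrakk>pairing g B A; ok u; src u = X; tgt u = A\<rbrakk> \<Longrightarrow> pairing (g \<bullet> (B \<rhd> u)) B X"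
  by (auto simp: pairing_def)

lemma to_dual_eq:
  assumes "duality A X e c" "pairing g B X"
  shows "e \<bullet> (to_dual g B X c A \<lhd> X) = g"
proof -
  note [simp] = dualityD[OF assms(1)] pairingD[OF assms(2)]
  have t: "ok (to_dual g B X c A)" "src (to_dual g B X c A) = B" "tgt (to_dual g B X c A) = A"
    using assms by auto
  have "cap e A X \<one> \<bullet> (to_dual g B X c A \<lhd> (X \<otimes> \<one>))
     = (cap e A X \<one> \<bullet> cap g B X (A \<otimes> (X \<otimes> \<one>))) \<bullet> (B \<rhd> cup c X A (X \<otimes> \<one>))"
    using assms by (simp add: to_dual_whisker)
  also have "\<dots> = (cap g B X \<one> \<bullet> (B \<rhd> X \<rhd> cap e A X \<one>)) \<bullet> (B \<rhd> cup c X A (X \<otimes> \<one>))"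
    using assms by (subst cap_natural[of g B X "cap e A X \<one>"]) simp_all
  also have "\<dots> = cap g B X \<one> \<bullet> (B \<rhd> ((X \<rhd> cap e A X \<one>) \<bullet> cup c X A (X \<otimes> \<one>)))"
    using assms by simp
  also have "\<dots> = cap g B X \<one>"
    using assms by (simp add: zigzag1 del: lwhisk_comp)
  finally have "cap (e \<bullet> (to_dual g B X c A \<lhd> X)) B X \<one> = cap g B X \<one>"
    using t by (simp add: cap_pre1[of e A X _ B])
  moreover have "pairing (e \<bullet> (to_dual g B X c A \<lhd> X)) B X"
    using t by (intro pairing_pre1[of e A]) simp_all
  ultimately show ?thesis
    using assms(2) cap_inj by blast
qed

text \<open>By the second zigzag an arrow into the dual \<open>A\<close> is recovered from the pairing that it induces.\<close>
lemma to_dual_unique: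
  assumes "duality A X e c" "ok u" "ok v" "src u = B" "src v = B" "tgt u = A" "tgt v = A"
    and eq: "e \<bullet> (u \<lhd> X) = e \<bullet> (v \<lhd> X)"
  shows "u = v"
proof -
  note [simp] = dualityD[OF assms(1)]
  have B: "B \<in> obj C" using assms by auto
  have "w \<lhd> \<one> = cap (e \<bullet> (w \<lhd> X)) B X (A \<otimes> \<one>) \<bullet> (B \<rhd> cup c X A \<one>)" if w: "ok w" "src w = B" "tgt w = A" for w
  proof -
    have "w \<lhd> \<one> = (cap e A X (A \<otimes> \<one>) \<bullet> (A \<rhd> cup c X A \<one>)) \<bullet> (w \<lhd> \<one>)"
      unfolding zigzag2[OF assms(1) unit_obj] using w by simp
    also have "\<dots> = cap e A X (A \<otimes> \<one>) \<bullet> ((w \<lhd> (X \<otimes> (A \<otimes> \<one>))) \<bullet> (B \<rhd> cup c X A \<one>))"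
      using w assms(1) B by (simp add: interchange[of w "cup c X A \<one>"])
    finally show ?thesis using w assms(1) B by (simp add: cap_pre1[of e A X w B])
  qed
  then have "u \<lhd> \<one> = v \<lhd> \<one>" using assms by metis
  then show ?thesis using assms by - (rule rwhisk_unit_faithful, auto)
qed

text \<open>The pairing of \<open>D \<otimes> B\<close> with \<open>X \<otimes> Y\<close> that contracts \<open>B\<close> with \<open>X\<close> inside and \<open>D\<close> with \<open>Y\<close> outside.\<close>
definition nest :: "('o, 'm) arrow \<Rightarrow> 'o \<Rightarrow> 'o \<Rightarrow> ('o, 'm) arrow \<Rightarrow> 'o \<Rightarrow> 'o \<Rightarrow> ('o, 'm) arrow" where
  "nest g B X h D Y = h \<bullet> ((D \<rhd> (lu Y \<bullet> ((g \<lhd> Y) \<bullet> \<alpha>i B X Y))) \<bullet> \<alpha> D B (X \<otimes> Y))"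

lemma nest_pairing: "\<lbrakk>pairing g B X; pairing h D Y\<rbrakk> \<Longrightarrow> pairing (nest g B X h D Y) (D \<otimes> B) (X \<otimes> Y)"
  by (auto simp: nest_def pairing_def)

lemma cap_nest:
  assumes "pairing g B X" "pairing h D Y" "W \<in> obj C"
  shows "cap (nest g B X h D Y) (D \<otimes> B) (X \<otimes> Y) W
     = cap h D Y W \<bullet> ((D \<rhd> cap g B X (Y \<otimes> W)) \<bullet> ((D \<rhd> B \<rhd> \<alpha> X Y W) \<bullet> \<alpha> D B ((X \<otimes> Y) \<otimes> W)))"
  using pairingD[OF assms(1)] pairingD[OF assms(2)] assms(3)
  by (auto simp: cap_def nest_def strictify)

lemma nest_pre:
  assumes "pairing g B X" "pairing h D Y" "ok u" "src u = B'" "tgt u = B" "ok v" "src v = D'" "tgt v = D"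
  shows "nest (g \<bullet> (u \<lhd> X)) B' X (h \<bullet> (v \<lhd> Y)) D' Y = nest g B X h D Y \<bullet> (((v \<lhd> B) \<bullet> (D' \<rhd> u)) \<lhd> (X \<otimes> Y))"
proof -
  note [simp] = pairingD[OF assms(1)] pairingD[OF assms(2)]
  have [simp]: "B' \<in> obj C" "D' \<in> obj C" using assms by auto
  have 1: "(v \<lhd> Y) \<bullet> ((D' \<rhd> lu Y) \<bullet> ((D' \<rhd> (g \<lhd> Y)) \<bullet> ((D' \<rhd> \<alpha>i B X Y) \<bullet> q)))
     = (D \<rhd> lu Y) \<bullet> ((D \<rhd> (g \<lhd> Y)) \<bullet> ((D \<rhd> \<alpha>i B X Y) \<bullet> ((v \<lhd> (B \<otimes> (X \<otimes> Y))) \<bullet> q)))" if "ok q" "tgt q = D' \<otimes> (B \<otimes> (X \<otimes> Y))" for q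
    using reassoc[OF interchange[of v "lu Y \<bullet> ((g \<lhd> Y) \<bullet> \<alpha>i B X Y)" D' D "B \<otimes> (X \<otimes> Y)" Y], of q] assms(3-) by auto
  show ?thesis
    using assms(3-) by (simp add: nest_def strictify 1)
qed

end

section \<open>The pivotal structure\<close>

context spherical_fusion_category
begin

definition evA :: "'o \<Rightarrow> ('o, 'm) arrow" where "evA X = arrow (X\<^sup>\<star> \<otimes> X) \<one> (ev C X)"
definition coA :: "'o \<Rightarrow> ('o, 'm) arrow" where "coA X = arrow \<one> (X \<otimes> X\<^sup>\<star>) (coev C X)"
definition pvA :: "'o \<Rightarrow> ('o, 'm) arrow" where "pvA X = arrow X (X\<^sup>\<star>\<^sup>\<star>) (piv C X)"

lemma dual_obj [simp]: "X \<in> obj C \<Longrightarrow> X\<^sup>\<star> \<in> obj C"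
  using dual[of X] by (simp add: dual_pair_def)

lemma evA_typ [simp]: "X \<in> obj C \<Longrightarrow> ok (evA X) \<and> src (evA X) = X\<^sup>\<star> \<otimes> X \<and> tgt (evA X) = \<one> \<and> mor (evA X) = ev C X"
  using dual[of X] unfolding evA_def by (simp add: dual_pair_def arrow_ok)
lemma coA_typ [simp]: "X \<in> obj C \<Longrightarrow> ok (coA X) \<and> src (coA X) = \<one> \<and> tgt (coA X) = X \<otimes> X\<^sup>\<star> \<and> mor (coA X) = coev C X"
  using dual[of X] unfolding coA_def by (simp add: dual_pair_def arrow_ok)
lemma pvA_typ [simp]: "X \<in> obj C \<Longrightarrow> ok (pvA X) \<and> src (pvA X) = X \<and> tgt (pvA X) = X\<^sup>\<star>\<^sup>\<star> \<and> mor (pvA X) = piv C X"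
  using piv_iso[of X] unfolding pvA_def by (simp add: is_iso_def inverses_def arrow_ok)

definition pviA :: "'o \<Rightarrow> ('o, 'm) arrow" where
  "pviA X = arrow (X\<^sup>\<star>\<^sup>\<star>) X (inv_mor C X (X\<^sup>\<star>\<^sup>\<star>) (piv C X))"

lemma pv_inverses: "X \<in> obj C \<Longrightarrow> inverses C X (X\<^sup>\<star>\<^sup>\<star>) (piv C X) (inv_mor C X (X\<^sup>\<star>\<^sup>\<star>) (piv C X))"
  by (intro inv_mor_inverses piv_iso) auto
lemma pviA_typ [simp]: "X \<in> obj C \<Longrightarrow> ok (pviA X) \<and> src (pviA X) = X\<^sup>\<star>\<^sup>\<star> \<and> tgt (pviA X) = X
     \<and> mor (pviA X) = inv_mor C X (X\<^sup>\<star>\<^sup>\<star>) (piv C X)"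
  using pv_inverses[of X] unfolding pviA_def by (simp add: inverses_def arrow_ok)
lemma pvA_inv [simp]: "X \<in> obj C \<Longrightarrow> pvA X \<bullet> pviA X = Id (X\<^sup>\<star>\<^sup>\<star>)" "X \<in> obj C \<Longrightarrow> pviA X \<bullet> pvA X = Id X"
  using pv_inverses[of X] by (auto intro!: arrow_eqI simp: inverses_def mor_comp)

lemma duality_ev [simp]: "X \<in> obj C \<Longrightarrow> duality (X\<^sup>\<star>) X (evA X) (coA X)"
  using dual[of X] unfolding dual_pair_def duality_def pairing_def
  by (auto intro!: arrow_eqI simp: mor_simps)

abbreviation cocup :: "'o \<Rightarrow> 'o \<Rightarrow> ('o, 'm) arrow" where "cocup X \<equiv> cup (coA X) X (X\<^sup>\<star>)"

lemma cocup_typ [simp]: "\<lbrakk>X \<in> obj C; W \<in> obj C\<rbrakk> \<Longrightarrow> ok (cocup X W) \<and> src (cocup X W) = W \<and> tgt (cocup X W) = X \<otimes> (X\<^sup>\<star> \<otimes> W)"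
  using cup_typ[OF duality_ev] by auto

lemma ev_pairing [simp]: "X \<in> obj C \<Longrightarrow> pairing (evA X) (X\<^sup>\<star>) X" by (simp add: pairing_def)

lemma to_dual_mor:
  assumes "pairing g B X"
  shows "mor (to_dual g B X (coA X) (X\<^sup>\<star>)) = transpose C B X (mor g)"
  using pairingD[OF assms] unfolding to_dual_def bend_def transpose_def by (auto simp: mor_simps)

definition dualA :: "('o, 'm) arrow \<Rightarrow> ('o, 'm) arrow" where
  "dualA f = to_dual (evA (tgt f) \<bullet> ((tgt f)\<^sup>\<star> \<rhd> f)) ((tgt f)\<^sup>\<star>) (src f) (coA (src f)) ((src f)\<^sup>\<star>)"

lemma dualA_pairing: "ok f \<Longrightarrow> pairing (evA (tgt f) \<bullet> ((tgt f)\<^sup>\<star> \<rhd> f)) ((tgt f)\<^sup>\<star>) (src f)"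
  by (simp add: pairing_def)

lemma dualA_typ [simp]:
  assumes "ok f" shows "ok (dualA f)" "src (dualA f) = (tgt f)\<^sup>\<star>" "tgt (dualA f) = (src f)\<^sup>\<star>"
  using to_dual_typ[OF duality_ev dualA_pairing[OF assms]] assms unfolding dualA_def by simp_all
lemma dualA_mor: "ok f \<Longrightarrow> mor (dualA f) = dual_mor C (src f) (tgt f) (mor f)"
  unfolding dualA_def dual_mor_def by (simp add: to_dual_mor[OF dualA_pairing] mor_simps)

lemma dualA_eq: "ok f \<Longrightarrow> evA (src f) \<bullet> (dualA f \<lhd> src f) = evA (tgt f) \<bullet> ((tgt f)\<^sup>\<star> \<rhd> f)"
  unfolding dualA_def by (rule to_dual_eq) (auto intro: dualA_pairing)

lemma pv_natural: "ok f \<Longrightarrow> pvA (tgt f) \<bullet> f = dualA (dualA f) \<bullet> pvA (src f)"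
  using piv_natural[of "src f" "tgt f" "mor f"] mor_hom[of f]
  by (intro arrow_eqI) (auto simp: mor_simps dualA_mor)

definition pev :: "'o \<Rightarrow> ('o, 'm) arrow" where "pev X = evA (X\<^sup>\<star>) \<bullet> (pvA X \<lhd> X\<^sup>\<star>)"

lemma pev_pairing [simp]: "X \<in> obj C \<Longrightarrow> pairing (pev X) X (X\<^sup>\<star>)"
  by (simp add: pev_def pairing_def)
lemma pev_typ [simp]: "X \<in> obj C \<Longrightarrow> ok (pev X) \<and> src (pev X) = X \<otimes> X\<^sup>\<star> \<and> tgt (pev X) = \<one> \<and> mor (pev X) = piv_ev C X"
  by (simp add: pev_def mor_simps piv_ev_def)

abbreviation pcap :: "'o \<Rightarrow> 'o \<Rightarrow> ('o, 'm) arrow" where "pcap X \<equiv> cap (pev X) X (X\<^sup>\<star>)"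

text \<open>Naturality of the pivotal structure turns \<open>f\<close> into its double dual, and the evaluation of \<open>Y\<^sup>\<star>\<close> turns
this back into a single dual.  So the evaluations \<open>X \<otimes> X\<^sup>\<star> \<rightarrow> \<one>\<close> given by the pivotal structure are
natural for the same dual morphisms as the evaluations \<open>X\<^sup>\<star> \<otimes> X \<rightarrow> \<one>\<close>.\<close>
lemma pev_natural:
  assumes "ok f" "src f = X" "tgt f = Y"
  shows "pev Y \<bullet> (f \<lhd> Y\<^sup>\<star>) = pev X \<bullet> (X \<rhd> dualA f)"
proof -
  have [simp]: "X \<in> obj C" "Y \<in> obj C" using assms by auto
  have "pev Y \<bullet> (f \<lhd> Y\<^sup>\<star>) = evA (Y\<^sup>\<star>) \<bullet> ((pvA Y \<bullet> f) \<lhd> Y\<^sup>\<star>)"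
    using assms by (simp add: pev_def)
  also have "\<dots> = evA (Y\<^sup>\<star>) \<bullet> ((dualA (dualA f) \<lhd> Y\<^sup>\<star>) \<bullet> (pvA X \<lhd> Y\<^sup>\<star>))"
    using assms pv_natural[of f] by simp
  also have "\<dots> = evA (X\<^sup>\<star>) \<bullet> ((X\<^sup>\<star>\<^sup>\<star> \<rhd> dualA f) \<bullet> (pvA X \<lhd> Y\<^sup>\<star>))"
    using assms reassoc[OF dualA_eq[of "dualA f"]] by simp
  also have "\<dots> = pev X \<bullet> (X \<rhd> dualA f)"
    using assms by (simp add: pev_def interchange[of "pvA X" "dualA f"])
  finally show ?thesis .
qed

definition dtensor :: "'o \<Rightarrow> 'o \<Rightarrow> ('o, 'm) arrow" where
  "dtensor X Y = to_dual (nest (evA X) (X\<^sup>\<star>) X (evA Y) (Y\<^sup>\<star>) Y) (Y\<^sup>\<star> \<otimes> X\<^sup>\<star>) (X \<otimes> Y) (coA (X \<otimes> Y)) ((X \<otimes> Y)\<^sup>\<star>)"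

context
  fixes X Y assumes [simp]: "X \<in> obj C" "Y \<in> obj C"
begin

lemma nested_ev_pairing: "pairing (nest (evA X) (X\<^sup>\<star>) X (evA Y) (Y\<^sup>\<star>) Y) (Y\<^sup>\<star> \<otimes> X\<^sup>\<star>) (X \<otimes> Y)"
  by (rule nest_pairing) auto
lemma dtensor_typ: "ok (dtensor X Y) \<and> src (dtensor X Y) = Y\<^sup>\<star> \<otimes> X\<^sup>\<star> \<and> tgt (dtensor X Y) = (X \<otimes> Y)\<^sup>\<star>"
  using to_dual_typ[OF duality_ev nested_ev_pairing] unfolding dtensor_def by simp
lemma dtensor_mor: "mor (dtensor X Y) = dual_tensor C X Y"
  unfolding dtensor_def dual_tensor_def by (simp add: to_dual_mor[OF nested_ev_pairing]) (simp add: nest_def mor_simps del: lwhisk_comp)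
lemma dtensor_eq: "evA (X \<otimes> Y) \<bullet> (dtensor X Y \<lhd> (X \<otimes> Y)) = nest (evA X) (X\<^sup>\<star>) X (evA Y) (Y\<^sup>\<star>) Y"
  unfolding dtensor_def by (rule to_dual_eq) (auto intro: nested_ev_pairing)

end

declare dtensor_typ [simp]

lemma pv_monoidal:
  assumes [simp]: "X \<in> obj C" "Y \<in> obj C"
  shows "dualA (dtensor X Y) \<bullet> pvA (X \<otimes> Y) = dtensor (Y\<^sup>\<star>) (X\<^sup>\<star>) \<bullet> ((pvA X \<lhd> Y\<^sup>\<star>\<^sup>\<star>) \<bullet> (X \<rhd> pvA Y))"
  using piv_monoidal[of X Y] interchange_mor(1)[of "pvA X" "pvA Y"]
  by (intro arrow_eqI) (auto simp: mor_comp dualA_mor dtensor_mor)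

text \<open>Monoidality of the pivotal structure, restated for evaluations: on a tensor product the evaluation
is, up to the canonical map \<open>Y\<^sup>\<star> \<otimes> X\<^sup>\<star> \<rightarrow> (X \<otimes> Y)\<^sup>\<star>\<close>, the nested evaluation.\<close>
lemma pev_tensor:
  assumes [simp]: "X \<in> obj C" "Y \<in> obj C"
  shows "pev (X \<otimes> Y) \<bullet> ((X \<otimes> Y) \<rhd> dtensor X Y) = nest (pev Y) Y (Y\<^sup>\<star>) (pev X) X (X\<^sup>\<star>)"
proof -
  let ?D = "Y\<^sup>\<star> \<otimes> X\<^sup>\<star>"
  have "pev (X \<otimes> Y) \<bullet> ((X \<otimes> Y) \<rhd> dtensor X Y) = evA ((X \<otimes> Y)\<^sup>\<star>) \<bullet> (((X \<otimes> Y)\<^sup>\<star>\<^sup>\<star> \<rhd> dtensor X Y) \<bullet> (pvA (X \<otimes> Y) \<lhd> ?D))"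
    by (simp add: pev_def interchange[of "pvA (X \<otimes> Y)" "dtensor X Y"])
  also have "\<dots> = evA ?D \<bullet> ((dualA (dtensor X Y) \<bullet> pvA (X \<otimes> Y)) \<lhd> ?D)"
    using reassoc[OF dualA_eq[of "dtensor X Y", symmetric]] by simp
  also have "\<dots> = (evA ?D \<bullet> (dtensor (Y\<^sup>\<star>) (X\<^sup>\<star>) \<lhd> ?D)) \<bullet> (((pvA X \<lhd> Y\<^sup>\<star>\<^sup>\<star>) \<bullet> (X \<rhd> pvA Y)) \<lhd> ?D)"
    unfolding pv_monoidal[OF assms] by simp
  also have "\<dots> = nest (evA (Y\<^sup>\<star>)) (Y\<^sup>\<star>\<^sup>\<star>) (Y\<^sup>\<star>) (evA (X\<^sup>\<star>)) (X\<^sup>\<star>\<^sup>\<star>) (X\<^sup>\<star>) \<bullet> (((pvA X \<lhd> Y\<^sup>\<star>\<^sup>\<star>) \<bullet> (X \<rhd> pvA Y)) \<lhd> ?D)"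
    by (simp add: dtensor_eq)
  also have "\<dots> = nest (pev Y) Y (Y\<^sup>\<star>) (pev X) X (X\<^sup>\<star>)"
    unfolding pev_def by (rule nest_pre[symmetric]) auto
  finally show ?thesis .
qed

text \<open>The premise says that \<open>F\<close> is the dual of \<open>s\<close> with respect to the nested evaluations \<open>X\<^sup>\<star> \<otimes> X \<rightarrow> \<one>\<close>,
the conclusion that it is also the dual with respect to the evaluations \<open>X \<otimes> X\<^sup>\<star> \<rightarrow> \<one>\<close>.  Working with
nested evaluations avoids inverting the canonical map \<open>Y\<^sup>\<star> \<otimes> X\<^sup>\<star> \<rightarrow> (X \<otimes> Y)\<^sup>\<star>\<close>.\<close>
lemma left_mate_eq_right_mate:
  assumes [simp]: "X \<in> obj C" "Y \<in> obj C" "X' \<in> obj C" "Y' \<in> obj C"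
    and s [simp]: "ok s" "src s = X \<otimes> Y" "tgt s = X' \<otimes> Y'"
    and F [simp]: "ok F" "src F = Y'\<^sup>\<star> \<otimes> X'\<^sup>\<star>" "tgt F = Y\<^sup>\<star> \<otimes> X\<^sup>\<star>"
    and mate: "nest (evA X) (X\<^sup>\<star>) X (evA Y) (Y\<^sup>\<star>) Y \<bullet> (F \<lhd> (X \<otimes> Y))
      = nest (evA X') (X'\<^sup>\<star>) X' (evA Y') (Y'\<^sup>\<star>) Y' \<bullet> ((Y'\<^sup>\<star> \<otimes> X'\<^sup>\<star>) \<rhd> s)"
  shows "nest (pev Y') Y' (Y'\<^sup>\<star>) (pev X') X' (X'\<^sup>\<star>) \<bullet> (s \<lhd> (Y'\<^sup>\<star> \<otimes> X'\<^sup>\<star>))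
      = nest (pev Y) Y (Y\<^sup>\<star>) (pev X) X (X\<^sup>\<star>) \<bullet> ((X \<otimes> Y) \<rhd> F)"
proof -
  let ?D = "Y'\<^sup>\<star> \<otimes> X'\<^sup>\<star>"
  have "evA (X \<otimes> Y) \<bullet> ((dualA s \<bullet> dtensor X' Y') \<lhd> (X \<otimes> Y)) = evA (X' \<otimes> Y') \<bullet> (((X' \<otimes> Y')\<^sup>\<star> \<rhd> s) \<bullet> (dtensor X' Y' \<lhd> (X \<otimes> Y)))"
    using reassoc[OF dualA_eq[of s]] by simp
  also have "\<dots> = (evA (X' \<otimes> Y') \<bullet> (dtensor X' Y' \<lhd> (X' \<otimes> Y'))) \<bullet> (?D \<rhd> s)"
    by (simp add: interchange[of "dtensor X' Y'" s])
  also have "\<dots> = (evA (X \<otimes> Y) \<bullet> (dtensor X Y \<lhd> (X \<otimes> Y))) \<bullet> (F \<lhd> (X \<otimes> Y))"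
    unfolding dtensor_eq[OF assms(1,2)] dtensor_eq[OF assms(3,4)] mate ..
  also have "\<dots> = evA (X \<otimes> Y) \<bullet> ((dtensor X Y \<bullet> F) \<lhd> (X \<otimes> Y))" by simp
  finally have eq: "dualA s \<bullet> dtensor X' Y' = dtensor X Y \<bullet> F"
    by (rule to_dual_unique[OF duality_ev, rotated -1]) auto
  have "nest (pev Y') Y' (Y'\<^sup>\<star>) (pev X') X' (X'\<^sup>\<star>) \<bullet> (s \<lhd> ?D) = pev (X' \<otimes> Y') \<bullet> ((s \<lhd> (X' \<otimes> Y')\<^sup>\<star>) \<bullet> ((X \<otimes> Y) \<rhd> dtensor X' Y'))"
    by (simp add: pev_tensor[symmetric] interchange[of s "dtensor X' Y'"])
  also have "\<dots> = pev (X \<otimes> Y) \<bullet> ((X \<otimes> Y) \<rhd> (dualA s \<bullet> dtensor X' Y'))"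
    by (simp add: reassoc[OF pev_natural[of s]])
  also have "\<dots> = nest (pev Y) Y (Y\<^sup>\<star>) (pev X) X (X\<^sup>\<star>) \<bullet> ((X \<otimes> Y) \<rhd> F)"
    unfolding eq by (simp add: reassoc[OF pev_tensor])
  finally show ?thesis .
qed

end

section \<open>Half-braidings and centrality of the twist\<close>

locale half_braided = spherical_fusion_category C
  for C :: "('o, 'm::ab_group_add, 'z) pivotal_cat_scheme" (structure) +
  fixes A :: 'o and e :: "'o \<Rightarrow> 'm"
  assumes A_obj [simp]: "A \<in> obj C" and half_braiding: "half_braiding C A e"
begin

definition E :: "'o \<Rightarrow> ('o, 'm) arrow" where "E Z = arrow (A \<otimes> Z) (Z \<otimes> A) (e Z)"
definition Ei :: "'o \<Rightarrow> ('o, 'm) arrow" where "Ei Z = arrow (Z \<otimes> A) (A \<otimes> Z) (inv_mor C (A \<otimes> Z) (Z \<otimes> A) (e Z))"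

lemma e_inverses: "Z \<in> obj C \<Longrightarrow> inverses C (A \<otimes> Z) (Z \<otimes> A) (e Z) (inv_mor C (A \<otimes> Z) (Z \<otimes> A) (e Z))"
  using half_braiding by (intro inv_mor_inverses) (auto simp: half_braiding_def)

lemma E_typ [simp]: "Z \<in> obj C \<Longrightarrow> ok (E Z) \<and> src (E Z) = A \<otimes> Z \<and> tgt (E Z) = Z \<otimes> A \<and> mor (E Z) = e Z"
  using e_inverses[of Z] unfolding E_def by (simp add: inverses_def arrow_ok)
lemma Ei_typ [simp]: "Z \<in> obj C \<Longrightarrow> ok (Ei Z) \<and> src (Ei Z) = Z \<otimes> A \<and> tgt (Ei Z) = A \<otimes> Z
   \<and> mor (Ei Z) = inv_mor C (A \<otimes> Z) (Z \<otimes> A) (e Z)"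
  using e_inverses[of Z] unfolding Ei_def by (simp add: inverses_def arrow_ok)
lemma E_inv [simp]: "Z \<in> obj C \<Longrightarrow> E Z \<bullet> Ei Z = Id (Z \<otimes> A)" "Z \<in> obj C \<Longrightarrow> Ei Z \<bullet> E Z = Id (A \<otimes> Z)"
  using e_inverses[of Z] by (auto intro!: arrow_eqI simp: inverses_def mor_comp)

lemma E_natural: "\<lbrakk>ok f; src f = Z; tgt f = W\<rbrakk> \<Longrightarrow> (f \<lhd> A) \<bullet> E Z = E W \<bullet> (A \<rhd> f)"
  using half_braiding mor_hom[of f] src_obj[of f] tgt_obj[of f] unfolding half_braiding_def
  by (intro arrow_eqI) (auto simp: mor_simps)
lemma E_hexagon: "\<lbrakk>Z \<in> obj C; W \<in> obj C\<rbrakk> \<Longrightarrow>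
    \<alpha> Z W A \<bullet> (E (Z \<otimes> W) \<bullet> \<alpha> A Z W) = (Z \<rhd> E W) \<bullet> (\<alpha> Z A W \<bullet> (E Z \<lhd> W))"
  using half_braiding unfolding half_braiding_def by (intro arrow_eqI) (auto simp: mor_simps)
lemma E_unit: "lu A \<bullet> E \<one> = ru A"
  using half_braiding unfolding half_braiding_def by (intro arrow_eqI) (auto simp: mor_simps)

abbreviation braid :: "'o \<Rightarrow> 'o \<Rightarrow> ('o, 'm) arrow" where "braid Z U \<equiv> cross (E Z) A Z Z A U"
abbreviation unbraid :: "'o \<Rightarrow> 'o \<Rightarrow> ('o, 'm) arrow" where "unbraid Z U \<equiv> cross (Ei Z) Z A A Z U"

lemma E_crossing [simp]: "Z \<in> obj C \<Longrightarrow> crossing (E Z) A Z Z A" by (simp add: crossing_def)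
lemma Ei_crossing [simp]: "Z \<in> obj C \<Longrightarrow> crossing (Ei Z) Z A A Z" by (simp add: crossing_def)

lemma braid_inv: "\<lbrakk>Z \<in> obj C; U \<in> obj C\<rbrakk> \<Longrightarrow> braid Z U \<bullet> unbraid Z U = Id (Z \<otimes> (A \<otimes> U))"
  "\<lbrakk>Z \<in> obj C; U \<in> obj C\<rbrakk> \<Longrightarrow> unbraid Z U \<bullet> braid Z U = Id (A \<otimes> (Z \<otimes> U))"
  unfolding cross_def by (simp_all add: reassoc[OF rwhisk_inv[OF E_inv(1)]] reassoc[OF rwhisk_inv[OF E_inv(2)]])

lemma braid_hexagon:
  assumes [simp]: "Z \<in> obj C" "V \<in> obj C" "U \<in> obj C"
  shows "(Z \<rhd> braid V U) \<bullet> braid Z (V \<otimes> U) = \<alpha> Z V (A \<otimes> U) \<bullet> (braid (Z \<otimes> V) U \<bullet> (A \<rhd> \<alpha>i Z V U))"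
proof -
  have "((Z \<rhd> E V) \<bullet> (\<alpha> Z A V \<bullet> (E Z \<lhd> V))) \<lhd> U = (\<alpha> Z V A \<bullet> (E (Z \<otimes> V) \<bullet> \<alpha> A Z V)) \<lhd> U"
    by (simp only: E_hexagon assms)
  then have "\<alpha> Z (V \<otimes> A) U \<bullet> (((Z \<rhd> E V) \<bullet> (\<alpha> Z A V \<bullet> (E Z \<lhd> V))) \<lhd> U)
      = \<alpha> Z (V \<otimes> A) U \<bullet> ((\<alpha> Z V A \<bullet> (E (Z \<otimes> V) \<bullet> \<alpha> A Z V)) \<lhd> U)"
    by (simp only:)
  then have h: "(Z \<rhd> (E V \<lhd> U)) \<bullet> (\<alpha> Z (A \<otimes> V) U \<bullet> ((\<alpha> Z A V \<lhd> U) \<bullet> (E Z \<lhd> V \<lhd> U)))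
     = \<alpha> Z (V \<otimes> A) U \<bullet> ((\<alpha> Z V A \<lhd> U) \<bullet> ((E (Z \<otimes> V) \<lhd> U) \<bullet> (\<alpha> A Z V \<lhd> U)))"
    by (simp add: reassoc[OF \<alpha>_natural2])
  have "(Z \<rhd> braid V U) \<bullet> braid Z (V \<otimes> U) = (Z \<rhd> \<alpha> V A U) \<bullet> (((Z \<rhd> (E V \<lhd> U)) \<bullet> (\<alpha> Z (A \<otimes> V) U \<bullet> ((\<alpha> Z A V \<lhd> U) \<bullet> (E Z \<lhd> V \<lhd> U))))
      \<bullet> (\<alpha>i (A \<otimes> Z) V U \<bullet> \<alpha>i A Z (V \<otimes> U)))"
    by (simp add: cross_def strictify)
  also have "\<dots> = \<alpha> Z V (A \<otimes> U) \<bullet> (braid (Z \<otimes> V) U \<bullet> (A \<rhd> \<alpha>i Z V U))"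
    unfolding h by (simp add: cross_def strictify)
  finally show ?thesis .
qed

text \<open>A strand \<open>A\<close> that crosses both legs of a pairing can be pulled off it: the half-braiding is natural
with respect to the pairing, and trivial on the unit.\<close>
lemma slide_cap:
  assumes g: "pairing g Z V" and [simp]: "U \<in> obj C"
  shows "cap g Z V (A \<otimes> U) \<bullet> ((Z \<rhd> braid V U) \<bullet> braid Z (V \<otimes> U)) = A \<rhd> cap g Z V U"
proof -
  note [simp] = pairingD[OF g]
  have n: "(g \<lhd> A \<lhd> U) \<bullet> ((E (Z \<otimes> V) \<lhd> U) \<bullet> x) = (E \<one> \<lhd> U) \<bullet> (((A \<rhd> g) \<lhd> U) \<bullet> x)" for x
  proof (rule reassoc[of "_ \<lhd> _", where c = "_ \<bullet> _", simplified comp_assoc])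
    have "((g \<lhd> A) \<bullet> E (Z \<otimes> V)) \<lhd> U = (E \<one> \<bullet> (A \<rhd> g)) \<lhd> U"
      by (simp only: E_natural[of g "Z \<otimes> V" \<one>] pairingD[OF g])
    then show "(g \<lhd> A \<lhd> U) \<bullet> (E (Z \<otimes> V) \<lhd> U) = (E \<one> \<lhd> U) \<bullet> ((A \<rhd> g) \<lhd> U)" by simp
  qed
  have u: "(lu A \<lhd> U) \<bullet> ((E \<one> \<lhd> U) \<bullet> x) = (ru A \<lhd> U) \<bullet> x" for x
  proof (rule reassoc)
    have "(lu A \<bullet> E \<one>) \<lhd> U = ru A \<lhd> U" by (simp only: E_unit)
    then show "(lu A \<lhd> U) \<bullet> (E \<one> \<lhd> U) = ru A \<lhd> U" by simp
  qed
  have "cap g Z V (A \<otimes> U) \<bullet> ((Z \<rhd> braid V U) \<bullet> braid Z (V \<otimes> U))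
     = lu (A \<otimes> U) \<bullet> ((g \<lhd> (A \<otimes> U)) \<bullet> (braid (Z \<otimes> V) U \<bullet> (A \<rhd> \<alpha>i Z V U)))"
    by (simp add: braid_hexagon cap_def)
  also have "\<dots> = (lu A \<lhd> U) \<bullet> ((g \<lhd> A \<lhd> U) \<bullet> ((E (Z \<otimes> V) \<lhd> U) \<bullet> (\<alpha>i A (Z \<otimes> V) U \<bullet> (A \<rhd> \<alpha>i Z V U))))"
    by (simp add: cross_def strictify)
  also have "\<dots> = A \<rhd> cap g Z V U"
    unfolding n u by (simp add: cap_def strictify)
  finally show ?thesis .
qed

text \<open>Naturality of the half-braiding for \<open>s\<close>, in the form of the third Reidemeister move.  With \<open>s\<close> a
component of the half-braiding this is the Yang-Baxter relation.\<close>
lemma slide_cross: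
  assumes s: "crossing s Z V Z' V'" and [simp]: "U \<in> obj C"
  shows "cross s Z V Z' V' (A \<otimes> U) \<bullet> ((Z \<rhd> braid V U) \<bullet> braid Z (V \<otimes> U))
     = (Z' \<rhd> braid V' U) \<bullet> (braid Z' (V' \<otimes> U) \<bullet> (A \<rhd> cross s Z V Z' V' U))"
proof -
  note [simp] = crossingD[OF s]
  have n: "(s \<lhd> A \<lhd> U) \<bullet> ((E (Z \<otimes> V) \<lhd> U) \<bullet> x) = (E (Z' \<otimes> V') \<lhd> U) \<bullet> (((A \<rhd> s) \<lhd> U) \<bullet> x)" for x
  proof (rule reassoc[of "_ \<lhd> _", where c = "_ \<bullet> _", simplified comp_assoc])
    have "((s \<lhd> A) \<bullet> E (Z \<otimes> V)) \<lhd> U = (E (Z' \<otimes> V') \<bullet> (A \<rhd> s)) \<lhd> U"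
      by (simp only: E_natural[of s "Z \<otimes> V" "Z' \<otimes> V'"] crossingD[OF s])
    then show "(s \<lhd> A \<lhd> U) \<bullet> (E (Z \<otimes> V) \<lhd> U) = (E (Z' \<otimes> V') \<lhd> U) \<bullet> ((A \<rhd> s) \<lhd> U)" by simp
  qed
  have "cross s Z V Z' V' (A \<otimes> U) \<bullet> ((Z \<rhd> braid V U) \<bullet> braid Z (V \<otimes> U))
     = \<alpha> Z' V' (A \<otimes> U) \<bullet> ((s \<lhd> (A \<otimes> U)) \<bullet> (braid (Z \<otimes> V) U \<bullet> (A \<rhd> \<alpha>i Z V U)))"
    by (simp add: braid_hexagon cross_def[of s])
  also have "\<dots> = \<alpha> Z' V' (A \<otimes> U) \<bullet> (\<alpha> (Z' \<otimes> V') A U \<bullet> ((s \<lhd> A \<lhd> U) \<bullet> ((E (Z \<otimes> V) \<lhd> U) \<bullet> (\<alpha>i A (Z \<otimes> V) U \<bullet> (A \<rhd> \<alpha>i Z V U)))))"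
    by (simp add: cross_def strictify)
  also have "\<dots> = \<alpha> Z' V' (A \<otimes> U) \<bullet> (braid (Z' \<otimes> V') U \<bullet> ((A \<rhd> \<alpha>i Z' V' U) \<bullet> (A \<rhd> cross s Z V Z' V' U)))"
    unfolding n by (simp add: cross_def strictify)
  also have "\<dots> = (Z' \<rhd> braid V' U) \<bullet> (braid Z' (V' \<otimes> U) \<bullet> (A \<rhd> cross s Z V Z' V' U))"
    by (subst comp_assoc[symmetric], subst comp_assoc[symmetric]) (simp add: reassoc[OF braid_hexagon])
  finally show ?thesis .
qed

abbreviation "Ad \<equiv> A\<^sup>\<star>"
abbreviation "evc \<equiv> cap (evA A) Ad A"
abbreviation "pvc \<equiv> cap (pev A) A Ad"
abbreviation "coc \<equiv> cup (coA A) A Ad"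

text \<open>The half-braiding of the dual \<open>A\<^sup>\<star>\<close>: the left mate of the inverse half-braiding of \<open>A\<close>.\<close>
definition Edual :: "'o \<Rightarrow> ('o, 'm) arrow" where
  "Edual W = bend (evc W \<bullet> ((Ad \<rhd> Ei W) \<bullet> \<alpha> Ad W A)) (Ad \<otimes> W) A (coA A) Ad"

abbreviation dbraid :: "'o \<Rightarrow> 'o \<Rightarrow> ('o, 'm) arrow" where "dbraid Z U \<equiv> cross (Edual Z) Ad Z Z Ad U"

lemma Edual_typ [simp]: "W \<in> obj C \<Longrightarrow> ok (Edual W)" "W \<in> obj C \<Longrightarrow> src (Edual W) = Ad \<otimes> W" "W \<in> obj C \<Longrightarrow> tgt (Edual W) = W \<otimes> Ad"
  unfolding Edual_def by (simp_all add: bend_typ[OF duality_ev])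

lemma Edual_crossing [simp]: "W \<in> obj C \<Longrightarrow> crossing (Edual W) Ad W W Ad" by (simp add: crossing_def)

lemma dbraid_expand:
  assumes [simp]: "W \<in> obj C" "U \<in> obj C"
  shows "dbraid W U = evc (W \<otimes> (Ad \<otimes> U)) \<bullet> ((Ad \<rhd> unbraid W (Ad \<otimes> U)) \<bullet> (Ad \<rhd> W \<rhd> coc U))"
proof -
  let ?m = "evc W \<bullet> ((Ad \<rhd> Ei W) \<bullet> \<alpha> Ad W A)"
  have "dbraid W U = (\<alpha> W Ad U \<bullet> (bend ?m (Ad \<otimes> W) A (coA A) Ad \<lhd> U)) \<bullet> \<alpha>i Ad W U"
    by (simp add: cross_def Edual_def)
  also have "\<dots> = (?m \<lhd> (Ad \<otimes> U)) \<bullet> (\<alpha>i (Ad \<otimes> W) A (Ad \<otimes> U) \<bullet> (((Ad \<otimes> W) \<rhd> coc U) \<bullet> \<alpha>i Ad W U))"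
    by (subst bend_whisker[OF duality_ev]) simp_all
  also have "\<dots> = evc (W \<otimes> (Ad \<otimes> U)) \<bullet> ((Ad \<rhd> unbraid W (Ad \<otimes> U)) \<bullet> (Ad \<rhd> W \<rhd> coc U))"
    by (simp add: cap_def cross_def strictify)
  finally show ?thesis .
qed

text \<open>The coevaluation hidden in \<open>Edual\<close> cancels against the evaluation on the left by a zigzag.  In other words,
the evaluation \<open>A\<^sup>\<star> \<otimes> A \<rightarrow> \<one>\<close> is a morphism of the center.\<close>
lemma ev_central:
  assumes [simp]: "W \<in> obj C" "U \<in> obj C"
  shows "(W \<rhd> evc U) \<bullet> dbraid W (A \<otimes> U) = evc (W \<otimes> U) \<bullet> (Ad \<rhd> unbraid W U)"
proof -
  have "(W \<rhd> evc U) \<bullet> dbraid W (A \<otimes> U) = evc (W \<otimes> U) \<bullet> ((Ad \<rhd> ((A \<rhd> W \<rhd> evc U) \<bullet> unbraid W (Ad \<otimes> (A \<otimes> U)))) \<bullet> (Ad \<rhd> W \<rhd> coc (A \<otimes> U)))"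
    by (simp add: dbraid_expand reassoc[OF cap_natural[of _ _ _ "W \<rhd> evc U", symmetric]])
  also have "\<dots> = evc (W \<otimes> U) \<bullet> ((Ad \<rhd> unbraid W U) \<bullet> (Ad \<rhd> W \<rhd> ((A \<rhd> evc U) \<bullet> coc (A \<otimes> U))))"
    by (simp add: cross_natural[of _ _ _ _ _ "evc U", symmetric] cross_natural[of _ _ _ _ _ "A \<rhd> evc U", symmetric])
  also have "\<dots> = evc (W \<otimes> U) \<bullet> (Ad \<rhd> unbraid W U)"
    by (simp add: zigzag1[OF duality_ev] del: lwhisk_comp)
  finally show ?thesis .
qed

text \<open>The other zigzag cancels the evaluation hidden in \<open>Edual\<close>, and the two half-braidings that remain are inverse
to each other: the coevaluation \<open>\<one> \<rightarrow> A \<otimes> A\<^sup>\<star>\<close> is a morphism of the center.\<close>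
lemma coev_central:
  assumes [simp]: "W \<in> obj C" "U \<in> obj C"
  shows "braid W (Ad \<otimes> U) \<bullet> ((A \<rhd> dbraid W U) \<bullet> coc (W \<otimes> U)) = W \<rhd> coc U"
proof -
  let ?h = "unbraid W (Ad \<otimes> U) \<bullet> (W \<rhd> coc U)"
  have "(A \<rhd> dbraid W U) \<bullet> coc (W \<otimes> U) = (A \<rhd> evc (W \<otimes> (Ad \<otimes> U))) \<bullet> ((A \<rhd> Ad \<rhd> ?h) \<bullet> coc (W \<otimes> U))"
    by (simp add: dbraid_expand)
  also have "\<dots> = ((A \<rhd> evc (W \<otimes> (Ad \<otimes> U))) \<bullet> coc (A \<otimes> (W \<otimes> (Ad \<otimes> U)))) \<bullet> ?h"
    by (subst cup_natural[OF duality_ev, of A ?h, symmetric]) simp_all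
  also have "\<dots> = ?h"
    by (simp add: zigzag1[OF duality_ev])
  finally show ?thesis by (simp add: reassoc[OF braid_inv(1)])
qed

text \<open>The full left dual of \<open>E Z : A \<otimes> Z \<rightarrow> Z \<otimes> A\<close> is the half-braiding of \<open>A\<^sup>\<star>\<close> with \<open>Z\<^sup>\<star>\<close>: rotating \<open>Z\<close>
turns \<open>E Z\<close> into the inverse of \<open>E (Z\<^sup>\<star>)\<close> by \<open>slide_cap\<close>, and rotating \<open>A\<close> then gives \<open>Edual (Z\<^sup>\<star>)\<close> by
definition.\<close>
lemma Edual_mate:
  assumes [simp]: "Z \<in> obj C"
  shows "nest (evA A) Ad A (evA Z) (Z\<^sup>\<star>) Z \<bullet> (Edual (Z\<^sup>\<star>) \<lhd> (A \<otimes> Z))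
      = nest (evA Z) (Z\<^sup>\<star>) Z (evA A) Ad A \<bullet> ((Ad \<otimes> Z\<^sup>\<star>) \<rhd> E Z)"
proof -
  \<comment> \<open>Pairings are compared with the spectator \<open>\<one>\<close>, which suffices by \<open>cap_inj\<close>.\<close>
  let ?V = "Z\<^sup>\<star>" and ?U = "\<one>"
  let ?zc = "cap (evA Z) ?V Z"
  let ?c = "(Ad \<rhd> ?V \<rhd> \<alpha> A Z ?U) \<bullet> \<alpha> Ad ?V ((A \<otimes> Z) \<otimes> ?U)"
  have n1: "pairing (nest (evA A) Ad A (evA Z) (Z\<^sup>\<star>) Z) (Z\<^sup>\<star> \<otimes> Ad) (A \<otimes> Z)"
    and n2: "pairing (nest (evA Z) (Z\<^sup>\<star>) Z (evA A) Ad A) (Ad \<otimes> Z\<^sup>\<star>) (Z \<otimes> A)"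
    by (auto intro: nest_pairing)
  have s: "(A \<rhd> ?zc ?U) \<bullet> unbraid ?V (Z \<otimes> ?U) = ?zc (A \<otimes> ?U) \<bullet> (?V \<rhd> braid Z ?U)"
    by (subst slide_cap[symmetric]) (simp_all add: braid_inv)
  have a: "\<alpha> ?V Ad ((A \<otimes> Z) \<otimes> ?U) \<bullet> (Edual ?V \<lhd> ((A \<otimes> Z) \<otimes> ?U)) = dbraid ?V ((A \<otimes> Z) \<otimes> ?U) \<bullet> \<alpha> Ad ?V ((A \<otimes> Z) \<otimes> ?U)"
    by (simp add: cross_def)
  have b: "braid Z ?U \<bullet> \<alpha> A Z ?U = \<alpha> Z A ?U \<bullet> (E Z \<lhd> ?U)" by (simp add: cross_def)
  have "cap (nest (evA A) Ad A (evA Z) (Z\<^sup>\<star>) Z \<bullet> (Edual (Z\<^sup>\<star>) \<lhd> (A \<otimes> Z))) (Ad \<otimes> ?V) (A \<otimes> Z) ?U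
    = ?zc ?U \<bullet> ((?V \<rhd> evc (Z \<otimes> ?U)) \<bullet> ((?V \<rhd> Ad \<rhd> \<alpha> A Z ?U) \<bullet> (dbraid ?V ((A \<otimes> Z) \<otimes> ?U) \<bullet> \<alpha> Ad ?V ((A \<otimes> Z) \<otimes> ?U))))"
    by (subst cap_pre1[OF n1]) (simp_all add: cap_nest a)
  also have "\<dots> = ?zc ?U \<bullet> ((?V \<rhd> evc (Z \<otimes> ?U)) \<bullet> (dbraid ?V (A \<otimes> (Z \<otimes> ?U)) \<bullet> ?c))"
    by (simp add: reassoc[OF cross_natural[of "Edual ?V" _ _ _ _ "\<alpha> A Z ?U"]])
  also have "\<dots> = ?zc ?U \<bullet> (evc (?V \<otimes> (Z \<otimes> ?U)) \<bullet> ((Ad \<rhd> unbraid ?V (Z \<otimes> ?U)) \<bullet> ?c))"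
    by (simp add: reassoc[OF ev_central])
  also have "\<dots> = evc ?U \<bullet> ((Ad \<rhd> ((A \<rhd> ?zc ?U) \<bullet> unbraid ?V (Z \<otimes> ?U))) \<bullet> ?c)"
    by (simp add: reassoc[OF cap_natural[of "evA A" _ _ "?zc ?U", symmetric]])
  also have "\<dots> = evc ?U \<bullet> ((Ad \<rhd> ?zc (A \<otimes> ?U)) \<bullet> ((Ad \<rhd> ?V \<rhd> (braid Z ?U \<bullet> \<alpha> A Z ?U)) \<bullet> \<alpha> Ad ?V ((A \<otimes> Z) \<otimes> ?U)))"
    unfolding s by simp
  also have "\<dots> = cap (nest (evA Z) (Z\<^sup>\<star>) Z (evA A) Ad A \<bullet> ((Ad \<otimes> Z\<^sup>\<star>) \<rhd> E Z)) (Ad \<otimes> ?V) (A \<otimes> Z) ?U"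
    unfolding b by (subst cap_pre2[OF n2]) (simp_all add: cap_nest lwhisk_tensor)
  finally show ?thesis
    by (rule cap_inj[rotated 2]) (use n1 n2 in auto)
qed

text \<open>By \<open>left_mate_eq_right_mate\<close>, what \<open>Edual_mate\<close> says for left evaluations holds for the pivotal ones.\<close>
lemma pev_mate:
  assumes [simp]: "Z \<in> obj C" "U \<in> obj C"
  defines "V \<equiv> Z\<^sup>\<star>"
  shows "cap (pev Z) Z V U \<bullet> ((Z \<rhd> pvc (V \<otimes> U)) \<bullet> braid Z (Ad \<otimes> (V \<otimes> U)))
    = pvc U \<bullet> ((A \<rhd> cap (pev Z) Z V (Ad \<otimes> U)) \<bullet> (A \<rhd> Z \<rhd> dbraid V U))"
proof -
  have [simp]: "V \<in> obj C" by (simp add: V_def)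
  have [simp]: "pairing (pev Z) Z V" by (simp add: V_def)
  have n1: "pairing (nest (pev A) A Ad (pev Z) Z V) (Z \<otimes> A) (Ad \<otimes> V)"
    and n2: "pairing (nest (pev Z) Z V (pev A) A Ad) (A \<otimes> Z) (V \<otimes> Ad)"
    by (auto intro: nest_pairing)
  have eq: "nest (pev A) A Ad (pev Z) Z V \<bullet> (E Z \<lhd> (Ad \<otimes> V)) = nest (pev Z) Z V (pev A) A Ad \<bullet> ((A \<otimes> Z) \<rhd> Edual V)"
    unfolding V_def by (rule left_mate_eq_right_mate) (simp_all add: Edual_mate)
  have [simp]: "(Z \<rhd> A \<rhd> \<alpha> Ad V U) \<bullet> ((Z \<rhd> A \<rhd> \<alpha>i Ad V U) \<bullet> x) = x"
    if "ok x" "tgt x = Z \<otimes> (A \<otimes> (Ad \<otimes> (V \<otimes> U)))" for x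
    using that by (intro inv_cancel[OF lwhisk_inv[OF lwhisk_inv[OF \<alpha>_inv(1)]]]) simp_all
  let ?q = "\<alpha>i A Z ((Ad \<otimes> V) \<otimes> U) \<bullet> (A \<rhd> Z \<rhd> \<alpha>i Ad V U)"
  have "cap (pev Z) Z V U \<bullet> ((Z \<rhd> pvc (V \<otimes> U)) \<bullet> braid Z (Ad \<otimes> (V \<otimes> U)))
    = cap (pev Z) Z V U \<bullet> ((Z \<rhd> pvc (V \<otimes> U)) \<bullet> ((Z \<rhd> A \<rhd> \<alpha> Ad V U) \<bullet> (braid Z ((Ad \<otimes> V) \<otimes> U) \<bullet> (A \<rhd> Z \<rhd> \<alpha>i Ad V U))))"
    by (subst cross_natural[of "E Z" A Z Z A "\<alpha>i Ad V U" "Ad \<otimes> (V \<otimes> U)" "(Ad \<otimes> V) \<otimes> U"]) simp_all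
  also have "\<dots> = cap (nest (pev A) A Ad (pev Z) Z V \<bullet> (E Z \<lhd> (Ad \<otimes> V))) (A \<otimes> Z) (Ad \<otimes> V) U \<bullet> ?q"
    by (subst cap_pre1[OF n1]) (simp_all add: cap_nest cross_def)
  also have "\<dots> = cap (nest (pev Z) Z V (pev A) A Ad \<bullet> ((A \<otimes> Z) \<rhd> Edual V)) (A \<otimes> Z) (Ad \<otimes> V) U \<bullet> ?q"
    unfolding eq ..
  also have "\<dots> = pvc U \<bullet> ((A \<rhd> cap (pev Z) Z V (Ad \<otimes> U)) \<bullet> (A \<rhd> Z \<rhd> dbraid V U))"
    by (subst cap_pre2[OF n2]) (simp_all add: cap_nest lwhisk_tensor, simp add: cross_def)
  finally show ?thesis .
qed

text \<open>Pairing with \<open>Z\<close> through the pivotal evaluation is faithful, since \<open>Z\<close> is isomorphic to \<open>Z\<^sup>\<star>\<^sup>\<star>\<close>.\<close>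
lemma pev_faithful:
  assumes [simp]: "Z \<in> obj C" "U \<in> obj C" and u: "ok u" "tgt u = Z\<^sup>\<star> \<otimes> U" "src u = Q"
    and v: "ok v" "tgt v = Z\<^sup>\<star> \<otimes> U" "src v = Q"
    and eq: "cap (pev Z) Z (Z\<^sup>\<star>) U \<bullet> (Z \<rhd> u) = cap (pev Z) Z (Z\<^sup>\<star>) U \<bullet> (Z \<rhd> v)"
  shows "u = v"
proof -
  have [simp]: "Q \<in> obj C" using u by auto
  let ?c = "cap (evA (Z\<^sup>\<star>)) (Z\<^sup>\<star>\<^sup>\<star>) (Z\<^sup>\<star>)"
  have p: "cap (pev Z) Z (Z\<^sup>\<star>) U \<bullet> (Z \<rhd> w) = (?c U \<bullet> (Z\<^sup>\<star>\<^sup>\<star> \<rhd> w)) \<bullet> (pvA Z \<lhd> Q)"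
    if "ok w" "tgt w = Z\<^sup>\<star> \<otimes> U" "src w = Q" for w
    unfolding pev_def using that by (subst cap_pre1) (simp_all add: interchange[of "pvA Z" w])
  have "?c U \<bullet> (Z\<^sup>\<star>\<^sup>\<star> \<rhd> u) = ?c U \<bullet> (Z\<^sup>\<star>\<^sup>\<star> \<rhd> v)"
    using eq unfolding p[OF u(1,2,3)] p[OF v(1,2,3)]
    by (rule iso_cancel_right[of "pvA Z \<lhd> Q" "pviA Z \<lhd> Q" "Z\<^sup>\<star>\<^sup>\<star> \<otimes> Q", rotated -1]) (use u v in \<open>simp_all add: rwhisk_inv\<close>)
  moreover have "w = (Z\<^sup>\<star> \<rhd> (?c U \<bullet> (Z\<^sup>\<star>\<^sup>\<star> \<rhd> w))) \<bullet> cup (coA (Z\<^sup>\<star>)) (Z\<^sup>\<star>) (Z\<^sup>\<star>\<^sup>\<star>) Q"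
    if w: "ok w" "tgt w = Z\<^sup>\<star> \<otimes> U" "src w = Q" for w
  proof -
    have "w = ((Z\<^sup>\<star> \<rhd> ?c U) \<bullet> cup (coA (Z\<^sup>\<star>)) (Z\<^sup>\<star>) (Z\<^sup>\<star>\<^sup>\<star>) (Z\<^sup>\<star> \<otimes> U)) \<bullet> w"
      using w by (subst zigzag1[OF duality_ev]) simp_all
    also have "\<dots> = (Z\<^sup>\<star> \<rhd> ?c U) \<bullet> ((Z\<^sup>\<star> \<rhd> Z\<^sup>\<star>\<^sup>\<star> \<rhd> w) \<bullet> cup (coA (Z\<^sup>\<star>)) (Z\<^sup>\<star>) (Z\<^sup>\<star>\<^sup>\<star>) Q)"
      using w by (simp add: cup_natural[OF duality_ev, of "Z\<^sup>\<star>" w])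
    finally show ?thesis using w by simp
  qed
  ultimately show ?thesis using u v by metis
qed

text \<open>The pivotal evaluation of \<open>A\<close> is a morphism of the center, tested on objects \<open>V = Z\<^sup>\<star>\<close>.  To compare the
two sides, let a further strand \<open>Z\<close> cross \<open>A\<close> and contract it with \<open>V\<close>.  On the side with crossings
the cap of \<open>Z\<close> and \<open>V\<close> is pulled off the strand \<open>A\<close> by \<open>slide_cap\<close>; what is left is the right-hand
side of \<open>pev_mate\<close>.\<close>
lemma pev_central:
  assumes [simp]: "Z \<in> obj C" "U \<in> obj C"
  defines "V \<equiv> Z\<^sup>\<star>"
  shows "(V \<rhd> pvc U) \<bullet> (braid V (Ad \<otimes> U) \<bullet> (A \<rhd> dbraid V U)) = pvc (V \<otimes> U)" (is "?u = ?v")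
proof -
  have [simp]: "V \<in> obj C" by (simp add: V_def)
  have [simp]: "pairing (pev Z) Z V" by (simp add: V_def)
  let ?z = "cap (pev Z) Z V" and ?Q = "Ad \<otimes> (V \<otimes> U)"
  have "(?z U \<bullet> (Z \<rhd> ?u)) \<bullet> braid Z ?Q
     = ?z U \<bullet> ((Z \<rhd> V \<rhd> pvc U) \<bullet> ((Z \<rhd> braid V (Ad \<otimes> U)) \<bullet> ((Z \<rhd> A \<rhd> dbraid V U) \<bullet> braid Z ?Q)))"
    by simp
  also have "\<dots> = pvc U \<bullet> (?z (A \<otimes> (Ad \<otimes> U)) \<bullet> ((Z \<rhd> braid V (Ad \<otimes> U)) \<bullet> (braid Z (V \<otimes> (Ad \<otimes> U)) \<bullet> (A \<rhd> Z \<rhd> dbraid V U))))"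
    by (simp add: cross_natural[of "E Z" _ _ _ _ "dbraid V U", symmetric] reassoc[OF cap_natural[of "pev Z" _ _ "pvc U"]])
  also have "\<dots> = pvc U \<bullet> ((A \<rhd> ?z (Ad \<otimes> U)) \<bullet> (A \<rhd> Z \<rhd> dbraid V U))"
    by (subst slide_cap[symmetric]) simp_all
  also have "\<dots> = (?z U \<bullet> (Z \<rhd> ?v)) \<bullet> braid Z ?Q"
    using pev_mate[OF assms(1,2)] by (simp add: V_def)
  finally have "?z U \<bullet> (Z \<rhd> ?u) = ?z U \<bullet> (Z \<rhd> ?v)"
    by (rule iso_cancel_right[OF braid_inv(1), rotated -1]) simp_all
  then show ?thesis
    unfolding V_def by (rule pev_faithful[rotated -1]) simp_all
qed

text \<open>Built with the inverse associators and unitors of \<open>C\<close>; \<open>center_twist_mor\<close> shows that those of the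
center are the same, so that this is the twist of \<open>(A, e)\<close>.\<close>
definition twist_arrow :: "('o, 'm) arrow" where
  "twist_arrow = ru A \<bullet> ((A \<rhd> pev A) \<bullet> (\<alpha> A A Ad \<bullet> bend (E A) A A (coA A) Ad))"

lemma twist_arrow_typ [simp]: "ok twist_arrow" "src twist_arrow = A" "tgt twist_arrow = A"
  unfolding twist_arrow_def by (simp_all add: bend_typ[OF duality_ev])

lemma twist_arrow_mor: "mor twist_arrow = run C A \<cdot> (\<i> A \<odot> piv_ev C A) \<cdot> asc C A A (A\<^sup>\<star>) \<cdot> (e A \<odot> \<i> (A\<^sup>\<star>))
    \<cdot> asc_inv C A A (A\<^sup>\<star>) \<cdot> (\<i> A \<odot> coev C A) \<cdot> run_inv C A"
  unfolding twist_arrow_def bend_def by (simp add: mor_simps)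

lemma twist_arrow_whisker:
  assumes [simp]: "W \<in> obj C"
  shows "twist_arrow \<lhd> W = (A \<rhd> pvc W) \<bullet> (braid A (Ad \<otimes> W) \<bullet> (A \<rhd> coc W))"
proof -
  let ?b = "bend (E A) A A (coA A) Ad"
  have [simp]: "ok ?b" "src ?b = A" "tgt ?b = (A \<otimes> A) \<otimes> Ad" by (simp_all add: bend_typ[OF duality_ev])
  have "twist_arrow \<lhd> W = (A \<rhd> pvc W) \<bullet> (\<alpha> A A (Ad \<otimes> W) \<bullet> (\<alpha> (A \<otimes> A) Ad W \<bullet> (?b \<lhd> W)))"
    unfolding twist_arrow_def by (simp add: strictify cap_def)
  also have "\<dots> = (A \<rhd> pvc W) \<bullet> (braid A (Ad \<otimes> W) \<bullet> (A \<rhd> coc W))"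
    by (subst bend_whisker[OF duality_ev]) (simp_all add: cross_def)
  finally show ?thesis .
qed

text \<open>A strand \<open>V\<close> passes from above the loop of \<open>A\<close> to below it: through the pivotal evaluation by
\<open>pev_central\<close>, through the crossing of \<open>A\<close> with itself by the Yang-Baxter relation \<open>yb\<close>, and through
the coevaluation by \<open>coev_central\<close>.\<close>
lemma twist_arrow_central_dual:
  assumes [simp]: "Z \<in> obj C"
  shows "(Z\<^sup>\<star> \<rhd> twist_arrow) \<bullet> E (Z\<^sup>\<star>) = E (Z\<^sup>\<star>) \<bullet> (twist_arrow \<lhd> Z\<^sup>\<star>)"
proof -
  define V where "V = Z\<^sup>\<star>"
  have [simp]: "V \<in> obj C" by (simp add: V_def)
  let ?U = "\<one>"
  have yb: "braid V (A \<otimes> (Ad \<otimes> ?U)) \<bullet> ((A \<rhd> braid V (Ad \<otimes> ?U)) \<bullet> braid A (V \<otimes> (Ad \<otimes> ?U)))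
    = (V \<rhd> braid A (Ad \<otimes> ?U)) \<bullet> (braid V (A \<otimes> (Ad \<otimes> ?U)) \<bullet> (A \<rhd> braid V (Ad \<otimes> ?U)))"
    by (rule slide_cross) simp_all
  have "braid V ?U \<bullet> (twist_arrow \<lhd> (V \<otimes> ?U)) = braid V ?U \<bullet> ((A \<rhd> pvc (V \<otimes> ?U)) \<bullet> (braid A (Ad \<otimes> (V \<otimes> ?U)) \<bullet> (A \<rhd> coc (V \<otimes> ?U))))"
    by (simp add: twist_arrow_whisker)
  also have "\<dots> = braid V ?U \<bullet> ((A \<rhd> V \<rhd> pvc ?U) \<bullet> ((A \<rhd> braid V (Ad \<otimes> ?U)) \<bullet> ((A \<rhd> A \<rhd> dbraid V ?U) \<bullet> (braid A (Ad \<otimes> (V \<otimes> ?U)) \<bullet> (A \<rhd> coc (V \<otimes> ?U))))))"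
    unfolding V_def by (subst pev_central[symmetric]) simp_all
  also have "\<dots> = (V \<rhd> A \<rhd> pvc ?U) \<bullet> (braid V (A \<otimes> (Ad \<otimes> ?U)) \<bullet> ((A \<rhd> braid V (Ad \<otimes> ?U)) \<bullet> (braid A (V \<otimes> (Ad \<otimes> ?U)) \<bullet> ((A \<rhd> A \<rhd> dbraid V ?U) \<bullet> (A \<rhd> coc (V \<otimes> ?U))))))"
    by (simp add: reassoc[OF cross_natural[of "E A" _ _ _ _ "dbraid V ?U", symmetric]] reassoc[OF cross_natural[of "E V" _ _ _ _ "pvc ?U"]])
  also have "\<dots> = (V \<rhd> A \<rhd> pvc ?U) \<bullet> ((V \<rhd> braid A (Ad \<otimes> ?U)) \<bullet> (braid V (A \<otimes> (Ad \<otimes> ?U)) \<bullet> (A \<rhd> (braid V (Ad \<otimes> ?U) \<bullet> ((A \<rhd> dbraid V ?U) \<bullet> coc (V \<otimes> ?U))))))"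
    using reassoc[OF yb] by simp
  also have "\<dots> = (V \<rhd> A \<rhd> pvc ?U) \<bullet> ((V \<rhd> braid A (Ad \<otimes> ?U)) \<bullet> (braid V (A \<otimes> (Ad \<otimes> ?U)) \<bullet> (A \<rhd> V \<rhd> coc ?U)))"
    by (subst coev_central) simp_all
  also have "\<dots> = (V \<rhd> (twist_arrow \<lhd> ?U)) \<bullet> braid V ?U"
    by (simp add: twist_arrow_whisker cross_natural[of "E V" _ _ _ _ "coc ?U"])
  finally have c: "\<alpha>i V A ?U \<bullet> (braid V ?U \<bullet> (twist_arrow \<lhd> (V \<otimes> ?U))) = \<alpha>i V A ?U \<bullet> ((V \<rhd> (twist_arrow \<lhd> ?U)) \<bullet> braid V ?U)" by simp
  have "((V \<rhd> twist_arrow) \<bullet> E V) \<lhd> ?U = (E V \<bullet> (twist_arrow \<lhd> V)) \<lhd> ?U"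
    using reassoc[OF c, where x = "\<alpha> A V ?U"] by (simp add: cross_def strictify)
  then show ?thesis unfolding V_def by - (rule rwhisk_unit_faithful, auto)
qed

text \<open>Every object is isomorphic to its double dual, so that \<open>twist_arrow_central_dual\<close> applies up to isomorphism.\<close>
lemma twist_arrow_central:
  assumes [simp]: "Z \<in> obj C"
  shows "(Z \<rhd> twist_arrow) \<bullet> E Z = E Z \<bullet> (twist_arrow \<lhd> Z)"
proof -
  let ?V = "Z\<^sup>\<star>\<^sup>\<star>" and ?j = "pvA Z"
  have "(?j \<lhd> A) \<bullet> ((Z \<rhd> twist_arrow) \<bullet> E Z) = (?V \<rhd> twist_arrow) \<bullet> ((?j \<lhd> A) \<bullet> E Z)"
    using reassoc[OF interchange[of ?j twist_arrow], where x = "E Z"] by simp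
  also have "\<dots> = E ?V \<bullet> ((twist_arrow \<lhd> ?V) \<bullet> (A \<rhd> ?j))"
    by (simp add: E_natural[of ?j] reassoc[OF twist_arrow_central_dual])
  also have "\<dots> = (?j \<lhd> A) \<bullet> (E Z \<bullet> (twist_arrow \<lhd> Z))"
    by (simp add: interchange[of twist_arrow ?j] reassoc[OF E_natural[of ?j]])
  finally show ?thesis
    by (rule iso_cancel_left[of "pviA Z \<lhd> A" "?j \<lhd> A" "Z \<otimes> A", rotated -1]) (simp_all add: rwhisk_inv)
qed

end

section \<open>Regularity and Schur's lemma in a semisimple category\<close>

context linear_category
begin

interpretation vs: vector_space "scl C" by (rule vector_space_scl)

lemma hom_0 [simp]: "\<lbrakk>X \<in> obj C; Y \<in> obj C\<rbrakk> \<Longrightarrow> 0 \<in> hom C X Y"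
  using hom_subspace vs.subspace_0 by blast
lemma hom_add: "\<lbrakk>X \<in> obj C; Y \<in> obj C; f \<in> hom C X Y; g \<in> hom C X Y\<rbrakk> \<Longrightarrow> f + g \<in> hom C X Y"
  using hom_subspace vs.subspace_add by blast
lemma hom_diff: "\<lbrakk>X \<in> obj C; Y \<in> obj C; f \<in> hom C X Y; g \<in> hom C X Y\<rbrakk> \<Longrightarrow> f - g \<in> hom C X Y"
  using hom_subspace vs.subspace_diff by blast
lemma hom_scl: "\<lbrakk>X \<in> obj C; Y \<in> obj C; f \<in> hom C X Y\<rbrakk> \<Longrightarrow> scl C a f \<in> hom C X Y"
  using hom_subspace vs.subspace_scale by blast
lemma hom_sum: "\<lbrakk>X \<in> obj C; Y \<in> obj C; \<And>k. k \<in> S \<Longrightarrow> h k \<in> hom C X Y\<rbrakk> \<Longrightarrow> (\<Sum>k\<in>S. h k) \<in> hom C X Y"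
  using hom_subspace vs.subspace_sum by blast

lemma cmp_0_right: "\<lbrakk>X \<in> obj C; Y \<in> obj C; Z \<in> obj C; g \<in> hom C Y Z\<rbrakk> \<Longrightarrow> g \<cdot> 0 = 0"
  using cmp_add_right[of X Y Z 0 0 g] by simp
lemma cmp_0_left: "\<lbrakk>X \<in> obj C; Y \<in> obj C; Z \<in> obj C; f \<in> hom C X Y\<rbrakk> \<Longrightarrow> 0 \<cdot> f = 0"
  using cmp_add_left[of X Y Z f 0 0] by simp
lemma cmp_diff_right: "\<lbrakk>X \<in> obj C; Y \<in> obj C; Z \<in> obj C; f \<in> hom C X Y; f' \<in> hom C X Y; g \<in> hom C Y Z\<rbrakk>
    \<Longrightarrow> g \<cdot> (f - f') = (g \<cdot> f) - (g \<cdot> f')"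
  using cmp_add_right[of X Y Z "f - f'" f' g] by (simp add: hom_diff eq_diff_eq)
lemma cmp_diff_left: "\<lbrakk>X \<in> obj C; Y \<in> obj C; Z \<in> obj C; f \<in> hom C X Y; g \<in> hom C Y Z; g' \<in> hom C Y Z\<rbrakk>
    \<Longrightarrow> (g - g') \<cdot> f = (g \<cdot> f) - (g' \<cdot> f)"
  using cmp_add_left[of X Y Z f "g - g'" g'] by (simp add: hom_diff eq_diff_eq)

lemma cmp_sum_right:
  assumes "X \<in> obj C" "Y \<in> obj C" "Z \<in> obj C" "g \<in> hom C Y Z"
  shows "(\<And>k. k < n \<Longrightarrow> h k \<in> hom C X Y) \<Longrightarrow> g \<cdot> (\<Sum>k<n. h k) = (\<Sum>k<(n::nat). g \<cdot> h k)"
proof (induction n)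
  case 0 then show ?case using assms by (simp add: cmp_0_right[of X Y Z])
next
  case (Suc n)
  then have "(\<Sum>k<n. h k) \<in> hom C X Y" using assms by (intro hom_sum) auto
  with Suc assms show ?case by (simp add: cmp_add_right[of X Y Z])
qed

lemma cmp_sum_left:
  assumes "X \<in> obj C" "Y \<in> obj C" "Z \<in> obj C" "f \<in> hom C X Y"
  shows "(\<And>k. k < n \<Longrightarrow> h k \<in> hom C Y Z) \<Longrightarrow> (\<Sum>k<n. h k) \<cdot> f = (\<Sum>k<(n::nat). h k \<cdot> f)"
proof (induction n)
  case 0 then show ?case using assms by (simp add: cmp_0_left[of X Y Z])
next
  case (Suc n)
  then have "(\<Sum>k<n. h k) \<in> hom C Y Z" using assms by (intro hom_sum) auto
  with Suc assms show ?case by (simp add: cmp_add_left[of X Y Z])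
qed

lemma kernel_mono:
  assumes "X \<in> obj C" "Y \<in> obj C" "f \<in> hom C X Y" "is_kernel C K k X Y f"
  shows "is_mono C K X k"
  unfolding is_mono_def
proof (intro conjI ballI impI)
  show "k \<in> hom C K X" using assms by (simp add: is_kernel_def)
  fix W g h assume W: "W \<in> obj C" "g \<in> hom C W K" "h \<in> hom C W K" "k \<cdot> g = k \<cdot> h"
  have K: "K \<in> obj C" "k \<in> hom C K X" "f \<cdot> k = 0" using assms by (auto simp: is_kernel_def)
  have "f \<cdot> (k \<cdot> g) = 0"
    using cmp_assoc[of W K X Y g k f] cmp_0_left[of W K Y g] W K assms by auto
  moreover have "k \<cdot> g \<in> hom C W X" using cmp_in_hom W K assms by blast
  ultimately have "\<exists>!u. u \<in> hom C W K \<and> k \<cdot> u = k \<cdot> g"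
    using assms(4) W(1) unfolding is_kernel_def by blast
  with W show "g = h" by metis
qed

lemma is_zero_if_id_zero:
  assumes "X \<in> obj C" "\<i> X = 0" shows "Defs.is_zero C X"
  unfolding Defs.is_zero_def
proof (intro conjI ballI)
  fix Y assume Y: "Y \<in> obj C"
  have "f = 0" if "f \<in> hom C X Y" for f
    using that assms Y cmp_idm_right[of X Y f] cmp_0_right[of X X Y f] by simp
  then show "hom C X Y = {0}" using assms Y by auto
  have "f = 0" if "f \<in> hom C Y X" for f
    using that assms Y cmp_idm_left[of Y X f] cmp_0_left[of Y X X f] by simp
  then show "hom C Y X = {0}" using assms Y by auto
qed (use assms in auto)

lemma simple_id_nonzero: "simple C X \<Longrightarrow> \<i> X \<noteq> 0"
  using is_zero_if_id_zero unfolding simple_def by blast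

end

context monoidal_linear_category
begin

lemma tmor_diff_left: "\<lbrakk>X \<in> obj C; Y \<in> obj C; X' \<in> obj C; Y' \<in> obj C; f \<in> hom C X Y; g \<in> hom C X Y; h \<in> hom C X' Y'\<rbrakk>
    \<Longrightarrow> (f - g) \<odot> h = (f \<odot> h) - (g \<odot> h)"
  using tmor_add_left[of X Y X' Y' "f - g" g h] by (simp add: hom_diff eq_diff_eq)
lemma tmor_diff_right: "\<lbrakk>X \<in> obj C; Y \<in> obj C; X' \<in> obj C; Y' \<in> obj C; h \<in> hom C X Y; f \<in> hom C X' Y'; g \<in> hom C X' Y'\<rbrakk>
    \<Longrightarrow> h \<odot> (f - g) = (h \<odot> f) - (h \<odot> g)"
  using tmor_add_right[of X Y X' Y' h "f - g" g] by (simp add: hom_diff eq_diff_eq)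

end

context fusion_category
begin

interpretation vs: vector_space "scl C" by (rule vector_space_scl)

lemma schur_iso:
  assumes S: "simple C S" and T: "simple C T" and f: "f \<in> hom C S T" "f \<noteq> 0"
  shows "is_iso C S T f"
proof -
  have o: "S \<in> obj C" "T \<in> obj C" "\<not> Defs.is_zero C S" using S T by (auto simp: simple_def)
  obtain K k where k: "is_kernel C K k S T f"
    using abelian o f unfolding abelian_def by blast
  have K: "K \<in> obj C" "k \<in> hom C K S" "f \<cdot> k = 0" using k by (auto simp: is_kernel_def)
  have "is_mono C K S k" using kernel_mono o f k by blast
  then consider "Defs.is_zero C K" | "is_iso C K S k" using S K unfolding simple_def by blast
  then have Kz: "Defs.is_zero C K"
  proof cases
    case 2
    then obtain k' where k': "k' \<in> hom C S K" "k \<cdot> k' = \<i> S" unfolding is_iso_def inverses_def by blast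
    have "f = f \<cdot> (k \<cdot> k')" using k' f o cmp_idm_right by simp
    also have "\<dots> = 0" using cmp_assoc[of S K S T k' k f] cmp_0_left[of S K T k'] k' K o f by simp
    finally show ?thesis using f by simp
  qed
  have "is_mono C S T f"
    unfolding is_mono_def
  proof (intro conjI ballI impI)
    fix W g h assume W: "W \<in> obj C" "g \<in> hom C W S" "h \<in> hom C W S" "f \<cdot> g = f \<cdot> h"
    have "f \<cdot> (g - h) = 0" "g - h \<in> hom C W S"
      using W o f by (auto simp: cmp_diff_right[of W S T] hom_diff)
    then obtain u where u: "u \<in> hom C W K" "k \<cdot> u = g - h"
      using k W(1) unfolding is_kernel_def by blast
    have "u = 0" using Kz u W(1) unfolding Defs.is_zero_def by auto
    then show "g = h" using u cmp_0_right[of W K S k] W K o by auto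
  qed (use f in auto)
  then show ?thesis using T o unfolding simple_def by blast
qed

text \<open>McCoy's reduction as Gaussian elimination.  If \<open>f - f c f\<close> is regular then so is \<open>f\<close>, with the quasi-inverse
\<open>(1 - c f) g' (1 - f c) + c\<close>.  Given direct sum decompositions, a nonzero matrix entry of
\<open>f\<close> is invertible by Schur's lemma; for \<open>c\<close> built from its inverse, the column of that entry vanishes
in \<open>f - f c f\<close> and columns that were zero remain zero.\<close>
lemma regular_of_decompositions:
  fixes n m :: nat
  assumes X: "X \<in> obj C" and Y: "Y \<in> obj C"
    and A: "\<And>k. k < n \<Longrightarrow> simple C (A k)" and B: "\<And>k. k < m \<Longrightarrow> simple C (B k)"
    and i: "\<And>k. k < n \<Longrightarrow> i k \<in> hom C (A k) X" and p: "\<And>k. k < n \<Longrightarrow> p k \<in> hom C X (A k)"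
    and j: "\<And>k. k < m \<Longrightarrow> j k \<in> hom C (B k) Y" and q: "\<And>k. k < m \<Longrightarrow> q k \<in> hom C Y (B k)"
    and ip: "(\<Sum>k<n. i k \<cdot> p k) = \<i> X" and jq: "(\<Sum>k<m. j k \<cdot> q k) = \<i> Y"
  shows "f \<in> hom C X Y \<Longrightarrow> \<exists>g\<in>hom C Y X. f \<cdot> (g \<cdot> f) = f"
proof (induction "card {k. k < n \<and> f \<cdot> i k \<noteq> 0}" arbitrary: f rule: less_induct)
  case less
  note f = less.prems
  have Ao: "\<And>k. k < n \<Longrightarrow> A k \<in> obj C" and Bo: "\<And>k. k < m \<Longrightarrow> B k \<in> obj C"
    using A B by (auto simp: simple_def)
  show ?case
  proof (cases "\<exists>k<n. f \<cdot> i k \<noteq> 0")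
    case False
    have "f = f \<cdot> (\<Sum>k<n. i k \<cdot> p k)" using f X Y ip cmp_idm_right by simp
    also have "\<dots> = (\<Sum>k<n. f \<cdot> (i k \<cdot> p k))"
      by (rule cmp_sum_right[OF X X Y f]) (use cmp_in_hom Ao i p X in blast)
    also have "\<dots> = 0"
    proof (rule sum.neutral, safe)
      fix k assume k: "k < n"
      then have "f \<cdot> (i k \<cdot> p k) = (f \<cdot> i k) \<cdot> p k"
        using cmp_assoc[of X "A k" X Y "p k" "i k" f] i p f X Y Ao by simp
      with False k show "f \<cdot> (i k \<cdot> p k) = 0" using cmp_0_left[of X "A k" Y "p k"] p X Y Ao by simp
    qed
    finally have "f \<cdot> (0 \<cdot> f) = f" using cmp_0_left[of X Y X f] cmp_0_right[of X X Y f] f X Y by simp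
    then show ?thesis using X Y by (intro bexI[of _ 0]) auto
  next
    case True
    then obtain k where k: "k < n" "f \<cdot> i k \<noteq> 0" by blast
    define fi where "fi = f \<cdot> i k"
    have fi: "fi \<in> hom C (A k) Y" "fi \<noteq> 0" using k cmp_in_hom i f X Y Ao unfolding fi_def by blast+
    have "\<exists>l<m. q l \<cdot> fi \<noteq> 0"
    proof (rule ccontr)
      assume neg: "\<not> (\<exists>l<m. q l \<cdot> fi \<noteq> 0)"
      have "fi = (\<Sum>l<m. j l \<cdot> q l) \<cdot> fi" using fi jq cmp_idm_left[of "A k" Y fi] Ao k Y by simp
      also have "\<dots> = (\<Sum>l<m. (j l \<cdot> q l) \<cdot> fi)"
        by (rule cmp_sum_left[of "A k" Y Y]) (use cmp_in_hom Ao Bo k j q Y fi in blast)+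
      also have "\<dots> = 0"
      proof (rule sum.neutral, safe)
        fix l assume l: "l < m"
        then have "(j l \<cdot> q l) \<cdot> fi = j l \<cdot> (q l \<cdot> fi)"
          using cmp_assoc[of "A k" Y "B l" Y fi "q l" "j l"] j q fi k Y Ao Bo by simp
        with neg l show "(j l \<cdot> q l) \<cdot> fi = 0" using cmp_0_right[of "A k" "B l" Y "j l"] j k Y Ao Bo by simp
      qed
      finally show False using fi by simp
    qed
    then obtain l where l: "l < m" "q l \<cdot> fi \<noteq> 0" by blast
    have ql: "q l \<cdot> fi \<in> hom C (A k) (B l)" using cmp_in_hom[of "A k" Y "B l" fi "q l"] fi q l k Ao Bo Y by simp
    then have "is_iso C (A k) (B l) (q l \<cdot> fi)" using schur_iso A B k l by blast
    then obtain d where d: "d \<in> hom C (B l) (A k)" "d \<cdot> (q l \<cdot> fi) = \<i> (A k)"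
      unfolding is_iso_def inverses_def by blast
    \<comment> \<open>The inverse \<open>d\<close> of the entry, extended by zero to a map \<open>Y \<rightarrow> X\<close>.\<close>
    define c where "c = i k \<cdot> (d \<cdot> q l)"
    have dq: "d \<cdot> q l \<in> hom C Y (A k)" using cmp_in_hom[of Y "B l" "A k" "q l" d] d q l k Ao Bo Y by simp
    then have c: "c \<in> hom C Y X" unfolding c_def using cmp_in_hom[of Y "A k" X] i k Ao X Y by simp
    have fc: "f \<cdot> c \<in> hom C Y Y" "c \<cdot> f \<in> hom C X X" using cmp_in_hom c f X Y by blast+
    define f' where "f' = f - f \<cdot> (c \<cdot> f)"
    have fcf: "f \<cdot> (c \<cdot> f) \<in> hom C X Y" using cmp_in_hom fc f X Y by blast
    then have f': "f' \<in> hom C X Y" unfolding f'_def using hom_diff f X Y by blast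
    have f'i: "f' \<cdot> i h = (f \<cdot> i h) - (f \<cdot> (c \<cdot> (f \<cdot> i h)))" if h: "h < n" for h
    proof -
      have "f' \<cdot> i h = (f \<cdot> i h) - ((f \<cdot> (c \<cdot> f)) \<cdot> i h)"
        unfolding f'_def by (rule cmp_diff_left[of "A h" X Y]) (use h Ao X Y i f fcf in auto)
      also have "(f \<cdot> (c \<cdot> f)) \<cdot> i h = f \<cdot> ((c \<cdot> f) \<cdot> i h)"
        using cmp_assoc[of "A h" X X Y "i h" "c \<cdot> f" f] h Ao X Y i f fc by simp
      also have "(c \<cdot> f) \<cdot> i h = c \<cdot> (f \<cdot> i h)"
        using cmp_assoc[of "A h" X Y X "i h" f c] h Ao X Y i f c by simp
      finally show ?thesis .
    qed
    have "c \<cdot> fi = i k \<cdot> ((d \<cdot> q l) \<cdot> fi)"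
      unfolding c_def using cmp_assoc[of "A k" Y "A k" X fi "d \<cdot> q l" "i k"] k Ao X Y i fi dq by simp
    also have "(d \<cdot> q l) \<cdot> fi = \<i> (A k)"
      using cmp_assoc[of "A k" Y "B l" "A k" fi "q l" d] k l Ao Bo Y fi d q by simp
    also have "i k \<cdot> \<i> (A k) = i k" using cmp_idm_right i k Ao X by blast
    finally have "f' \<cdot> i k = 0" using f'i[OF k(1)] by (simp add: fi_def)
    moreover have "f' \<cdot> i h = 0" if "h < n" "f \<cdot> i h = 0" for h
      using that f'i[of h] cmp_0_right[of "A h" Y X c] cmp_0_right[of "A h" X Y f] Ao X Y c f by simp
    ultimately have "{h. h < n \<and> f' \<cdot> i h \<noteq> 0} \<subset> {h. h < n \<and> f \<cdot> i h \<noteq> 0}" using k by auto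
    then have "card {h. h < n \<and> f' \<cdot> i h \<noteq> 0} < card {h. h < n \<and> f \<cdot> i h \<noteq> 0}"
      by (intro psubset_card_mono) auto
    from less.hyps[OF this f'] obtain g' where g': "g' \<in> hom C Y X" "f' \<cdot> (g' \<cdot> f') = f'" by blast
    define a where "a = \<i> X - c \<cdot> f"
    define b where "b = \<i> Y - f \<cdot> c"
    have ab: "a \<in> hom C X X" "b \<in> hom C Y Y" unfolding a_def b_def using hom_diff fc idm_in_hom X Y by blast+
    have fa: "f \<cdot> a = f'" unfolding a_def f'_def
      using cmp_diff_right[of X X Y "\<i> X" "c \<cdot> f" f] fc idm_in_hom cmp_idm_right f X Y by simp
    have bf: "b \<cdot> f = f'" unfolding b_def f'_def
      using cmp_diff_left[of X Y Y f "\<i> Y" "f \<cdot> c"] cmp_assoc[of X Y X Y f c f] fc c idm_in_hom cmp_idm_left f X Y by simp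
    have gb: "g' \<cdot> b \<in> hom C Y X" using cmp_in_hom[of Y Y X] g' ab X Y by blast
    then have agb: "a \<cdot> (g' \<cdot> b) \<in> hom C Y X" using cmp_in_hom[of Y X X] ab X Y by blast
    have gf: "g' \<cdot> f' \<in> hom C X X" using cmp_in_hom[of X Y X] g' f' X Y by blast
    have "(a \<cdot> (g' \<cdot> b)) \<cdot> f = a \<cdot> (g' \<cdot> (b \<cdot> f))"
      using cmp_assoc[of X Y X X f "g' \<cdot> b" a] cmp_assoc[of X Y Y X f b g'] gb g' ab f X Y by simp
    then have 1: "(a \<cdot> (g' \<cdot> b) + c) \<cdot> f = a \<cdot> (g' \<cdot> f') + c \<cdot> f"
      using cmp_add_left[of X Y X f "a \<cdot> (g' \<cdot> b)" c] agb c f X Y by (simp add: bf)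
    have "f \<cdot> (a \<cdot> (g' \<cdot> f') + c \<cdot> f) = f \<cdot> (a \<cdot> (g' \<cdot> f')) + f \<cdot> (c \<cdot> f)"
      by (rule cmp_add_right[of X X Y]) (use X Y f fc ab gf cmp_in_hom in blast)+
    also have "f \<cdot> (a \<cdot> (g' \<cdot> f')) = f' \<cdot> (g' \<cdot> f')"
      using cmp_assoc[of X X X Y "g' \<cdot> f'" a f] gf ab f X Y by (simp add: fa)
    also have "\<dots> + f \<cdot> (c \<cdot> f) = f" using g' by (simp add: f'_def)
    finally show ?thesis unfolding 1[symmetric]
      using hom_add[OF Y X agb c] by blast
  qed
qed

lemma regular:
  assumes "X \<in> obj C" "Y \<in> obj C" "f \<in> hom C X Y"
  shows "\<exists>g\<in>hom C Y X. f \<cdot> (g \<cdot> f) = f"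
proof -
  obtain n A where A: "\<forall>k<n. simple C (A k)" "is_finite_direct_sum C X n A"
    using semisimple assms(1) unfolding semisimple_def by blast
  obtain m B where B: "\<forall>k<m. simple C (B k)" "is_finite_direct_sum C Y m B"
    using semisimple assms(2) unfolding semisimple_def by blast
  show ?thesis
    using A B assms unfolding is_finite_direct_sum_def
    by (elim conjE exE) (rule regular_of_decompositions, auto)
qed

text \<open>The composition pairing of \<open>Hom (Y, X)\<close> with \<open>Hom (X, Y)\<close> is nondegenerate: if \<open>f g f = f\<close>
then \<open>g f = 0\<close> forces \<open>f = 0\<close>.\<close>
lemma zero_if_composites_zero:
  assumes "X \<in> obj C" "Y \<in> obj C" "f \<in> hom C X Y" "\<And>p. p \<in> hom C Y X \<Longrightarrow> p \<cdot> f = 0"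
  shows "f = 0"
  using regular[OF assms(1-3)] assms cmp_0_right[of X X Y f] by auto

context
  fixes A t assumes A: "A \<in> obj C" and t: "t \<in> hom C A A"
begin

definition iter :: "nat \<Rightarrow> 'm" where "iter k = ((\<cdot>) t ^^ k) (\<i> A)"

text \<open>The value of a polynomial at the endomorphism \<open>t\<close>; the ring of endomorphisms is no type, so that
\<open>poly\<close> is not applicable.\<close>
definition ev_poly :: "complex poly \<Rightarrow> 'm" where
  "ev_poly p = (\<Sum>k<Suc (degree p). scl C (coeff p k) (iter k))"

lemma iter_hom: "iter k \<in> hom C A A"
  by (induction k) (use A t idm_in_hom cmp_in_hom in \<open>auto simp: iter_def\<close>)

lemma iter_Suc: "iter (Suc k) = t \<cdot> iter k" by (simp add: iter_def)

lemma ev_poly_bound: "degree p < n \<Longrightarrow> ev_poly p = (\<Sum>k<n. scl C (coeff p k) (iter k))"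
  unfolding ev_poly_def by (rule sum.mono_neutral_left) (auto simp: coeff_eq_0)

lemma ev_poly_hom: "ev_poly p \<in> hom C A A"
  unfolding ev_poly_def using A iter_hom by (intro hom_sum hom_scl) auto

lemma ev_poly_linear_factor:
  "ev_poly ([:-z, 1:] * q) = t \<cdot> ev_poly q - scl C z (ev_poly q)"
proof -
  define n where "n = Suc (max (degree q) (degree ([:-z, 1:] * q)))"
  have n: "degree q < n" "degree ([:-z, 1:] * q) < Suc n" "degree q < Suc n" by (auto simp: n_def)
  have c: "coeff ([:-z, 1:] * q) k = coeff (pCons 0 q) k - z * coeff q k" for k
    by (simp add: algebra_simps)
  have "ev_poly ([:-z, 1:] * q) = (\<Sum>k<Suc n. scl C (coeff (pCons 0 q) k) (iter k) - scl C z (scl C (coeff q k) (iter k)))"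
    unfolding ev_poly_bound[OF n(2)] c by (simp add: vs.scale_left_diff_distrib)
  also have "\<dots> = (\<Sum>k<Suc n. scl C (coeff (pCons 0 q) k) (iter k)) - scl C z (ev_poly q)"
    unfolding ev_poly_bound[OF n(3)] by (simp add: sum_subtractf vs.scale_sum_right vs.scale_right_distrib)
  also have "(\<Sum>k<Suc n. scl C (coeff (pCons 0 q) k) (iter k)) = (\<Sum>k<n. scl C (coeff q k) (iter (Suc k)))"
    by (subst sum.lessThan_Suc_shift) simp
  also have "\<dots> = (\<Sum>k<n. t \<cdot> scl C (coeff q k) (iter k))"
    using A t iter_hom by (intro sum.cong refl) (simp add: iter_Suc cmp_scl_right[of A A A])
  also have "\<dots> = t \<cdot> ev_poly q"
    unfolding ev_poly_bound[OF n(1)] using A t iter_hom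
    by (intro cmp_sum_right[symmetric, of A A A]) (auto intro: hom_scl)
  finally show ?thesis .
qed

lemma annihilating_poly: "\<exists>p. p \<noteq> 0 \<and> ev_poly p = 0"
proof -
  obtain B where B: "finite B" "vs.span B = hom C A A" using hom_finite_dim[OF A A] by blast
  let ?m = "card B"
  have "\<exists>a k0. k0 < Suc ?m \<and> a k0 \<noteq> 0 \<and> (\<Sum>k<Suc ?m. scl C (a k) (iter k)) = 0"
  proof (cases "inj_on iter {..<Suc ?m}")
    case True
    let ?S = "iter ` {..<Suc ?m}"
    have "\<not> vs.independent ?S"
    proof
      assume "vs.independent ?S"
      then have "card ?S \<le> card B" using vs.independent_span_bound[of B ?S] B iter_hom by auto
      then show False using True by (simp add: card_image)
    qed
    then obtain u where u: "\<exists>v\<in>?S. u v \<noteq> 0" "(\<Sum>v\<in>?S. scl C (u v) v) = 0"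
      using vs.dependent_finite[of ?S] by auto
    have "(\<Sum>k<Suc ?m. scl C (u (iter k)) (iter k)) = 0"
      using u(2) by (subst (asm) sum.reindex[OF True]) (simp add: o_def)
    with u(1) show ?thesis by (intro exI[of _ "\<lambda>k. u (iter k)"]) auto
  next
    case False
    then obtain i j where ij: "i < Suc ?m" "j < Suc ?m" "i \<noteq> j" "iter i = iter j" by (auto simp: inj_on_def)
    let ?a = "\<lambda>k. if k = i then 1 else if k = j then -1 else (0::complex)"
    have "(\<Sum>k<Suc ?m. scl C (?a k) (iter k)) = (\<Sum>k\<in>{i, j}. scl C (?a k) (iter k))"
      by (rule sum.mono_neutral_right) (use ij in auto)
    also have "\<dots> = 0" using ij by simp
    finally show ?thesis using ij by (intro exI[of _ ?a] exI[of _ i]) simp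
  qed
  then obtain a k0 where a: "k0 < Suc ?m" "a k0 \<noteq> 0" "(\<Sum>k<Suc ?m. scl C (a k) (iter k)) = 0" by blast
  let ?p = "\<Sum>k<Suc ?m. monom (a k) k"
  have c: "coeff ?p k = (if k < Suc ?m then a k else 0)" for k
    unfolding coeff_sum coeff_monom by (subst sum.delta) auto
  have "degree ?p \<le> ?m" by (rule degree_le) (auto simp: c simp del: sum.lessThan_Suc)
  then have "ev_poly ?p = (\<Sum>k<Suc ?m. scl C (coeff ?p k) (iter k))" by (intro ev_poly_bound) auto
  also have "\<dots> = (\<Sum>k<Suc ?m. scl C (a k) (iter k))" by (intro sum.cong refl) (simp add: c del: sum.lessThan_Suc)
  finally have "ev_poly ?p = 0" using a by simp
  moreover have "?p \<noteq> 0" using c[of k0] a by (metis coeff_0)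
  ultimately show ?thesis by blast
qed

text \<open>A polynomial \<open>p\<close> of least degree that annihilates \<open>t\<close> has a root \<open>z\<close>, and evaluating \<open>p\<close> divided by
the linear factor of \<open>z\<close> gives a nonzero \<open>Q\<close> that is killed by \<open>t - z\<close>.\<close>
lemma eigenvector:
  assumes "\<i> A \<noteq> 0"
  shows "\<exists>z. \<exists>Q\<in>hom C A A. Q \<noteq> 0 \<and> (t - scl C z (\<i> A)) \<cdot> Q = 0"
proof -
  define P where "P = (\<lambda>p. p \<noteq> 0 \<and> ev_poly p = 0)"
  obtain p where p: "P p" and min: "\<And>q. P q \<Longrightarrow> degree p \<le> degree q"
    using annihilating_poly ex_has_least_nat[of P _ degree] unfolding P_def by blast
  have "degree p \<noteq> 0"
  proof
    assume "degree p = 0"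
    then obtain c where c: "p = [:c:]" by (rule degree_eq_zeroE)
    with p have "c \<noteq> 0" "scl C c (\<i> A) = 0" by (auto simp: P_def ev_poly_def iter_def)
    with assms show False by simp
  qed
  then have "\<not> constant (poly p)" by (simp add: constant_degree)
  then obtain z where "poly p z = 0" using fundamental_theorem_of_algebra by blast
  then obtain q where q: "p = [:-z, 1:] * q" by (auto simp: poly_eq_0_iff_dvd)
  with p have q0: "q \<noteq> 0" by (auto simp: P_def)
  then have "degree q < degree p" unfolding q by (subst degree_mult_eq) auto
  then have Q: "ev_poly q \<noteq> 0" using min[of q] q0 by (auto simp: P_def)
  have "(t - scl C z (\<i> A)) \<cdot> ev_poly q = t \<cdot> ev_poly q - scl C z (ev_poly q)"
    using A t ev_poly_hom[of q]
    by (simp add: cmp_diff_left[of A A A] hom_scl idm_in_hom cmp_scl_left[of A A A] cmp_idm_left)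
  also have "\<dots> = 0" using p ev_poly_linear_factor[of z q] q by (simp add: P_def)
  finally show ?thesis using Q ev_poly_hom by blast
qed

end

lemma schur_scalar:
  assumes X: "simple C X" and f: "f \<in> hom C X X"
  shows "\<exists>c. f = scl C c (\<i> X)"
proof -
  have o: "X \<in> obj C" using X by (simp add: simple_def)
  obtain z Q where Q: "Q \<in> hom C X X" "Q \<noteq> 0" "(f - scl C z (\<i> X)) \<cdot> Q = 0"
    using eigenvector[OF o f simple_id_nonzero[OF X]] by blast
  let ?g = "f - scl C z (\<i> X)"
  have g: "?g \<in> hom C X X" using f o by (intro hom_diff hom_scl idm_in_hom) auto
  have "?g = 0"
  proof (rule ccontr)
    assume "?g \<noteq> 0"
    then obtain h where h: "h \<in> hom C X X" "h \<cdot> ?g = \<i> X"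
      using schur_iso[OF X X g] unfolding is_iso_def inverses_def by blast
    have "Q = h \<cdot> (?g \<cdot> Q)" using cmp_assoc[of X X X X Q ?g h] cmp_idm_left[of X X Q] h g Q o by simp
    then show False using Q cmp_0_right[of X X X h] h o by simp
  qed
  then show ?thesis by auto
qed

end

section \<open>The center: twists of simple objects are scalars\<close>

context spherical_fusion_category
begin

text \<open>Half-braidings and the components of tensor products, units and duals in the center are families
of this type, and this typing is what makes associators and unitors of \<open>C\<close> morphisms of the center.\<close>
definition family :: "'o \<Rightarrow> ('o \<Rightarrow> 'm) \<Rightarrow> bool" where
  "family X e \<longleftrightarrow> X \<in> obj C \<and> (\<forall>V\<in>obj C. e V \<in> hom C (X \<otimes> V) (V \<otimes> X))"

definition fam :: "'o \<Rightarrow> ('o \<Rightarrow> 'm) \<Rightarrow> 'o \<Rightarrow> ('o, 'm) arrow" where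
  "fam X e V = arrow (X \<otimes> V) (V \<otimes> X) (e V)"

lemma fam_typ [simp]: "\<lbrakk>family X e; V \<in> obj C\<rbrakk> \<Longrightarrow> ok (fam X e V) \<and> src (fam X e V) = X \<otimes> V \<and> tgt (fam X e V) = V \<otimes> X \<and> mor (fam X e V) = e V"
  by (simp add: family_def fam_def arrow_ok)

lemma family_obj: "family X e \<Longrightarrow> X \<in> obj C" by (simp add: family_def)

lemma center_homI:
  assumes "family X e" "family Y d" "ok f" "src f = X" "tgt f = Y"
    and "\<And>V. V \<in> obj C \<Longrightarrow> (V \<rhd> f) \<bullet> fam X e V = fam Y d V \<bullet> (f \<lhd> V)"
  shows "mor f \<in> center_hom C (X, e) (Y, d)"
  unfolding center_hom_def prod.case
proof (intro CollectI conjI ballI)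
  show "mor f \<in> hom C X Y" using assms mor_hom by blast
  fix V assume V: "V \<in> obj C"
  show "(\<i> V \<odot> mor f) \<cdot> e V = d V \<cdot> (mor f \<odot> \<i> V)"
    using arg_cong[OF assms(6)[OF V], of mor] assms(1-5) V by (simp add: mor_simps)
qed

lemma center_homD:
  assumes "family X e" "family Y d" "f \<in> center_hom C (X, e) (Y, d)" "V \<in> obj C"
  shows "(V \<rhd> arrow X Y f) \<bullet> fam X e V = fam Y d V \<bullet> (arrow X Y f \<lhd> V)"
  using assms family_obj[OF assms(1)] family_obj[OF assms(2)]
  by (intro arrow_eqI) (auto simp: center_hom_def mor_simps arrow_ok)

definition tensor_fam :: "'o \<Rightarrow> ('o \<Rightarrow> ('o, 'm) arrow) \<Rightarrow> 'o \<Rightarrow> ('o \<Rightarrow> ('o, 'm) arrow) \<Rightarrow> 'o \<Rightarrow> ('o, 'm) arrow" where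
  "tensor_fam X E Y D V = \<alpha> V X Y \<bullet> ((E V \<lhd> Y) \<bullet> (\<alpha>i X V Y \<bullet> ((X \<rhd> D V) \<bullet> \<alpha> X Y V)))"

lemma center_tensor_tf:
  assumes "family X e" "family Y d"
  obtains h where "center_tensor C (X, e) (Y, d) = (X \<otimes> Y, h)" "family (X \<otimes> Y) h"
    "\<And>V. V \<in> obj C \<Longrightarrow> fam (X \<otimes> Y) h V = tensor_fam X (fam X e) Y (fam Y d) V"
proof -
  note [simp] = family_obj[OF assms(1)] family_obj[OF assms(2)]
  let ?h = "\<lambda>Z\<in>obj C. asc C Z X Y \<cdot> (e Z \<odot> \<i> Y) \<cdot> asc_inv C X Z Y \<cdot> (\<i> X \<odot> d Z) \<cdot> asc C X Y Z"
  have t: "ok (tensor_fam X (fam X e) Y (fam Y d) V) \<and> src (tensor_fam X (fam X e) Y (fam Y d) V) = (X \<otimes> Y) \<otimes> V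
     \<and> tgt (tensor_fam X (fam X e) Y (fam Y d) V) = V \<otimes> (X \<otimes> Y) \<and> mor (tensor_fam X (fam X e) Y (fam Y d) V) = ?h V"
    if "V \<in> obj C" for V
    using that assms by (simp add: tensor_fam_def mor_simps)
  have "family (X \<otimes> Y) ?h" 
    unfolding family_def
  proof (intro conjI ballI)
    fix V assume "V \<in> obj C"
    from t[OF this] mor_hom[of "tensor_fam X (fam X e) Y (fam Y d) V"]
    show "?h V \<in> hom C ((X \<otimes> Y) \<otimes> V) (V \<otimes> (X \<otimes> Y))" by (simp del: restrict_apply)
  qed simp
  moreover have "fam (X \<otimes> Y) ?h V = tensor_fam X (fam X e) Y (fam Y d) V" if "V \<in> obj C" for V
    using t[OF that] arrow_mor[of "tensor_fam X (fam X e) Y (fam Y d) V"] unfolding fam_def[of _ ?h] by simp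
  ultimately show ?thesis by (intro that[of ?h]) (auto simp: center_tensor_def)
qed

lemma asc_central:
  assumes "family X e" "family Y d" "family Z c"
  shows "asc C X Y Z \<in> center_hom C (center_tensor C (center_tensor C (X, e) (Y, d)) (Z, c))
      (center_tensor C (X, e) (center_tensor C (Y, d) (Z, c)))"
proof -
  note [simp] = family_obj[OF assms(1)] family_obj[OF assms(2)] family_obj[OF assms(3)]
  obtain h1 where h1: "center_tensor C (X, e) (Y, d) = (X \<otimes> Y, h1)" "family (X \<otimes> Y) h1"
    "\<And>V. V \<in> obj C \<Longrightarrow> fam (X \<otimes> Y) h1 V = tensor_fam X (fam X e) Y (fam Y d) V"
    using center_tensor_tf[OF assms(1,2)] by metis
  obtain h2 where h2: "center_tensor C (X \<otimes> Y, h1) (Z, c) = ((X \<otimes> Y) \<otimes> Z, h2)" "family ((X \<otimes> Y) \<otimes> Z) h2"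
    "\<And>V. V \<in> obj C \<Longrightarrow> fam ((X \<otimes> Y) \<otimes> Z) h2 V = tensor_fam (X \<otimes> Y) (fam (X \<otimes> Y) h1) Z (fam Z c) V"
    using center_tensor_tf[OF h1(2) assms(3)] by metis
  obtain h3 where h3: "center_tensor C (Y, d) (Z, c) = (Y \<otimes> Z, h3)" "family (Y \<otimes> Z) h3"
    "\<And>V. V \<in> obj C \<Longrightarrow> fam (Y \<otimes> Z) h3 V = tensor_fam Y (fam Y d) Z (fam Z c) V"
    using center_tensor_tf[OF assms(2,3)] by metis
  obtain h4 where h4: "center_tensor C (X, e) (Y \<otimes> Z, h3) = (X \<otimes> (Y \<otimes> Z), h4)" "family (X \<otimes> (Y \<otimes> Z)) h4"
    "\<And>V. V \<in> obj C \<Longrightarrow> fam (X \<otimes> (Y \<otimes> Z)) h4 V = tensor_fam X (fam X e) (Y \<otimes> Z) (fam (Y \<otimes> Z) h3) V"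
    using center_tensor_tf[OF assms(1) h3(2)] by metis
  have "mor (\<alpha> X Y Z) \<in> center_hom C ((X \<otimes> Y) \<otimes> Z, h2) (X \<otimes> (Y \<otimes> Z), h4)"
  proof (rule center_homI[OF h2(2) h4(2)])
    fix V assume [simp]: "V \<in> obj C"
    show "(V \<rhd> \<alpha> X Y Z) \<bullet> fam ((X \<otimes> Y) \<otimes> Z) h2 V = fam (X \<otimes> (Y \<otimes> Z)) h4 V \<bullet> (\<alpha> X Y Z \<lhd> V)"
      unfolding h2(3)[OF \<open>V \<in> obj C\<close>] h4(3)[OF \<open>V \<in> obj C\<close>] tensor_fam_def h1(3)[OF \<open>V \<in> obj C\<close>] h3(3)[OF \<open>V \<in> obj C\<close>]
      using assms by (simp add: strictify)
  qed simp_all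
  then show ?thesis by (simp add: h1 h2 h3 h4)
qed

lemma rui_tensor: "\<lbrakk>X \<in> obj C; Y \<in> obj C\<rbrakk> \<Longrightarrow> rui (X \<otimes> Y) = \<alpha>i X Y \<one> \<bullet> (X \<rhd> rui Y)"
  by (rule iso_cancel_left[of "rui (X \<otimes> Y)" "ru (X \<otimes> Y)" "(X \<otimes> Y) \<otimes> \<one>"]) (simp_all, simp add: ru_tensor[symmetric])

lemma run_central:
  assumes "family X e"
  obtains h where "center_tensor C (X, e) (center_unit C) = (X \<otimes> \<one>, h)" "family (X \<otimes> \<one>) h"
    "run C X \<in> center_hom C (X \<otimes> \<one>, h) (X, e)"
proof -
  note [simp] = family_obj[OF assms]
  define u where "u = (\<lambda>Z\<in>obj C. run_inv C Z \<cdot> lun C Z)"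
  have ok: "ok (rui V \<bullet> lu V) \<and> src (rui V \<bullet> lu V) = \<one> \<otimes> V \<and> tgt (rui V \<bullet> lu V) = V \<otimes> \<one> \<and> mor (rui V \<bullet> lu V) = u V"
    if "V \<in> obj C" for V using that by (simp add: u_def mor_simps)
  have u: "family \<one> u" 
    unfolding family_def
  proof (intro conjI ballI)
    fix V assume "V \<in> obj C"
    from ok[OF this] mor_hom[of "rui V \<bullet> lu V"] show "u V \<in> hom C (\<one> \<otimes> V) (V \<otimes> \<one>)" by simp
  qed simp
  have fu: "fam \<one> u V = rui V \<bullet> lu V" if "V \<in> obj C" for V using ok[OF that] arrow_mor[of "rui V \<bullet> lu V"] unfolding fam_def by metis
  obtain h where h: "center_tensor C (X, e) (\<one>, u) = (X \<otimes> \<one>, h)" "family (X \<otimes> \<one>) h"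
    "\<And>V. V \<in> obj C \<Longrightarrow> fam (X \<otimes> \<one>) h V = tensor_fam X (fam X e) \<one> (fam \<one> u) V"
    using center_tensor_tf[OF assms u] by metis
  have "mor (ru X) \<in> center_hom C (X \<otimes> \<one>, h) (X, e)"
  proof (rule center_homI[OF h(2) assms])
    fix V assume [simp]: "V \<in> obj C"
    show "(V \<rhd> ru X) \<bullet> fam (X \<otimes> \<one>) h V = fam X e V \<bullet> (ru X \<lhd> V)"
      unfolding h(3)[OF \<open>V \<in> obj C\<close>] tensor_fam_def fu[OF \<open>V \<in> obj C\<close>]
      using assms by (simp add: strictify rwhisk_unit rui_tensor ru_tensor[symmetric])
  qed simp_all
  then show ?thesis using h by (intro that[of h]) (auto simp: center_unit_def u_def[symmetric])
qed

text \<open>An inverse in \<open>C\<close> of a morphism of the center is again a morphism of the center, so that \<open>inv_mor\<close>,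
which for the center ranges over its hom sets, gives the inverse from \<open>C\<close>.\<close>
lemma center_inv_mor:
  assumes "family X e" "family Y d" "f \<in> center_hom C (X, e) (Y, d)" "inverses C X Y f g"
  shows "inv_mor (drinfeld_center C) (X, e) (Y, d) f = g"
proof -
  note [simp] = family_obj[OF assms(1)] family_obj[OF assms(2)]
  have g: "g \<in> hom C Y X" "g \<cdot> f = \<i> X" "f \<cdot> g = \<i> Y" and f: "f \<in> hom C X Y"
    using assms(4) by (auto simp: inverses_def)
  let ?f = "arrow X Y f" and ?g = "arrow Y X g"
  note [simp] = arrow_ok[OF _ _ g(1)] arrow_ok[OF _ _ f]
  have gf: "?g \<bullet> ?f = Id X" "?f \<bullet> ?g = Id Y" using g by (auto intro!: arrow_eqI simp: mor_simps)
  have "mor ?g \<in> center_hom C (Y, d) (X, e)"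
  proof (rule center_homI[OF assms(2,1)])
    fix V assume V [simp]: "V \<in> obj C"
    have "(V \<rhd> ?g) \<bullet> fam Y d V = (V \<rhd> ?g) \<bullet> ((fam Y d V \<bullet> (?f \<lhd> V)) \<bullet> (?g \<lhd> V))"
      using assms by (simp add: rwhisk_inv[OF gf(2)])
    also have "\<dots> = ((V \<rhd> ?g) \<bullet> (V \<rhd> ?f)) \<bullet> (fam X e V \<bullet> (?g \<lhd> V))"
      unfolding center_homD[OF assms(1-3) V, symmetric] by simp
    also have "\<dots> = fam X e V \<bullet> (?g \<lhd> V)"
      using assms by (simp add: lwhisk_inv[OF gf(1)] del: comp_assoc)
    finally show "(V \<rhd> ?g) \<bullet> fam Y d V = fam X e V \<bullet> (?g \<lhd> V)" .
  qed simp_all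
  then have i: "inverses (drinfeld_center C) (X, e) (Y, d) f g"
    using assms(3) g by (simp add: inverses_def drinfeld_center_def)
  show ?thesis
    unfolding inv_mor_def
  proof (rule the_equality, rule i)
    fix g' assume "inverses (drinfeld_center C) (X, e) (Y, d) f g'"
    then have "inverses C X Y f g'"
      by (simp add: inverses_def drinfeld_center_def center_hom_def)
    then show "g' = g" using assms(4) by (intro inverses_unique[of X Y f]) simp_all
  qed
qed

end

context half_braided
begin

lemma e_tf: "family A e"
  using e_inverses by (auto simp: family_def inverses_def)

lemma center_dual_tf: obtains h where "center_dual C (A, e) = (Ad, h)" "family Ad h"
proof -
  let ?h = "\<lambda>Z\<in>obj C. ((lun C Z \<cdot> (ev C A \<odot> \<i> Z) \<cdot> asc_inv C (A\<^sup>\<star>) A Z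
         \<cdot> (\<i> (A\<^sup>\<star>) \<odot> inv_mor C (A \<otimes> Z) (Z \<otimes> A) (e Z)) \<cdot> asc C (A\<^sup>\<star>) Z A) \<odot> \<i> (A\<^sup>\<star>))
       \<cdot> asc_inv C (A\<^sup>\<star> \<otimes> Z) A (A\<^sup>\<star>) \<cdot> (\<i> (A\<^sup>\<star> \<otimes> Z) \<odot> coev C A) \<cdot> run_inv C (A\<^sup>\<star> \<otimes> Z)"
  have "mor (Edual Z) = ?h Z" if "Z \<in> obj C" for Z
    using that by (simp add: Edual_def bend_def cap_def mor_simps del: lwhisk_comp rwhisk_comp)
  note h = this
  have "family Ad ?h"
    unfolding family_def
  proof (intro conjI ballI)
    fix V assume V: "V \<in> obj C"
    from h[OF V, symmetric] mor_hom[of "Edual V"] V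
    show "?h V \<in> hom C (Ad \<otimes> V) (V \<otimes> Ad)" by (simp del: restrict_apply)
  qed simp
  then show ?thesis by (intro that[of ?h]) (auto simp: center_dual_def)
qed

lemma center_twist_mor: "twist_mor (drinfeld_center C) (A, e) = mor twist_arrow"
proof -
  obtain d where d: "center_dual C (A, e) = (Ad, d)" "family Ad d" by (rule center_dual_tf)
  obtain h where h: "center_tensor C (A, e) (center_unit C) = (A \<otimes> \<one>, h)" "family (A \<otimes> \<one>) h"
    "run C A \<in> center_hom C (A \<otimes> \<one>, h) (A, e)" by (rule run_central[OF e_tf])
  have 1: "run_inv (drinfeld_center C) (A, e) = run_inv C A"
    using center_inv_mor[OF h(2) e_tf h(3) run_inverses] unfolding Defs.run_inv_def[of "drinfeld_center C"]
    by (simp add: drinfeld_center_def h)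
  obtain h1 where h1: "center_tensor C (A, e) (A, e) = (A \<otimes> A, h1)" "family (A \<otimes> A) h1"
    using center_tensor_tf[OF e_tf e_tf] by metis
  obtain h2 where h2: "center_tensor C (A \<otimes> A, h1) (Ad, d) = ((A \<otimes> A) \<otimes> Ad, h2)" "family ((A \<otimes> A) \<otimes> Ad) h2"
    using center_tensor_tf[OF h1(2) d(2)] by metis
  obtain h3 where h3: "center_tensor C (A, e) (Ad, d) = (A \<otimes> Ad, h3)" "family (A \<otimes> Ad) h3"
    using center_tensor_tf[OF e_tf d(2)] by metis
  obtain h4 where h4: "center_tensor C (A, e) (A \<otimes> Ad, h3) = (A \<otimes> (A \<otimes> Ad), h4)" "family (A \<otimes> (A \<otimes> Ad)) h4"
    using center_tensor_tf[OF e_tf h3(2)] by metis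
  have "asc C A A Ad \<in> center_hom C ((A \<otimes> A) \<otimes> Ad, h2) (A \<otimes> (A \<otimes> Ad), h4)"
    using asc_central[OF e_tf e_tf d(2)] by (simp add: h1 h2 h3 h4)
  then have 2: "asc_inv (drinfeld_center C) (A, e) (A, e) (Ad, d) = asc_inv C A A Ad"
    using center_inv_mor[OF h2(2) h4(2) _ asc_inverses] unfolding Defs.asc_inv_def[of "drinfeld_center C"]
    by (simp add: drinfeld_center_def h1 h2 h3 h4)
  have 3: "piv_ev (drinfeld_center C) (A, e) = piv_ev C A"
    by (simp add: piv_ev_def drinfeld_center_def d)
  have 4: "dual (drinfeld_center C) (A, e) = (Ad, d)" by (simp add: drinfeld_center_def d)
  show ?thesis
    unfolding twist_mor_def 1 3 4 2 twist_arrow_mor by (simp add: drinfeld_center_def)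
qed

text \<open>The new half-braiding is that of \<open>A\<close> between the inclusion \<open>k\<close> and the retraction \<open>r\<close>.  By the two
premises of invariance, the inclusion intertwines the half-braidings and their inverses, and the
axioms for \<open>K\<close> follow from those for \<open>A\<close> by cancelling the inclusion on the left.\<close>
lemma restrict_half_braiding:
  assumes k: "ok k" "src k = K" "tgt k = A" and r: "ok r" "src r = A" "tgt r = K" and rk: "r \<bullet> k = Id K"
    and inv1: "\<And>Z. Z \<in> obj C \<Longrightarrow> (Z \<rhd> (k \<bullet> r)) \<bullet> (E Z \<bullet> (k \<lhd> Z)) = E Z \<bullet> (k \<lhd> Z)"
    and inv2: "\<And>Z. Z \<in> obj C \<Longrightarrow> ((k \<bullet> r) \<lhd> Z) \<bullet> (Ei Z \<bullet> (Z \<rhd> k)) = Ei Z \<bullet> (Z \<rhd> k)"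
  obtains d where "half_braiding C K d" "mor k \<in> center_hom C (K, d) (A, e)"
proof -
  note [simp] = k r
  have [simp]: "K \<in> obj C" using src_obj[OF k(1)] by simp
  define D where "D Z = (Z \<rhd> r) \<bullet> (E Z \<bullet> (k \<lhd> Z))" for Z
  define Di where "Di Z = (r \<lhd> Z) \<bullet> (Ei Z \<bullet> (Z \<rhd> k))" for Z
  have D [simp]: "ok (D Z)" "src (D Z) = K \<otimes> Z" "tgt (D Z) = Z \<otimes> K" if "Z \<in> obj C" for Z
    using that by (simp_all add: D_def)
  have Di [simp]: "ok (Di Z)" "src (Di Z) = Z \<otimes> K" "tgt (Di Z) = K \<otimes> Z" if "Z \<in> obj C" for Z
    using that by (simp_all add: Di_def)
  have kD: "(Z \<rhd> k) \<bullet> D Z = E Z \<bullet> (k \<lhd> Z)" if "Z \<in> obj C" for Z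
    using inv1[OF that] that by (simp add: D_def)
  have kDi: "(k \<lhd> Z) \<bullet> Di Z = Ei Z \<bullet> (Z \<rhd> k)" if "Z \<in> obj C" for Z
    using inv2[OF that] that by (simp add: Di_def)
  have DDi: "D Z \<bullet> Di Z = Id (Z \<otimes> K)" if [simp]: "Z \<in> obj C" for Z
    unfolding D_def by (simp add: kDi reassoc[OF E_inv(1)] lwhisk_inv[OF rk])
  have DiD: "Di Z \<bullet> D Z = Id (K \<otimes> Z)" if [simp]: "Z \<in> obj C" for Z
    unfolding Di_def by (simp add: kD reassoc[OF E_inv(2)] rwhisk_inv[OF rk])
  have cancel: "a = b" if "(Z \<rhd> k) \<bullet> a = (Z \<rhd> k) \<bullet> b" "ok a" "ok b" "tgt a = Z \<otimes> K" "tgt b = Z \<otimes> K" "Z \<in> obj C" for a b Z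
    using iso_cancel_left[OF lwhisk_inv[OF rk, of Z]] that by simp
  define d where "d = (\<lambda>Z\<in>obj C. mor (D Z))"
  have fd: "fam K d Z = D Z" if "Z \<in> obj C" for Z using that arrow_mor[of "D Z"] by (simp add: d_def fam_def)
  have tfd: "family K d" 
    unfolding family_def
  proof (intro conjI ballI)
    fix V assume "V \<in> obj C"
    then show "d V \<in> hom C (K \<otimes> V) (V \<otimes> K)" using mor_hom[of "D V"] by (simp add: d_def)
  qed simp
  have nat: "(f \<lhd> K) \<bullet> D Z = D W \<bullet> (K \<rhd> f)" if f: "ok f" "src f = Z" "tgt f = W" for f Z W
  proof (rule cancel[of W])
    note [simp] = f
    have [simp]: "Z \<in> obj C" "W \<in> obj C" using src_obj[OF f(1)] tgt_obj[OF f(1)] by simp_all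
    have "(W \<rhd> k) \<bullet> ((f \<lhd> K) \<bullet> D Z) = (f \<lhd> A) \<bullet> (E Z \<bullet> (k \<lhd> Z))"
      using reassoc[OF interchange[of f k Z W K A, symmetric], of "D Z"] by (simp add: kD)
    also have "\<dots> = E W \<bullet> ((k \<lhd> W) \<bullet> (K \<rhd> f))"
      by (simp add: reassoc[OF E_natural[of f]] interchange[of k f])
    also have "\<dots> = (W \<rhd> k) \<bullet> (D W \<bullet> (K \<rhd> f))" by (simp add: reassoc[OF kD])
    finally show "(W \<rhd> k) \<bullet> ((f \<lhd> K) \<bullet> D Z) = (W \<rhd> k) \<bullet> (D W \<bullet> (K \<rhd> f))" .
  qed (use f in auto)
  have hex: "\<alpha> Z W K \<bullet> (D (Z \<otimes> W) \<bullet> \<alpha> K Z W) = (Z \<rhd> D W) \<bullet> (\<alpha> Z K W \<bullet> (D Z \<lhd> W))"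
    if [simp]: "Z \<in> obj C" "W \<in> obj C" for Z W
  proof -
    have "(Z \<rhd> W \<rhd> k) \<bullet> (\<alpha> Z W K \<bullet> (D (Z \<otimes> W) \<bullet> \<alpha> K Z W)) = \<alpha> Z W A \<bullet> ((E (Z \<otimes> W) \<bullet> (k \<lhd> (Z \<otimes> W))) \<bullet> \<alpha> K Z W)"
      by (simp add: reassoc[OF \<alpha>_natural3[symmetric]] kD[symmetric])
    also have "\<dots> = (\<alpha> Z W A \<bullet> (E (Z \<otimes> W) \<bullet> \<alpha> A Z W)) \<bullet> (k \<lhd> Z \<lhd> W)"
      by (simp add: \<alpha>_natural1)
    also have "\<dots> = (Z \<rhd> E W) \<bullet> (\<alpha> Z A W \<bullet> ((E Z \<bullet> (k \<lhd> Z)) \<lhd> W))"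
      unfolding E_hexagon[OF that] by simp
    also have "\<dots> = (Z \<rhd> (E W \<bullet> (k \<lhd> W))) \<bullet> (\<alpha> Z K W \<bullet> (D Z \<lhd> W))"
      unfolding kD[OF that(1), symmetric] by (simp add: reassoc[OF \<alpha>_natural2])
    also have "\<dots> = (Z \<rhd> W \<rhd> k) \<bullet> ((Z \<rhd> D W) \<bullet> (\<alpha> Z K W \<bullet> (D Z \<lhd> W)))"
      unfolding kD[OF that(2), symmetric] by simp
    finally show ?thesis
      using iso_cancel_left[OF lwhisk_inv[OF lwhisk_inv[OF rk, of W], of Z]] by simp
  qed
  have unit: "lu K \<bullet> D \<one> = ru K"
  proof -
    have "k \<bullet> (lu K \<bullet> D \<one>) = lu A \<bullet> (E \<one> \<bullet> (k \<lhd> \<one>))"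
      by (simp add: reassoc[OF lu_natural[symmetric]] kD)
    also have "\<dots> = k \<bullet> ru K" by (simp add: reassoc[OF E_unit] ru_natural)
    finally show ?thesis using iso_cancel_left[OF rk] by simp
  qed
  have "half_braiding C K d"
    unfolding half_braiding_def
  proof (intro conjI ballI)
    show "d \<in> extensional (obj C)" by (simp add: d_def)
    fix Z assume Z [simp]: "Z \<in> obj C"
    have "inverses C (K \<otimes> Z) (Z \<otimes> K) (d Z) (mor (Di Z))"
      using arg_cong[OF DDi[OF Z], of mor] arg_cong[OF DiD[OF Z], of mor] mor_hom[of "D Z"] mor_hom[of "Di Z"]
      by (simp add: inverses_def d_def mor_simps)
    then show "is_iso C (K \<otimes> Z) (Z \<otimes> K) (d Z)" by (auto simp: is_iso_def)
    fix W assume W [simp]: "W \<in> obj C"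
    show "asc C Z W K \<cdot> d (Z \<otimes> W) \<cdot> asc C K Z W = (\<i> Z \<odot> d W) \<cdot> asc C Z K W \<cdot> (d Z \<odot> \<i> W)"
      using arg_cong[OF hex[OF Z W], of mor] by (simp add: d_def mor_simps)
    fix f assume "f \<in> hom C Z W"
    then show "(f \<odot> \<i> K) \<cdot> d Z = d W \<cdot> (\<i> K \<odot> f)"
      using arg_cong[OF nat[of "arrow Z W f" Z W], of mor] by (simp add: d_def mor_simps arrow_ok)
  next
    show "lun C K \<cdot> d \<one> = run C K" using arg_cong[OF unit, of mor] by (simp add: d_def mor_simps)
  qed
  moreover have "mor k \<in> center_hom C (K, d) (A, e)"
    by (rule center_homI[OF tfd e_tf]) (simp_all add: fd kD fam_def[of A e] E_def[symmetric])
  ultimately show ?thesis by (rule that)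
qed

text \<open>The kernel \<open>K\<close> of \<open>f\<close> in \<open>C\<close> is split by the idempotent \<open>1 - g f\<close>, for \<open>g\<close> with \<open>f g f = f\<close>.  It is
invariant under the half-braiding, because \<open>g f\<close> kills whatever \<open>f\<close> kills and \<open>f\<close> commutes with the
half-braiding.  As \<open>Q\<close> factors through \<open>K\<close>, the subobject \<open>K\<close> is not zero, so it is everything.\<close>
lemma center_schur:
  assumes simple: "simple (drinfeld_center C) (A, e)"
    and f: "f \<in> center_hom C (A, e) (A, e)" and Q: "Q \<in> hom C A A" "Q \<noteq> 0" "f \<cdot> Q = 0"
  shows "f = 0"
proof -
  have fh: "f \<in> hom C A A" using f by (simp add: center_hom_def)
  obtain g where g: "g \<in> hom C A A" "f \<cdot> (g \<cdot> f) = f" using regular[OF A_obj A_obj fh] by blast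
  obtain K k where ker: "is_kernel C K k A A f"
    using abelian A_obj fh unfolding abelian_def by blast
  have K [simp]: "K \<in> obj C" and k: "k \<in> hom C K A" "f \<cdot> k = 0" using ker by (auto simp: is_kernel_def)
  have gf: "g \<cdot> f \<in> hom C A A" using cmp_in_hom g fh A_obj by blast
  define \<pi> where "\<pi> = \<i> A - g \<cdot> f"
  have \<pi>: "\<pi> \<in> hom C A A" unfolding \<pi>_def by (intro hom_diff idm_in_hom gf) auto
  have "f \<cdot> \<pi> = 0" unfolding \<pi>_def
    using cmp_diff_right[of A A A "\<i> A" "g \<cdot> f" f] gf fh g idm_in_hom cmp_idm_right[of A A f] by simp
  then obtain r where r: "r \<in> hom C A K" "k \<cdot> r = \<pi>"
    using ker \<pi> A_obj unfolding is_kernel_def by blast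
  have "(g \<cdot> f) \<cdot> k = 0" using cmp_assoc[of K A A A k f g] k g fh cmp_0_right[of K A A g] by simp
  then have "\<pi> \<cdot> k = k" unfolding \<pi>_def
    using cmp_diff_left[of K A A k "\<i> A" "g \<cdot> f"] gf k idm_in_hom cmp_idm_left[of K A k] by simp
  then have "k \<cdot> (r \<cdot> k) = k \<cdot> \<i> K"
    using cmp_assoc[of K A K A k r k] r k cmp_idm_right[of K A k] by simp
  moreover have "r \<cdot> k \<in> hom C K K" using cmp_in_hom[of K A K] r k by simp
  ultimately have rk: "r \<cdot> k = \<i> K"
    using kernel_mono[OF A_obj A_obj fh ker] idm_in_hom[OF K] K unfolding is_mono_def by blast
  let ?k = "arrow K A k" and ?r = "arrow A K r" and ?f = "arrow A A f" and ?g = "arrow A A g"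
  note [simp] = arrow_ok[OF K A_obj k(1)] arrow_ok[OF A_obj K r(1)] arrow_ok[OF A_obj A_obj fh] arrow_ok[OF A_obj A_obj g(1)]
  have 1: "?r \<bullet> ?k = Id K" by (rule arrow_eqI) (simp_all add: mor_simps rk)
  have fk: "mor (?f \<bullet> ?k) = 0" using k by (simp add: mor_simps)
  have fE: "(Z \<rhd> ?f) \<bullet> E Z = E Z \<bullet> (?f \<lhd> Z)" if "Z \<in> obj C" for Z
    using center_homD[OF e_tf e_tf f that] by (simp add: E_def fam_def)
  have t0: "(0 \<odot> \<i> Z) = 0" "(\<i> Z \<odot> 0) = 0" if "Z \<in> obj C" for Z
    using that tmor_diff_left[of K A Z Z 0 0 "\<i> Z"] tmor_diff_right[of Z Z K A "\<i> Z" 0 0] by (simp_all add: idm_in_hom)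
  obtain d where d: "half_braiding C K d" "mor ?k \<in> center_hom C (K, d) (A, e)"
  proof (rule restrict_half_braiding[of ?k K ?r])
    fix Z assume Z [simp]: "Z \<in> obj C"
    let ?x = "E Z \<bullet> (?k \<lhd> Z)"
    have "(Z \<rhd> (?g \<bullet> ?f)) \<bullet> ?x = ((Z \<rhd> ?g) \<bullet> E Z) \<bullet> ((?f \<bullet> ?k) \<lhd> Z)"
      by (simp add: reassoc[OF fE])
    then have "mor ((Z \<rhd> (?g \<bullet> ?f)) \<bullet> ?x) = mor ((Z \<rhd> ?g) \<bullet> E Z) \<cdot> mor ((?f \<bullet> ?k) \<lhd> Z)"
      by (simp only:) (rule mor_comp, simp_all)
    also have "mor ((?f \<bullet> ?k) \<lhd> Z) = 0"
      by (subst mor_rwh) (simp_all only: fk t0[OF Z], simp_all)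
    also have "mor ((Z \<rhd> ?g) \<bullet> E Z) \<cdot> 0 = 0"
      by (rule cmp_0_right[of "K \<otimes> Z" "A \<otimes> Z" "Z \<otimes> A"]) (use mor_hom[of "(Z \<rhd> ?g) \<bullet> E Z"] in simp_all)
    finally have z: "(\<i> Z \<odot> (g \<cdot> f)) \<cdot> mor ?x = 0" by (simp add: mor_simps del: lwhisk_comp rwhisk_comp)
    have x: "mor ?x \<in> hom C (K \<otimes> Z) (Z \<otimes> A)" using mor_hom[of ?x] by simp
    have gh: "\<i> Z \<odot> (g \<cdot> f) \<in> hom C (Z \<otimes> A) (Z \<otimes> A)" by (rule tmor_in_hom) (auto simp: idm_in_hom gf)
    have "(\<i> Z \<odot> \<pi>) \<cdot> mor ?x = mor ?x"
      unfolding \<pi>_def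
      using tmor_diff_right[of Z Z A A "\<i> Z" "\<i> A" "g \<cdot> f"] z x gh gf
        cmp_diff_left[of "K \<otimes> Z" "Z \<otimes> A" "Z \<otimes> A" "mor ?x" "\<i> (Z \<otimes> A)" "\<i> Z \<odot> (g \<cdot> f)"] cmp_idm_left[of "K \<otimes> Z" "Z \<otimes> A" "mor ?x"]
      by (simp add: idm_in_hom tmor_idm)
    then show "(Z \<rhd> (?k \<bullet> ?r)) \<bullet> ?x = ?x"
      by (intro arrow_eqI) (simp_all add: mor_comp[of ?x] mor_lwh mor_comp[of ?r] r del: lwhisk_comp)
  next
    fix Z assume Z [simp]: "Z \<in> obj C"
    let ?x = "Ei Z \<bullet> (Z \<rhd> ?k)"
    have "?f \<lhd> Z = Ei Z \<bullet> ((Z \<rhd> ?f) \<bullet> E Z)" using fE[OF Z] inv_cancel[OF E_inv(2)[OF Z], of "?f \<lhd> Z"] by simp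
    then have "((?g \<bullet> ?f) \<lhd> Z) \<bullet> ?x = ((?g \<lhd> Z) \<bullet> Ei Z) \<bullet> (Z \<rhd> (?f \<bullet> ?k))"
      by (simp add: reassoc[OF E_inv(1)])
    then have "mor (((?g \<bullet> ?f) \<lhd> Z) \<bullet> ?x) = mor ((?g \<lhd> Z) \<bullet> Ei Z) \<cdot> mor (Z \<rhd> (?f \<bullet> ?k))"
      by (simp only:) (rule mor_comp, simp_all)
    also have "mor (Z \<rhd> (?f \<bullet> ?k)) = 0"
      by (subst mor_lwh) (simp_all only: fk t0[OF Z], simp_all)
    also have "mor ((?g \<lhd> Z) \<bullet> Ei Z) \<cdot> 0 = 0"
      by (rule cmp_0_right[of "Z \<otimes> K" "Z \<otimes> A" "A \<otimes> Z"]) (use mor_hom[of "(?g \<lhd> Z) \<bullet> Ei Z"] in simp_all)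
    finally have z: "((g \<cdot> f) \<odot> \<i> Z) \<cdot> mor ?x = 0" by (simp add: mor_simps del: lwhisk_comp rwhisk_comp)
    have x: "mor ?x \<in> hom C (Z \<otimes> K) (A \<otimes> Z)" using mor_hom[of ?x] by simp
    have gh: "(g \<cdot> f) \<odot> \<i> Z \<in> hom C (A \<otimes> Z) (A \<otimes> Z)" by (rule tmor_in_hom) (auto simp: idm_in_hom gf)
    have "(\<pi> \<odot> \<i> Z) \<cdot> mor ?x = mor ?x"
      unfolding \<pi>_def
      using tmor_diff_left[of A A Z Z "\<i> A" "g \<cdot> f" "\<i> Z"] z x gh gf
        cmp_diff_left[of "Z \<otimes> K" "A \<otimes> Z" "A \<otimes> Z" "mor ?x" "\<i> (A \<otimes> Z)" "(g \<cdot> f) \<odot> \<i> Z"] cmp_idm_left[of "Z \<otimes> K" "A \<otimes> Z" "mor ?x"]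
      by (simp add: idm_in_hom tmor_idm)
    then show "((?k \<bullet> ?r) \<lhd> Z) \<bullet> ?x = ?x"
      by (intro arrow_eqI) (simp_all add: mor_comp[of ?x] mor_rwh mor_comp[of ?r] r del: rwhisk_comp)
  qed (simp_all add: 1)
  have Ko: "(K, d) \<in> obj (drinfeld_center C)" using d by (simp add: drinfeld_center_def)
  have kc: "k \<in> hom (drinfeld_center C) (K, d) (A, e)" using d by (simp add: drinfeld_center_def)
  have "is_mono (drinfeld_center C) (K, d) (A, e) k"
    unfolding is_mono_def
  proof (intro conjI ballI impI kc)
    fix W u v assume W: "W \<in> obj (drinfeld_center C)" "u \<in> hom (drinfeld_center C) W (K, d)"
      "v \<in> hom (drinfeld_center C) W (K, d)" "k \<cdot>\<^bsub>drinfeld_center C\<^esub> u = k \<cdot>\<^bsub>drinfeld_center C\<^esub> v"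
    obtain W0 w where "W = (W0, w)" by (cases W)
    with W have "W0 \<in> obj C" "u \<in> hom C W0 K" "v \<in> hom C W0 K" "k \<cdot> u = k \<cdot> v"
      by (simp_all add: drinfeld_center_def center_hom_def)
    then show "u = v" using kernel_mono[OF A_obj A_obj fh ker] unfolding is_mono_def by blast
  qed
  then consider "Defs.is_zero (drinfeld_center C) (K, d)" | "is_iso (drinfeld_center C) (K, d) (A, e) k"
    using simple Ko unfolding simple_def by blast
  then show ?thesis
  proof cases
    case 1
    have "\<i> K \<in> center_hom C (K, d) (K, d)"
    proof -
      have "\<i> (Z \<otimes> K) \<cdot> d Z = d Z \<cdot> \<i> (K \<otimes> Z)" if "Z \<in> obj C" for Z
        using that d(1) cmp_idm_left[of "K \<otimes> Z" "Z \<otimes> K" "d Z"] cmp_idm_right[of "K \<otimes> Z" "Z \<otimes> K" "d Z"]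
        by (auto simp: half_braiding_def is_iso_def inverses_def)
      then show ?thesis by (auto simp: center_hom_def idm_in_hom tmor_idm)
    qed
    then have "\<i> K = 0" using 1 Ko unfolding Defs.is_zero_def by (auto simp: drinfeld_center_def)
    then have "k = 0" using cmp_idm_right[of K A k] cmp_0_right[of K K A k] k by simp
    then have "\<pi> = 0" using r cmp_0_left[of A K A r] by simp
    then have "\<i> A = g \<cdot> f" by (simp add: \<pi>_def)
    then have "Q = (g \<cdot> f) \<cdot> Q" using cmp_idm_left[of A A Q] Q by simp
    also have "\<dots> = 0" using cmp_assoc[of A A A A Q f g] Q g fh cmp_0_right[of A A A g] by simp
    finally show ?thesis using Q by simp
  next
    case 2
    then obtain k' where k': "k' \<in> hom C A K" "k \<cdot> k' = \<i> A"
      unfolding is_iso_def inverses_def by (auto simp: drinfeld_center_def center_hom_def)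
    have "f = f \<cdot> (k \<cdot> k')" using k' fh cmp_idm_right[of A A f] by simp
    also have "\<dots> = 0" using cmp_assoc[of A K A A k' k f] cmp_0_left[of A K A k'] k' k fh by simp
    finally show ?thesis .
  qed
qed

lemma center_id_nonzero:
  assumes "simple (drinfeld_center C) (A, e)" shows "\<i> A \<noteq> 0"
proof
  assume "\<i> A = 0"
  then have z: "Defs.is_zero C A" by (intro is_zero_if_id_zero) auto
  have "Defs.is_zero (drinfeld_center C) (A, e)"
    unfolding Defs.is_zero_def
  proof (intro conjI ballI)
    show o: "(A, e) \<in> obj (drinfeld_center C)" using half_braiding by (simp add: drinfeld_center_def)
    fix W assume "W \<in> obj (drinfeld_center C)"
    then obtain W0 w where W: "W = (W0, w)" "W0 \<in> obj C" "half_braiding C W0 w" by (auto simp: drinfeld_center_def)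
    have "family W0 w" using W unfolding family_def half_braiding_def is_iso_def inverses_def by auto
    have zm: "(0 \<odot> \<i> Z) = 0" "(\<i> Z \<odot> 0) = 0" if "Z \<in> obj C" for Z
      using that tmor_diff_left[of A A Z Z 0 0 "\<i> Z"] tmor_diff_right[of Z Z A A "\<i> Z" 0 0] by (simp_all add: idm_in_hom)
    have e0: "0 \<cdot> e Z = 0" "e Z \<cdot> 0 = 0" "0 \<cdot> w Z = 0" "w Z \<cdot> 0 = 0" if "Z \<in> obj C" for Z
      using that e_tf \<open>family W0 w\<close> W(2) cmp_0_left[of "A \<otimes> Z" "Z \<otimes> A" "Z \<otimes> W0" "e Z"] cmp_0_left[of "W0 \<otimes> Z" "Z \<otimes> W0" "Z \<otimes> A" "w Z"]
        cmp_0_right[of "A \<otimes> Z" "W0 \<otimes> Z" "Z \<otimes> W0" "w Z"] cmp_0_right[of "W0 \<otimes> Z" "A \<otimes> Z" "Z \<otimes> A" "e Z"]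
      by (simp_all add: family_def)
    have "0 \<in> center_hom C (A, e) (W0, w)" "0 \<in> center_hom C (W0, w) (A, e)"
      unfolding center_hom_def using W(2) by (auto simp: zm e0)
    moreover have "center_hom C (A, e) (W0, w) \<subseteq> {0}" "center_hom C (W0, w) (A, e) \<subseteq> {0}"
      using z W(2) unfolding Defs.is_zero_def center_hom_def by auto
    ultimately show "hom (drinfeld_center C) (A, e) W = {0}" "hom (drinfeld_center C) W (A, e) = {0}"
      unfolding W by (auto simp: drinfeld_center_def)
  qed
  with assms show False by (simp add: simple_def)
qed

theorem twist_scalar:
  assumes simple: "simple (drinfeld_center C) (A, e)"
  shows "mor twist_arrow = scl C (twist (drinfeld_center C) (A, e)) (\<i> A)"
proof -
  interpret vs: vector_space "scl C" by (rule vector_space_scl)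
  have t: "mor twist_arrow \<in> hom C A A" using mor_hom[of twist_arrow] by simp
  have nz: "\<i> A \<noteq> 0" by (rule center_id_nonzero[OF simple])
  obtain z Q where Q: "Q \<in> hom C A A" "Q \<noteq> 0" "(mor twist_arrow - scl C z (\<i> A)) \<cdot> Q = 0"
    using eigenvector[OF A_obj t nz] by blast
  have s: "scl C z (\<i> A) \<in> hom C A A" by (intro hom_scl idm_in_hom) auto
  have "mor twist_arrow - scl C z (\<i> A) \<in> center_hom C (A, e) (A, e)"
    unfolding center_hom_def prod.case
  proof (intro CollectI conjI ballI)
    show "mor twist_arrow - scl C z (\<i> A) \<in> hom C A A" by (intro hom_diff t s) auto
    fix Z assume Z [simp]: "Z \<in> obj C"
    have eZ: "e Z \<in> hom C (A \<otimes> Z) (Z \<otimes> A)" using e_tf by (simp add: family_def)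
    have 1: "(\<i> Z \<odot> mor twist_arrow) \<cdot> e Z = e Z \<cdot> (mor twist_arrow \<odot> \<i> Z)"
      using arg_cong[OF twist_arrow_central[OF Z], of mor] by (simp add: mor_simps)
    have 2: "\<i> Z \<odot> mor twist_arrow \<in> hom C (Z \<otimes> A) (Z \<otimes> A)" "mor twist_arrow \<odot> \<i> Z \<in> hom C (A \<otimes> Z) (A \<otimes> Z)"
      by (auto intro!: tmor_in_hom t idm_in_hom)
    have 3: "\<i> Z \<odot> scl C z (\<i> A) = scl C z (\<i> (Z \<otimes> A))" "scl C z (\<i> A) \<odot> \<i> Z = scl C z (\<i> (A \<otimes> Z))"
      by (simp_all add: tmor_scl_right[of Z Z A A] tmor_scl_left[of A A Z Z] idm_in_hom tmor_idm)
    show "(\<i> Z \<odot> (mor twist_arrow - scl C z (\<i> A))) \<cdot> e Z = e Z \<cdot> ((mor twist_arrow - scl C z (\<i> A)) \<odot> \<i> Z)"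
      using t s eZ 2
      by (simp add: tmor_diff_right[of Z Z A A] tmor_diff_left[of A A Z Z] idm_in_hom 3 1
        cmp_diff_left[of "A \<otimes> Z" "Z \<otimes> A" "Z \<otimes> A"] cmp_diff_right[of "A \<otimes> Z" "A \<otimes> Z" "Z \<otimes> A"] hom_scl
        cmp_scl_left[of "A \<otimes> Z" "Z \<otimes> A" "Z \<otimes> A"] cmp_scl_right[of "A \<otimes> Z" "A \<otimes> Z" "Z \<otimes> A"]
        cmp_idm_left[of "A \<otimes> Z" "Z \<otimes> A"] cmp_idm_right[of "A \<otimes> Z" "Z \<otimes> A"])
  qed
  then have tz: "mor twist_arrow = scl C z (\<i> A)" using center_schur[OF simple _ Q] by simp
  have "twist (drinfeld_center C) (A, e) = z"
    unfolding twist_def center_twist_mor tz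
    using nz by (intro the_equality) (auto simp: drinfeld_center_def)
  with tz show ?thesis by simp
qed

end

section \<open>Objects with a trivial tensor power\<close>

context monoidal_linear_category
begin

definition scale :: "complex \<Rightarrow> ('o, 'm) arrow \<Rightarrow> ('o, 'm) arrow" where
  "scale b a = arrow (src a) (tgt a) (scl C b (mor a))"

lemma scale_typ [simp]: "ok a \<Longrightarrow> ok (scale b a) \<and> src (scale b a) = src a \<and> tgt (scale b a) = tgt a \<and> mor (scale b a) = scl C b (mor a)"
  unfolding scale_def by (intro arrow_ok) (auto intro: hom_scl mor_hom)

lemma scale_comp_left: "\<lbrakk>ok x; ok y; src x = tgt y\<rbrakk> \<Longrightarrow> scale b x \<bullet> y = scale b (x \<bullet> y)"
  using cmp_scl_left[of "src y" "tgt y" "tgt x" "mor y" "mor x" b] mor_hom[of x] mor_hom[of y] tgt_obj[of y]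
  by (intro arrow_eqI) (auto simp: mor_comp)
lemma scale_comp_right: "\<lbrakk>ok x; ok y; src x = tgt y\<rbrakk> \<Longrightarrow> x \<bullet> scale b y = scale b (x \<bullet> y)"
  using cmp_scl_right[of "src y" "tgt y" "tgt x" "mor y" "mor x" b] mor_hom[of x] mor_hom[of y] tgt_obj[of y]
  by (intro arrow_eqI) (auto simp: mor_comp)
lemma scale_lwh: "\<lbrakk>ok x; X \<in> obj C\<rbrakk> \<Longrightarrow> X \<rhd> scale b x = scale b (X \<rhd> x)"
  using tmor_scl_right[of X X "src x" "tgt x" "\<i> X" "mor x" b] mor_hom[of x]
  by (intro arrow_eqI) (auto simp: mor_lwh idm_in_hom)
lemma scale_rwh: "\<lbrakk>ok x; X \<in> obj C\<rbrakk> \<Longrightarrow> scale b x \<lhd> X = scale b (x \<lhd> X)"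
  using tmor_scl_left[of "src x" "tgt x" X X "mor x" "\<i> X" b] mor_hom[of x]
  by (intro arrow_eqI) (auto simp: mor_rwh idm_in_hom)
lemma scale_sc: "ok x \<Longrightarrow> scale a (scale b x) = scale (a * b) x"
  using vector_space.vector_space_assms(3)[OF vector_space_scl, of a b "mor x"] by (intro arrow_eqI) auto
lemma scale_1: "ok x \<Longrightarrow> scale 1 x = x"
  using vector_space.vector_space_assms(4)[OF vector_space_scl, of "mor x"] by (intro arrow_eqI) auto

lemma tensor_power_obj [simp]: "X \<in> obj C \<Longrightarrow> tensor_power C X n \<in> obj C"
  by (induction n) auto

text \<open>The isomorphism between \<open>X \<otimes> X ^ n\<close> and \<open>X ^ n \<otimes> X\<close> by associativity alone.\<close>
primrec shift :: "'o \<Rightarrow> nat \<Rightarrow> ('o, 'm) arrow" where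
  "shift X 0 = lui X \<bullet> ru X"
| "shift X (Suc n) = (shift X n \<lhd> X) \<bullet> \<alpha>i X (tensor_power C X n) X"

lemma shift_typ [simp]: "X \<in> obj C \<Longrightarrow> ok (shift X n) \<and> src (shift X n) = X \<otimes> tensor_power C X n \<and> tgt (shift X n) = tensor_power C X n \<otimes> X"
  by (induction n) auto

primrec unshift :: "'o \<Rightarrow> nat \<Rightarrow> ('o, 'm) arrow" where
  "unshift X 0 = rui X \<bullet> lu X"
| "unshift X (Suc n) = \<alpha> X (tensor_power C X n) X \<bullet> (unshift X n \<lhd> X)"

lemma unshift_typ [simp]: "X \<in> obj C \<Longrightarrow> ok (unshift X n) \<and> tgt (unshift X n) = X \<otimes> tensor_power C X n \<and> src (unshift X n) = tensor_power C X n \<otimes> X"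
  by (induction n) auto

lemma shift_inv: "X \<in> obj C \<Longrightarrow> shift X n \<bullet> unshift X n = Id (tensor_power C X n \<otimes> X)"
  "X \<in> obj C \<Longrightarrow> unshift X n \<bullet> shift X n = Id (X \<otimes> tensor_power C X n)"
  by (induction n) (auto simp: rwhisk_inv reassoc[OF rwhisk_inv])

lemma cap_iso:
  assumes g: "pairing g X Y" and gi: "ok gi" "src gi = \<one>" "tgt gi = X \<otimes> Y" and inv: "g \<bullet> gi = Id \<one>" "gi \<bullet> g = Id (X \<otimes> Y)"
    and [simp]: "W \<in> obj C"
  shows "cap g X Y W \<bullet> (\<alpha> X Y W \<bullet> ((gi \<lhd> W) \<bullet> lui W)) = Id W"
    "(\<alpha> X Y W \<bullet> ((gi \<lhd> W) \<bullet> lui W)) \<bullet> cap g X Y W = Id (X \<otimes> (Y \<otimes> W))"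
  using pairingD[OF g] gi by (simp_all add: cap_def reassoc[OF rwhisk_inv[OF inv(1)]] reassoc[OF rwhisk_inv[OF inv(2)]])

end

context spherical_fusion_category
begin

text \<open>The counterpart of \<open>pev_natural\<close> for coevaluations.  The dual of \<open>f\<close> is \<open>f\<close> with both legs bent, and one
of the bends is straightened by the coevaluation of \<open>Y\<close>.\<close>
lemma cocup_slide:
  assumes f [simp]: "ok f" "src f = X" "tgt f = Y" and [simp]: "W \<in> obj C"
  shows "(f \<lhd> (X\<^sup>\<star> \<otimes> W)) \<bullet> cocup X W = (Y \<rhd> (dualA f \<lhd> W)) \<bullet> cocup Y W"
proof -
  have [simp]: "X \<in> obj C" "Y \<in> obj C" using src_obj[OF f(1)] tgt_obj[OF f(1)] by simp_all
  let ?h = "(f \<lhd> (X\<^sup>\<star> \<otimes> W)) \<bullet> cocup X W"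
  let ?ec = "cap (evA Y) (Y\<^sup>\<star>) Y"
  have "dualA f \<lhd> W = cap (evA Y \<bullet> (Y\<^sup>\<star> \<rhd> f)) (Y\<^sup>\<star>) X (X\<^sup>\<star> \<otimes> W) \<bullet> (Y\<^sup>\<star> \<rhd> cocup X W)"
    using dualA_pairing[of f] unfolding dualA_def by (simp add: to_dual_whisker[OF duality_ev])
  also have "\<dots> = ?ec (X\<^sup>\<star> \<otimes> W) \<bullet> (Y\<^sup>\<star> \<rhd> ?h)"
    by (subst cap_pre2[of _ _ Y]) simp_all
  finally have "(Y \<rhd> (dualA f \<lhd> W)) \<bullet> cocup Y W = (Y \<rhd> ?ec (X\<^sup>\<star> \<otimes> W)) \<bullet> ((Y \<rhd> Y\<^sup>\<star> \<rhd> ?h) \<bullet> cocup Y W)"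
    by simp
  also have "\<dots> = ((Y \<rhd> ?ec (X\<^sup>\<star> \<otimes> W)) \<bullet> cocup Y (Y \<otimes> (X\<^sup>\<star> \<otimes> W))) \<bullet> ?h"
    by (subst cup_natural[OF duality_ev, of Y ?h, symmetric]) simp_all
  also have "\<dots> = ?h" by (simp add: zigzag1[OF duality_ev])
  finally show ?thesis by simp
qed

text \<open>Slide \<open>p\<close> through the coevaluation to become its dual, past \<open>u\<close>, and back through the evaluation.\<close>
lemma trace_cyclic:
  assumes u [simp]: "ok u" "src u = X" "tgt u = Y" and p [simp]: "ok p" "src p = Y" "tgt p = X" and [simp]: "W \<in> obj C"
  shows "pcap Y W \<bullet> (((u \<bullet> p) \<lhd> (Y\<^sup>\<star> \<otimes> W)) \<bullet> cocup Y W) = pcap X W \<bullet> (((p \<bullet> u) \<lhd> (X\<^sup>\<star> \<otimes> W)) \<bullet> cocup X W)"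
proof -
  have [simp]: "X \<in> obj C" "Y \<in> obj C" using src_obj[OF u(1)] tgt_obj[OF u(1)] by simp_all
  have "pcap Y W \<bullet> (((u \<bullet> p) \<lhd> (Y\<^sup>\<star> \<otimes> W)) \<bullet> cocup Y W) = pcap Y W \<bullet> ((u \<lhd> (Y\<^sup>\<star> \<otimes> W)) \<bullet> ((X \<rhd> (dualA p \<lhd> W)) \<bullet> cocup X W))"
    by (simp add: cocup_slide[of p])
  also have "\<dots> = (pcap Y W \<bullet> (Y \<rhd> (dualA p \<lhd> W))) \<bullet> ((u \<lhd> (X\<^sup>\<star> \<otimes> W)) \<bullet> cocup X W)"
    by (simp add: reassoc[OF interchange[of u "dualA p \<lhd> W"]])
  also have "pcap Y W \<bullet> (Y \<rhd> (dualA p \<lhd> W)) = cap (pev Y \<bullet> (Y \<rhd> dualA p)) Y (X\<^sup>\<star>) W"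
    by (rule cap_pre2[symmetric]) simp_all
  also have "pev Y \<bullet> (Y \<rhd> dualA p) = pev X \<bullet> (p \<lhd> X\<^sup>\<star>)"
    by (rule pev_natural[symmetric]) simp_all
  also have "cap (pev X \<bullet> (p \<lhd> X\<^sup>\<star>)) Y (X\<^sup>\<star>) W = pcap X W \<bullet> (p \<lhd> (X\<^sup>\<star> \<otimes> W))"
    by (rule cap_pre1) simp_all
  finally show ?thesis by simp
qed

definition dim_arrow :: "'o \<Rightarrow> ('o, 'm) arrow" where "dim_arrow X = pcap X \<one> \<bullet> cocup X \<one>"

end

text \<open>The tensor power is \<open>Suc n\<close> so that the power \<open>n\<close> is a tensor inverse of \<open>X\<close>.\<close>
locale torsion_object = spherical_fusion_category C
  for C :: "('o, 'm::ab_group_add, 'z) pivotal_cat_scheme" (structure) +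
  fixes X :: 'o and n :: nat and f fi :: "('o, 'm) arrow"
  assumes X_obj [simp]: "X \<in> obj C" and X_simple: "simple C X"
    and f [simp]: "ok f" "src f = tensor_power C X (Suc n)" "tgt f = \<one>"
    and fi [simp]: "ok fi" "src fi = \<one>" "tgt fi = tensor_power C X (Suc n)"
    and f_inv: "f \<bullet> fi = Id \<one>" "fi \<bullet> f = Id (tensor_power C X (Suc n))"
begin

text \<open>With \<open>G = X ^ n\<close>, both \<open>G \<otimes> X\<close> and \<open>X \<otimes> G\<close> are isomorphic to the unit.  The first isomorphism gives a
candidate \<open>u\<close> with \<open>G \<otimes> (X \<otimes> u) = G \<otimes> h\<close>, and by the second one tensoring with \<open>G\<close> is faithful.\<close>
lemma lwhisk_full:
  assumes V [simp]: "V \<in> obj C" and W [simp]: "W \<in> obj C" and h [simp]: "ok h" "src h = X \<otimes> V" "tgt h = X \<otimes> W"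
  obtains u where "ok u" "src u = V" "tgt u = W" "h = X \<rhd> u"
proof -
  define G where "G = tensor_power C X n"
  have G [simp]: "G \<in> obj C" "tensor_power C X n = G" by (simp_all add: G_def)
  have p1 [simp]: "pairing f G X" by (simp add: pairing_def)
  define f2 where "f2 = f \<bullet> shift X n"
  have p2 [simp]: "pairing f2 X G" by (simp add: pairing_def f2_def)
  have f2_inv: "f2 \<bullet> (unshift X n \<bullet> fi) = Id \<one>" "(unshift X n \<bullet> fi) \<bullet> f2 = Id (X \<otimes> G)"
    unfolding f2_def
    by (simp_all add: inv_cancel[OF shift_inv(1)] inv_cancel[OF f_inv(2)] f_inv shift_inv)
  have G_faithful: "a = b" if [simp]: "ok a" "ok b" "src b = src a" "tgt b = tgt a" and eq: "G \<rhd> a = G \<rhd> b" for a b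
  proof -
    have "a \<bullet> cap f2 X G (src a) = cap f2 X G (tgt a) \<bullet> (X \<rhd> G \<rhd> a)"
      by (simp add: cap_natural)
    also have "\<dots> = b \<bullet> cap f2 X G (src a)"
      unfolding eq by (simp add: cap_natural)
    finally show ?thesis
      by (rule iso_cancel_right[OF cap_iso(1)[OF p2 _ _ _ f2_inv], rotated -1]) simp_all
  qed
  define \<psi> where "\<psi> Z = cap f G X Z" for Z
  define \<psi>i where "\<psi>i Z = \<alpha> G X Z \<bullet> ((fi \<lhd> Z) \<bullet> lui Z)" for Z
  have \<psi> [simp]: "ok (\<psi> Z)" "src (\<psi> Z) = G \<otimes> (X \<otimes> Z)" "tgt (\<psi> Z) = Z" if "Z \<in> obj C" for Z
    using that by (simp_all add: \<psi>_def)
  have \<psi>i [simp]: "ok (\<psi>i Z)" "tgt (\<psi>i Z) = G \<otimes> (X \<otimes> Z)" "src (\<psi>i Z) = Z" if "Z \<in> obj C" for Z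
    using that by (simp_all add: \<psi>i_def)
  have \<psi>_inv: "\<psi> Z \<bullet> \<psi>i Z = Id Z" "\<psi>i Z \<bullet> \<psi> Z = Id (G \<otimes> (X \<otimes> Z))" if "Z \<in> obj C" for Z
    using cap_iso[OF p1 fi(1,2) _ f_inv(1) _ that] f_inv(2) unfolding \<psi>_def \<psi>i_def by simp_all
  define u where "u = \<psi> W \<bullet> ((G \<rhd> h) \<bullet> \<psi>i V)"
  have u [simp]: "ok u" "src u = V" "tgt u = W" by (simp_all add: u_def)
  \<comment> \<open>Conjugation by \<open>\<psi>\<close> identifies \<open>G \<otimes> (X \<otimes> -)\<close> with the identity functor.\<close>
  have "\<psi> W \<bullet> (G \<rhd> X \<rhd> u) = u \<bullet> \<psi> V" unfolding \<psi>_def by (rule cap_natural) simp_all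
  also have "\<dots> = \<psi> W \<bullet> (G \<rhd> h)" by (simp add: u_def \<psi>_inv)
  finally have "G \<rhd> X \<rhd> u = G \<rhd> h"
    by (rule iso_cancel_left[OF \<psi>_inv(2), rotated -1]) simp_all
  then have "X \<rhd> u = h" by - (rule G_faithful, simp_all)
  then show ?thesis by (intro that[of u]) simp_all
qed

lemma dim_arrow_scalar: "\<exists>\<delta>. dim_arrow X = scale \<delta> (Id \<one>)"
proof -
  have d: "ok (dim_arrow X)" "src (dim_arrow X) = \<one>" "tgt (dim_arrow X) = \<one>" by (simp_all add: dim_arrow_def)
  then obtain \<delta> where "mor (dim_arrow X) = scl C \<delta> (\<i> \<one>)"
    using schur_scalar[OF unit_simple] mor_hom[of "dim_arrow X"] by auto
  with d show ?thesis by (intro exI[of _ \<delta>] arrow_eqI) simp_all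
qed

end

locale torsion_object_center = torsion_object C X n f fi + half_braided C A e
  for C :: "('o, 'm::ab_group_add, 'z) pivotal_cat_scheme" (structure) and X n f fi A e +
  fixes \<theta> :: complex
  assumes twist_arrow_scalar: "twist_arrow = scale \<theta> (Id A)"
begin

text \<open>For every \<open>p : A \<rightarrow> X\<close>, naturality of the half-braiding moves \<open>p\<close> through the crossing in the loop of
the twist, and the premise on \<open>i\<close> then resolves the crossing.  What remains is \<open>X\<close> next to a closed
loop, the trace of \<open>u \<circ> p\<close>.  By cyclicity this is the trace of \<open>p \<circ> u\<close>, a multiple of the dimension
\<open>\<delta>\<close> of \<open>X\<close>.\<close>
lemma twist_on_multiplicity_space:
  assumes i [simp]: "ok i" "src i = X" "tgt i = A" and u [simp]: "ok u" "src u = X" "tgt u = A"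
    and Ei: "E X \<bullet> (i \<lhd> X) = X \<rhd> u" and d: "dim_arrow X = scale \<delta> (Id \<one>)"
  shows "scale \<theta> i = scale \<delta> u"
proof -
  interpret vs: vector_space "scl C" by (rule vector_space_scl)
  have key: "scl C \<theta> (mor p \<cdot> mor i) = scl C \<delta> (mor p \<cdot> mor u)" if p [simp]: "ok p" "src p = A" "tgt p = X" for p
  proof -
    let ?U = "Ad \<otimes> \<one>"
    have n: "(p \<lhd> (A \<otimes> ?U)) \<bullet> braid A ?U = braid X ?U \<bullet> (A \<rhd> (p \<lhd> ?U))"
    proof -
      have "((p \<lhd> A) \<bullet> E A) \<lhd> ?U = (E X \<bullet> (A \<rhd> p)) \<lhd> ?U" by (simp only: E_natural[OF p])
      then have h: "(p \<lhd> A \<lhd> ?U) \<bullet> (E A \<lhd> ?U) = (E X \<lhd> ?U) \<bullet> ((A \<rhd> p) \<lhd> ?U)" by simp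
      have "(p \<lhd> (A \<otimes> ?U)) \<bullet> braid A ?U = \<alpha> X A ?U \<bullet> (((p \<lhd> A \<lhd> ?U) \<bullet> (E A \<lhd> ?U)) \<bullet> \<alpha>i A A ?U)"
        by (simp add: cross_def reassoc[OF \<alpha>_natural1])
      also have "\<dots> = braid X ?U \<bullet> (A \<rhd> (p \<lhd> ?U))"
        unfolding h by (simp add: cross_def rwhisk_lwhisk)
      finally show ?thesis .
    qed
    have x: "braid X ?U \<bullet> (i \<lhd> (X \<otimes> ?U)) = X \<rhd> (u \<lhd> ?U)"
    proof -
      have "braid X ?U \<bullet> (i \<lhd> (X \<otimes> ?U)) = \<alpha> X A ?U \<bullet> (((E X \<bullet> (i \<lhd> X)) \<lhd> ?U) \<bullet> \<alpha>i X X ?U)"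
        by (simp add: cross_def rwhisk_rwhisk)
      also have "\<dots> = X \<rhd> (u \<lhd> ?U)" unfolding Ei by (simp add: rwhisk_lwhisk)
      finally show ?thesis .
    qed
    have "(p \<bullet> (twist_arrow \<bullet> i)) \<lhd> \<one> = ((p \<lhd> \<one>) \<bullet> (A \<rhd> pvc \<one>)) \<bullet> (braid A ?U \<bullet> ((A \<rhd> coc \<one>) \<bullet> (i \<lhd> \<one>)))"
      by (simp add: twist_arrow_whisker)
    also have "\<dots> = (X \<rhd> pvc \<one>) \<bullet> (((p \<lhd> (A \<otimes> ?U)) \<bullet> braid A ?U) \<bullet> ((i \<lhd> (A \<otimes> ?U)) \<bullet> (X \<rhd> coc \<one>)))"
      by (simp add: interchange[of p "pvc \<one>"] interchange[of i "coc \<one>"] interchange[of p "pvc \<one>", THEN reassoc])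
    also have "\<dots> = (X \<rhd> pvc \<one>) \<bullet> ((braid X ?U \<bullet> (i \<lhd> (X \<otimes> ?U))) \<bullet> ((X \<rhd> (p \<lhd> ?U)) \<bullet> (X \<rhd> coc \<one>)))"
      unfolding n by (simp add: reassoc[OF interchange[of i "p \<lhd> ?U", symmetric]])
    also have "\<dots> = X \<rhd> (pvc \<one> \<bullet> (((u \<bullet> p) \<lhd> ?U) \<bullet> coc \<one>))"
      unfolding x by simp
    also have "\<dots> = X \<rhd> (pcap X \<one> \<bullet> (((p \<bullet> u) \<lhd> (X\<^sup>\<star> \<otimes> \<one>)) \<bullet> cocup X \<one>))"
      by (subst trace_cyclic[of u X A p]) simp_all
    finally have 1: "(p \<bullet> (twist_arrow \<bullet> i)) \<lhd> \<one> = X \<rhd> (pcap X \<one> \<bullet> (((p \<bullet> u) \<lhd> (X\<^sup>\<star> \<otimes> \<one>)) \<bullet> cocup X \<one>))" .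
    have "mor (p \<bullet> u) \<in> hom C X X" "mor (p \<bullet> i) \<in> hom C X X"
      using mor_hom[of "p \<bullet> u"] mor_hom[of "p \<bullet> i"] by simp_all
    then obtain c c' where c: "mor (p \<bullet> u) = scl C c (\<i> X)" "mor (p \<bullet> i) = scl C c' (\<i> X)"
      using schur_scalar[OF X_simple] by metis
    have pu: "p \<bullet> u = scale c (Id X)" "p \<bullet> i = scale c' (Id X)" using c by (auto intro!: arrow_eqI)
    have "p \<bullet> (twist_arrow \<bullet> i) = scale \<theta> (p \<bullet> i)"
      by (simp add: twist_arrow_scalar scale_comp_left scale_comp_right)
    also have "\<dots> = scale (\<theta> * c') (Id X)" by (simp add: pu scale_sc)
    finally have "scale (\<theta> * c') (Id (X \<otimes> \<one>)) = (p \<bullet> (twist_arrow \<bullet> i)) \<lhd> \<one>" by (simp add: scale_rwh)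
    also have "\<dots> = X \<rhd> scale c (dim_arrow X)"
      unfolding 1 pu by (simp add: scale_rwh scale_comp_left scale_comp_right dim_arrow_def)
    also have "\<dots> = scale (c * \<delta>) (Id (X \<otimes> \<one>))" by (simp add: d scale_lwh scale_sc)
    finally have "(scale (\<theta> * c') (Id X)) \<lhd> \<one> = (scale (c * \<delta>) (Id X)) \<lhd> \<one>" by (simp add: scale_rwh)
    then have "scale (\<theta> * c') (Id X) = scale (c * \<delta>) (Id X)"
      by - (rule rwhisk_unit_faithful, simp_all)
    then have "mor (scale (\<theta> * c') (Id X)) = mor (scale (c * \<delta>) (Id X))" by simp
    then show ?thesis using c by (simp add: mor_comp mult.commute)
  qed
  have im: "mor i \<in> hom C X A" "mor u \<in> hom C X A" using mor_hom[of i] mor_hom[of u] by simp_all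
  have "scl C \<theta> (mor i) - scl C \<delta> (mor u) = 0"
  proof (rule zero_if_composites_zero[OF X_obj A_obj])
    show "scl C \<theta> (mor i) - scl C \<delta> (mor u) \<in> hom C X A" by (intro hom_diff hom_scl im) simp_all
    fix q assume q: "q \<in> hom C A X"
    have "q \<cdot> (scl C \<theta> (mor i) - scl C \<delta> (mor u)) = scl C \<theta> (q \<cdot> mor i) - scl C \<delta> (q \<cdot> mor u)"
      using q im by (simp add: cmp_diff_right[of X A X] hom_scl cmp_scl_right[of X A X])
    also have "\<dots> = 0" using key[of "arrow A X q"] q by (simp add: arrow_ok)
    finally show "q \<cdot> (scl C \<theta> (mor i) - scl C \<delta> (mor u)) = 0" .
  qed
  then show ?thesis by (intro arrow_eqI) simp_all
qed

lemma power_braiding: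
  assumes i [simp]: "ok i" "src i = X" "tgt i = A" and b: "E X \<bullet> (i \<lhd> X) = scale b (X \<rhd> i)"
  shows "E (tensor_power C X m) \<bullet> (i \<lhd> tensor_power C X m) = scale (b ^ m) ((tensor_power C X m \<rhd> i) \<bullet> shift X m)"
proof (induction m)
  case 0
  have "E \<one> = lui A \<bullet> ru A" using E_unit solve_left[of "lui A" "lu A" _ "E \<one>"] by simp
  then show ?case by (simp add: scale_1 ru_natural[of i] reassoc[OF lui_natural[of i]])
next
  case (Suc m)
  define P where "P = tensor_power C X m"
  have [simp]: "P \<in> obj C" "tensor_power C X m = P" by (simp_all add: P_def)
  have hex: "E (P \<otimes> X) = \<alpha>i P X A \<bullet> ((P \<rhd> E X) \<bullet> (\<alpha> P A X \<bullet> ((E P \<lhd> X) \<bullet> \<alpha>i A P X)))"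
  proof -
    have "E (P \<otimes> X) = \<alpha>i P X A \<bullet> ((\<alpha> P X A \<bullet> (E (P \<otimes> X) \<bullet> \<alpha> A P X)) \<bullet> \<alpha>i A P X)" by simp
    then show ?thesis by (subst (asm) E_hexagon) simp_all
  qed
  have "E (P \<otimes> X) \<bullet> (i \<lhd> (P \<otimes> X)) = \<alpha>i P X A \<bullet> ((P \<rhd> E X) \<bullet> (\<alpha> P A X \<bullet> (((E P \<bullet> (i \<lhd> P)) \<lhd> X) \<bullet> \<alpha>i X P X)))"
    by (simp add: hex rwhisk_rwhisk)
  also have "\<dots> = scale (b ^ m) (\<alpha>i P X A \<bullet> ((P \<rhd> (E X \<bullet> (i \<lhd> X))) \<bullet> (\<alpha> P X X \<bullet> ((shift X m \<lhd> X) \<bullet> \<alpha>i X P X))))"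
    using Suc.IH by (simp add: scale_rwh scale_comp_left scale_comp_right reassoc[OF \<alpha>_natural2])
  also have "\<dots> = scale (b ^ Suc m) (((P \<otimes> X) \<rhd> i) \<bullet> ((shift X m \<lhd> X) \<bullet> \<alpha>i X P X))"
    unfolding b by (simp add: scale_lwh scale_comp_left scale_comp_right scale_sc lwhisk_tensor mult.commute)
  finally show ?case by simp
qed

text \<open>If \<open>\<delta> = 0\<close>, the equation says nothing about \<open>\<theta>\<close>, as its left-hand side may contain a zero morphism;
hence the second claim.\<close>
lemma twist_power:
  assumes i0: "i0 \<in> hom C X A" "i0 \<noteq> 0" and d: "dim_arrow X = scale \<delta> (Id \<one>)"
  shows "scl C (\<theta> ^ Suc n) (mor ((f \<lhd> X) \<bullet> shift X (Suc n))) = scl C (\<delta> ^ Suc n) (mor (lui X \<bullet> (ru X \<bullet> (X \<rhd> f))))"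
    "\<delta> = 0 \<Longrightarrow> \<theta> = 0"
proof -
  interpret vs: vector_space "scl C" by (rule vector_space_scl)
  define i where "i = arrow X A i0"
  have i [simp]: "ok i" "src i = X" "tgt i = A" "mor i = i0" using i0 by (simp_all add: i_def arrow_ok)
  obtain u where u: "ok u" "src u = X" "tgt u = A" "E X \<bullet> (i \<lhd> X) = X \<rhd> u"
    by (rule lwhisk_full[of X A "E X \<bullet> (i \<lhd> X)"]) simp_all
  have tu: "scale \<theta> i = scale \<delta> u" using twist_on_multiplicity_space[OF i(1-3) u d] .
  show z: "\<delta> = 0 \<Longrightarrow> \<theta> = 0" using arg_cong[OF tu, of mor] u i0 by simp
  show "scl C (\<theta> ^ Suc n) (mor ((f \<lhd> X) \<bullet> shift X (Suc n))) = scl C (\<delta> ^ Suc n) (mor (lui X \<bullet> (ru X \<bullet> (X \<rhd> f))))"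
  proof (cases "\<delta> = 0")
    case True
    then show ?thesis using z by simp
  next
    case False
    define b where "b = \<theta> / \<delta>"
    have "u = scale (1 / \<delta>) (scale \<delta> u)" using False u by (simp add: scale_sc scale_1)
    also have "\<dots> = scale b i" unfolding tu[symmetric] by (simp add: scale_sc b_def)
    finally have b: "E X \<bullet> (i \<lhd> X) = scale b (X \<rhd> i)" using u by (simp add: scale_lwh)
    \<comment> \<open>A retraction of \<open>i\<close>, needed to remove \<open>i\<close> from the final equation.\<close>
    obtain g where g: "g \<in> hom C A X" "i0 \<cdot> (g \<cdot> i0) = i0" using regular[OF X_obj A_obj i0(1)] by blast
    have gi: "g \<cdot> i0 \<in> hom C X X" using cmp_in_hom g i0 X_obj A_obj by blast
    then obtain c where c: "g \<cdot> i0 = scl C c (\<i> X)" using schur_scalar[OF X_simple] by blast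
    have "scl C c i0 = i0" using g(2) i0 unfolding c
      by (simp add: cmp_scl_right[of X X A] idm_in_hom cmp_idm_right[of X A i0])
    then have "c = 1" using i0 vs.scale_right_imp_eq[of i0 c 1] by simp
    then have gi: "arrow A X g \<bullet> i = Id X" using c g by (intro arrow_eqI) (simp_all add: arrow_ok mor_comp)
    note [simp] = arrow_ok[OF A_obj X_obj g(1)]
    let ?P = "tensor_power C X (Suc n)"
    have Pn: "?P = tensor_power C X n \<otimes> X" by simp
    have "scale (b ^ Suc n) ((\<one> \<rhd> i) \<bullet> ((f \<lhd> X) \<bullet> shift X (Suc n))) = (f \<lhd> A) \<bullet> scale (b ^ Suc n) ((?P \<rhd> i) \<bullet> shift X (Suc n))"
      using reassoc[OF interchange[of f i]] f fi by (simp add: scale_comp_right del: shift.simps tensor_power.simps)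
    also have "\<dots> = ((f \<lhd> A) \<bullet> E ?P) \<bullet> (i \<lhd> ?P)"
      unfolding power_braiding[OF i(1-3) b, symmetric] by (simp del: tensor_power.simps)
    also have "\<dots> = E \<one> \<bullet> ((i \<lhd> \<one>) \<bullet> (X \<rhd> f))"
      by (simp add: E_natural[of f ?P \<one>] interchange[of i f] del: tensor_power.simps)
    also have "E \<one> = lui A \<bullet> ru A" using E_unit solve_left[of "lui A" "lu A" _ "E \<one>"] by simp
    also have "(lui A \<bullet> ru A) \<bullet> ((i \<lhd> \<one>) \<bullet> (X \<rhd> f)) = (\<one> \<rhd> i) \<bullet> (lui X \<bullet> (ru X \<bullet> (X \<rhd> f)))"
      by (simp add: reassoc[OF ru_natural[of i]] reassoc[OF lui_natural[of i]] del: tensor_power.simps)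
    finally have "(\<one> \<rhd> arrow A X g) \<bullet> scale (b ^ Suc n) ((\<one> \<rhd> i) \<bullet> ((f \<lhd> X) \<bullet> shift X (Suc n)))
       = (\<one> \<rhd> arrow A X g) \<bullet> ((\<one> \<rhd> i) \<bullet> (lui X \<bullet> (ru X \<bullet> (X \<rhd> f))))" by simp
    then have "scale (b ^ Suc n) ((f \<lhd> X) \<bullet> shift X (Suc n)) = lui X \<bullet> (ru X \<bullet> (X \<rhd> f))"
      by (simp add: scale_comp_right inv_cancel[OF lwhisk_inv[OF gi]] del: shift.simps tensor_power.simps)
    from arg_cong[OF this, of mor]
    have "scl C (b ^ Suc n) (mor ((f \<lhd> X) \<bullet> shift X (Suc n))) = mor (lui X \<bullet> (ru X \<bullet> (X \<rhd> f)))"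
      by (simp del: shift.simps tensor_power.simps)
    then have "scl C (\<delta> ^ Suc n) (mor (lui X \<bullet> (ru X \<bullet> (X \<rhd> f)))) = scl C (\<delta> ^ Suc n * b ^ Suc n) (mor ((f \<lhd> X) \<bullet> shift X (Suc n)))"
      by (metis vs.scale_scale)
    also have "\<delta> ^ Suc n * b ^ Suc n = \<theta> ^ Suc n" using False by (simp add: b_def power_mult_distrib[symmetric] power_divide)
    finally show ?thesis by simp
  qed
qed

end

context spherical_fusion_category
begin

text \<open>The adjunction is a bijection of hom sets that may move 0; but the images of 0 and of the projection
onto the summand are different, so that one of them is nonzero.\<close>
lemma summand_hom_nonzero:
  assumes adj: "induction_functor C Io Ir" and X: "X \<in> obj C" and Y: "simple_summand (drinfeld_center C) (A, e) (Io X)"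
  obtains i where "half_braided C A e" "i \<in> hom C X A" "i \<noteq> 0"
proof -
  let ?Z = "drinfeld_center C"
  have Yo: "(A, e) \<in> obj ?Z" and Ys: "simple ?Z (A, e)" using Y by (auto simp: simple_summand_def simple_def)
  then have A: "A \<in> obj C" and h: "half_braiding C A e" by (auto simp: drinfeld_center_def)
  interpret half_braided C A e by unfold_locales (use A h in auto)
  obtain S s where S: "Io X = (S, s)" by (cases "Io X")
  have So: "(S, s) \<in> obj ?Z" using Y S by (auto simp: simple_summand_def is_direct_sum_def)
  then have S': "S \<in> obj C" "half_braiding C S s" by (auto simp: drinfeld_center_def)
  interpret S: half_braided C S s by unfold_locales (use S' in auto)
  obtain j p where jp: "j \<in> hom C A S" "p \<in> hom C S A" "p \<cdot> j = \<i> A" and p: "p \<in> center_hom C (S, s) (A, e)"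
    using Y unfolding simple_summand_def is_direct_sum_def S by (auto simp: drinfeld_center_def center_hom_def)
  have "p \<noteq> 0"
    using jp center_id_nonzero[OF Ys] cmp_0_left[of A S A j] A S' by auto
  have zz: "0 \<odot> \<i> V = 0" "\<i> V \<odot> 0 = 0" "0 \<cdot> s V = 0" "e V \<cdot> 0 = 0" if "V \<in> obj C" for V
    using that tmor_diff_left[of A A V V 0 0 "\<i> V"] tmor_diff_right[of V V A A "\<i> V" 0 0]
      S.e_tf e_tf S' A cmp_0_left[of "S \<otimes> V" "V \<otimes> S" "V \<otimes> A" "s V"] cmp_0_right[of "S \<otimes> V" "A \<otimes> V" "V \<otimes> A" "e V"]
    by (simp_all add: idm_in_hom family_def)
  have "0 \<in> center_hom C (S, s) (A, e)"
    unfolding center_hom_def using S' A by (auto simp: zz)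
  moreover obtain \<phi> where "bij_betw \<phi> (hom ?Z (Io X) (A, e)) (hom C X (forget_obj (A, e)))"
    using adj X Yo unfolding induction_functor_def left_adjoint_def by blast
  then have b: "inj_on \<phi> (center_hom C (S, s) (A, e))" "\<phi> ` center_hom C (S, s) (A, e) = hom C X A"
    by (simp_all add: bij_betw_def S drinfeld_center_def forget_obj_def)
  ultimately have "\<phi> 0 \<noteq> \<phi> p" "\<phi> 0 \<in> hom C X A" "\<phi> p \<in> hom C X A"
    using p \<open>p \<noteq> 0\<close> by (auto dest: inj_onD)
  then have "\<exists>i\<in>hom C X A. i \<noteq> 0" by metis
  then show ?thesis using that half_braided_axioms by blast
qed

end

theorem proposition3p8:
  fixes C :: "('o, 'm::ab_group_add) pivotal_cat"
    and X :: 'o and n :: nat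
    and Io :: "'o \<Rightarrow> 'o \<times> ('o \<Rightarrow> 'm)" and Ir :: "'o \<Rightarrow> 'o \<Rightarrow> 'm \<Rightarrow> 'm"
  assumes "spherical_fusion_category C"
    and "induction_functor C Io Ir"
    and "simple C X"
    and "n \<ge> 1"
    and "isomorphic C (tensor_power C X n) (unit C)"
  shows "\<forall>Y Y'. simple_summand (drinfeld_center C) Y (Io X) \<and>
                simple_summand (drinfeld_center C) Y' (Io X)
           \<longrightarrow> twist (drinfeld_center C) Y ^ n = twist (drinfeld_center C) Y' ^ n"
proof -
  interpret spherical_fusion_category C by fact
  interpret vs: vector_space "scl C" by (rule vector_space_scl)
  have X [simp]: "X \<in> obj C" using assms(3) by (simp add: simple_def)
  obtain n0 where n: "n = Suc n0" using assms(4) by (cases n) auto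
  let ?P = "tensor_power C X (Suc n0)"
  obtain f0 g0 where fg: "inverses C ?P (unit C) f0 g0"
    using assms(5) unfolding n isomorphic_def is_iso_def by blast
  define f where "f = arrow ?P (unit C) f0"
  define g where "g = arrow (unit C) ?P g0"
  have f [simp]: "ok f" "src f = ?P" "tgt f = unit C" "mor f = f0"
    using fg by (simp_all add: f_def arrow_ok inverses_def del: tensor_power.simps)
  have g [simp]: "ok g" "src g = unit C" "tgt g = ?P" "mor g = g0"
    using fg by (simp_all add: g_def arrow_ok inverses_def del: tensor_power.simps)
  have inv: "f \<bullet> g = Id (unit C)" "g \<bullet> f = Id ?P"
    using fg by (auto intro!: arrow_eqI simp: inverses_def mor_comp simp del: tensor_power.simps)
  interpret torsion_object C X n0 f g
    by unfold_locales (use assms(3) inv in \<open>simp_all del: tensor_power.simps\<close>)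
  obtain \<delta> where d: "dim_arrow X = scale \<delta> (Id (unit C))" using dim_arrow_scalar by blast
  define m where "m = mor ((f \<lhd> X) \<bullet> shift X (Suc n0))"
  define m' where "m' = mor (lui X \<bullet> (ru X \<bullet> (X \<rhd> f)))"
  have key: "scl C (twist (drinfeld_center C) Y ^ n) m = scl C (\<delta> ^ n) m' \<and> (\<delta> = 0 \<longrightarrow> twist (drinfeld_center C) Y = 0)"
    if Y: "simple_summand (drinfeld_center C) Y (Io X)" for Y
  proof -
    obtain A e where Ae: "Y = (A, e)" by (cases Y)
    obtain i where i: "half_braided C A e" "i \<in> hom C X A" "i \<noteq> 0"
      using summand_hom_nonzero[OF assms(2) X] Y unfolding Ae by blast
    interpret half_braided C A e by (rule i)
    have s: "simple (drinfeld_center C) (A, e)" using Y Ae by (simp add: simple_summand_def)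
    interpret torsion_object_center C X n0 f g A e "twist (drinfeld_center C) (A, e)"
      by unfold_locales (rule arrow_eqI, simp_all add: twist_scalar[OF s])
    show ?thesis using twist_power[OF i(2,3) d] unfolding Ae n m_def m'_def by blast
  qed
  have "m' \<noteq> 0"
  proof
    assume m0: "m' = 0"
    let ?a = "lui X \<bullet> (ru X \<bullet> (X \<rhd> f))" and ?b = "(X \<rhd> g) \<bullet> (rui X \<bullet> lu X)"
    have "?a \<bullet> ?b = Id (unit C \<otimes>\<^bsub>C\<^esub> X)"
      by (simp add: reassoc[OF lwhisk_inv[OF inv(1)]] del: tensor_power.simps)
    then have "mor (?a \<bullet> ?b) = idm C (unit C \<otimes>\<^bsub>C\<^esub> X)" by simp
    moreover have "mor (?a \<bullet> ?b) = cmp C (mor ?a) (mor ?b)"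
      by (rule mor_comp) (simp_all del: tensor_power.simps)
    moreover have "cmp C (mor ?a) (mor ?b) = 0"
      using m0 mor_hom[of ?b] cmp_0_left[of "unit C \<otimes>\<^bsub>C\<^esub> X" "X \<otimes>\<^bsub>C\<^esub> ?P" "unit C \<otimes>\<^bsub>C\<^esub> X" "mor ?b"]
      by (simp add: m'_def del: tensor_power.simps)
    ultimately have z: "Id (unit C \<otimes>\<^bsub>C\<^esub> X) = arrow (unit C \<otimes>\<^bsub>C\<^esub> X) (unit C \<otimes>\<^bsub>C\<^esub> X) 0"
      by (simp add: Id_def)
    have "mor (lu X \<bullet> (Id (unit C \<otimes>\<^bsub>C\<^esub> X) \<bullet> lui X)) = 0"
      unfolding z using cmp_0_left[of X "unit C \<otimes>\<^bsub>C\<^esub> X" "unit C \<otimes>\<^bsub>C\<^esub> X" "lun_inv C X"]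
        cmp_0_right[of X "unit C \<otimes>\<^bsub>C\<^esub> X" X "lun C X"] lun_hom[of X] by (simp add: arrow_ok mor_comp)
    then show False using simple_id_nonzero[OF assms(3)] by simp
  qed
  show ?thesis
  proof (intro allI impI, elim conjE)
    fix Y Y' assume Y: "simple_summand (drinfeld_center C) Y (Io X)" "simple_summand (drinfeld_center C) Y' (Io X)"
    let ?t = "twist (drinfeld_center C) Y" and ?t' = "twist (drinfeld_center C) Y'"
    show "?t ^ n = ?t' ^ n"
    proof (cases "\<delta> = 0")
      case True
      then show ?thesis using key[OF Y(1)] key[OF Y(2)] by simp
    next
      case False
      then have "scl C (\<delta> ^ n) m' \<noteq> 0" using \<open>m' \<noteq> 0\<close> by simp
      then have "m \<noteq> 0" using key[OF Y(1)] by auto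
      moreover have "scl C (?t ^ n) m = scl C (?t' ^ n) m" using key[OF Y(1)] key[OF Y(2)] by simp
      ultimately show ?thesis using vs.scale_right_imp_eq by blast
    qed
  qed
qed

end
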